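(* Let $n_1=n_2=1$, $\theta=1$, and $\Omega=I_1\times I_2$ a bounded open box. Let $u\in L^1_{loc}(\Omega)$ with $\mathcal{E}(u)<\infty$. Then $\mu[u]=\partial_1\partial_2u$ is a finite Radon measure and there exists a Borel set $A\subset\Omega$ such that $\mathcal{H}^1\llcorner A$ is $\sigma$-finite and $\mu[u]=\mu[u]\llcorner A$.
   Context: Setting: $\theta_1,\theta_2>0$ with $\theta_1+\theta_2=\theta$; $\rho\in L^1(\mathbb{R}^2,\mathbb{R}_+)$ radial, supported in $B_1$, $\int\rho=1$, $\rho_\varepsilon(z)=\varepsilon^{-2}\rho(z/\varepsilon)$. $Du(x,z):=u(x+z)-u(x)$; for $z=(z_1,z_2)$, $z_1$ stands for $(z_1,0)$ and $z_2$ for $(0,z_2)$. $I_l^\varepsilon=\{s\in I_l:\operatorname{dist}(s,\mathbb{R}\setminus I_l)>\varepsilon\}$, $\Omega^\varepsilon=I_1^\varepsilon\times I_2^\varepsilon$, $\mathcal{E}_\varepsilon(u)=\int_{\mathbb{R}^2}\int_{\Omega^\varepsilon}|z|^{-2}|Du(x,z_1)|^{\theta_1}|Du(x,z_2)|^{\theta_2}\,dx\,\rho_\varepsilon(z)dz$, $\mathcal{E}(u)=\liminf_{\varepsilon\downarrow0}\mathcal{E}_\varepsilon(u)$. $\mu[u]=\partial_1\partial_2u$ in the sense of distributions. *)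

theory Defs
  imports "HOL-Analysis.Analysis"
begin

type_synonym pt = "real \<times> real"

definition pd1 :: "(pt \<Rightarrow> real) \<Rightarrow> pt \<Rightarrow> real" where
  "pd1 f x = deriv (\<lambda>t. f (t, snd x)) (fst x)"

definition pd2 :: "(pt \<Rightarrow> real) \<Rightarrow> pt \<Rightarrow> real" where
  "pd2 f x = deriv (\<lambda>t. f (fst x, t)) (snd x)"

definition iter_pd :: "bool list \<Rightarrow> (pt \<Rightarrow> real) \<Rightarrow> pt \<Rightarrow> real" where
  "iter_pd ws f = foldr (\<lambda>w g. if w then pd2 g else pd1 g) ws f"

definition smooth_fun :: "(pt \<Rightarrow> real) \<Rightarrow> bool" where
  "smooth_fun f \<longleftrightarrow>
     (\<forall>ws. continuous_on UNIV (iter_pd ws f)) \<and>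
     (\<forall>ws x. (\<lambda>t. iter_pd ws f (t, snd x)) differentiable (at (fst x)) \<and>
             (\<lambda>t. iter_pd ws f (fst x, t)) differentiable (at (snd x)))"

definition test_fun :: "pt set \<Rightarrow> (pt \<Rightarrow> real) \<Rightarrow> bool" where
  "test_fun \<Omega> \<phi> \<longleftrightarrow> smooth_fun \<phi> \<and>
     compact (closure {x. \<phi> x \<noteq> 0}) \<and> closure {x. \<phi> x \<noteq> 0} \<subseteq> \<Omega>"

definition L1_loc :: "pt set \<Rightarrow> (pt \<Rightarrow> real) \<Rightarrow> bool" where
  "L1_loc \<Omega> u \<longleftrightarrow> (\<forall>K. compact K \<and> K \<subseteq> \<Omega> \<longrightarrow> set_integrable lebesgue K u)"

definition inner_set :: "real set \<Rightarrow> real \<Rightarrow> real set" where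
  "inner_set I \<epsilon> = {s \<in> I. infdist s (UNIV - I) > \<epsilon>}"

definition rho_eps :: "(pt \<Rightarrow> real) \<Rightarrow> real \<Rightarrow> pt \<Rightarrow> real" where
  "rho_eps \<rho> \<epsilon> z = \<rho> ((1 / \<epsilon>) *\<^sub>R z) / \<epsilon>\<^sup>2"

definition energy_eps ::
  "real \<Rightarrow> real \<Rightarrow> (pt \<Rightarrow> real) \<Rightarrow> real set \<Rightarrow> real set \<Rightarrow> (pt \<Rightarrow> real) \<Rightarrow> real \<Rightarrow> ennreal" where
  "energy_eps \<theta>1 \<theta>2 \<rho> I1 I2 u \<epsilon> =
     (\<integral>\<^sup>+ z. (\<integral>\<^sup>+ x. indicator (inner_set I1 \<epsilon> \<times> inner_set I2 \<epsilon>) x *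
          ennreal (inverse ((norm z)\<^sup>2) * \<bar>u (x + (fst z, 0)) - u x\<bar> powr \<theta>1
                   * \<bar>u (x + (0, snd z)) - u x\<bar> powr \<theta>2) \<partial>lebesgue)
        * ennreal (rho_eps \<rho> \<epsilon> z) \<partial>lebesgue)"

definition energy ::
  "real \<Rightarrow> real \<Rightarrow> (pt \<Rightarrow> real) \<Rightarrow> real set \<Rightarrow> real set \<Rightarrow> (pt \<Rightarrow> real) \<Rightarrow> ennreal" where
  "energy \<theta>1 \<theta>2 \<rho> I1 I2 u = Liminf (at_right 0) (energy_eps \<theta>1 \<theta>2 \<rho> I1 I2 u)"

definition hausdorff1_delta :: "real \<Rightarrow> pt set \<Rightarrow> ennreal" where
  "hausdorff1_delta \<delta> E =
     (INF C \<in> {C :: nat \<Rightarrow> pt set. E \<subseteq> (\<Union>i. C i) \<and> (\<forall>i. bounded (C i) \<and> diameter (C i) \<le> \<delta>)}.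
        (\<Sum>i. ennreal (diameter (C i))))"

definition hausdorff1 :: "pt set \<Rightarrow> ennreal" where
  "hausdorff1 E = (SUP \<delta> \<in> {0<..}. hausdorff1_delta \<delta> E)"

definition hausdorff1_sigma_finite_on :: "pt set \<Rightarrow> bool" where
  "hausdorff1_sigma_finite_on A \<longleftrightarrow>
     (\<exists>B :: nat \<Rightarrow> pt set. A \<subseteq> (\<Union>k. B k) \<and> (\<forall>k. hausdorff1 (B k) < \<infinity>))"

end

theory Submission
  imports Defs
begin

text \<open>Since \<open>min a b \<le> a\<^sup>\<theta>\<^sup>1 b\<^sup>\<theta>\<^sup>2\<close> and the levels between \<open>u x\<close> and both \<open>u (x + z1)\<close> and \<open>u (x + z2)\<close> have
  measure at most \<open>min \<bar>Du(x, z1)\<bar> \<bar>Du(x, z2)\<bar>\<close>, the energy controls, integrated over \<open>t\<close>, the number of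
  corners of the superlevel sets \<open>{u > t}\<close> sampled on lattices of mesh tending to zero; a suitable random
  position of the lattices makes the samples converge almost everywhere. So for almost every \<open>t\<close> the mixed
  derivative of the indicator of \<open>{u > t}\<close> is a finite sum of Dirac masses, and \<open>\<mu>[u]\<close> is the
  integral of these sums over \<open>t\<close>. In a box containing a single corner of \<open>{u > t}\<close> for each \<open>t\<close> of some set
  of levels, the sets being nested in \<open>t\<close> forces the corners to move along finitely many monotone graphs,
  which have finite length. Countably many rational boxes capture all corners.\<close>

section \<open>Chains and one-dimensional Hausdorff measure\<close>

text \<open>Three obstacles shape the argument. (1) The energy is a liminf of averages over
  directions, so one direction can be extracted only along a sequence of scales. It is taken away
  from the axes: then \<open>|z|^2\<close> is at most a constant times the area of a lattice cell,
  which turns the singular factor into a bounded count. Radiality of \<rho> lets this direction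
  serve with all four sign choices, so that corners of all four orientations are counted. (2) The
  corners of a level come from compactness and choice, so nothing says that they depend measurably
  on the level. Measurability is recovered from their total weight in half-open cells, which is a
  limit of mixed differences of indicators at fixed points; fine cells then separate positive from
  negative weights. (3) Nesting can be exploited only at points where the levels to be compared are
  all controlled. Hence a countable grid common to almost all levels, from which each level drops
  only finitely many lines.\<close>

lemma dist_le_sum_abs:
  fixes x y :: pt
  shows "dist x y \<le> \<bar>fst x - fst y\<bar> + \<bar>snd x - snd y\<bar>"
proof -
  have "dist x y = sqrt ((fst x - fst y)\<^sup>2 + (snd x - snd y)\<^sup>2)"
    by (cases x; cases y) (simp add: dist_Pair_Pair dist_real_def)
  also have "\<dots> \<le> \<bar>fst x - fst y\<bar> + \<bar>snd x - snd y\<bar>"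
    by (rule sqrt_sum_squares_le_sum_abs)
  finally show ?thesis .
qed

text \<open>The sign \<open>s = 1\<close> describes nondecreasing and \<open>s = -1\<close> nonincreasing chains.\<close>

definition chain :: "real \<Rightarrow> pt set \<Rightarrow> bool" where
  "chain s S \<longleftrightarrow> (\<forall>x\<in>S. \<forall>y\<in>S. 0 \<le> s * (fst x - fst y) * (snd x - snd y))"

text \<open>The defining inequality is closed, so it survives limits in both points. This lets the
  carrier be assembled from closed, hence Borel, pieces.\<close>

lemma chain_closure:
  assumes "chain s S"
  shows "chain s (closure S)"
  unfolding chain_def
proof (intro ballI)
  fix x y assume "x \<in> closure S" "y \<in> closure S"
  then obtain f g where f: "\<And>n. f n \<in> S" "f \<longlonglongrightarrow> x" and g: "\<And>n. g n \<in> S" "g \<longlonglongrightarrow> y"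
    by (meson closure_sequential)
  have "(\<lambda>n. s * (fst (f n) - fst (g n)) * (snd (f n) - snd (g n))) \<longlonglongrightarrow>
        s * (fst x - fst y) * (snd x - snd y)"
    by (intro tendsto_intros f g)
  moreover have "\<forall>n. 0 \<le> s * (fst (f n) - fst (g n)) * (snd (f n) - snd (g n))"
    using assms f g unfolding chain_def by blast
  ultimately show "0 \<le> s * (fst x - fst y) * (snd x - snd y)"
    by (meson LIMSEQ_le_const)
qed

text \<open>On a chain the increments of \<open>fst\<close> and of \<open>s * snd\<close> have the
  same sign, so their absolute values add up without cancellation. Thus \<open>fst + s * snd\<close>
  parametrizes the chain with a 1-Lipschitz inverse.\<close>

lemma chain_dist:
  assumes "chain s S" "s = 1 \<or> s = -1" "x \<in> S" "y \<in> S"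
  shows "dist x y \<le> \<bar>(fst x + s * snd x) - (fst y + s * snd y)\<bar>"
proof -
  have "0 \<le> s * (fst x - fst y) * (snd x - snd y)"
    using assms unfolding chain_def by blast
  then have "0 \<le> (fst x - fst y) * (s * (snd x - snd y))"
    by (simp add: ac_simps)
  then have "\<bar>fst x - fst y\<bar> + \<bar>s * (snd x - snd y)\<bar> = \<bar>(fst x - fst y) + s * (snd x - snd y)\<bar>"
    by (auto simp: zero_le_mult_iff)
  moreover have "\<bar>s * (snd x - snd y)\<bar> = \<bar>snd x - snd y\<bar>"
    using assms(2) by auto
  ultimately show ?thesis
    using dist_le_sum_abs[of x y] by (simp add: algebra_simps)
qed

text \<open>The parameter \<open>fst + s * snd\<close> ranges over an interval of length
  \<open>4 * M\<close>. Equal short bands of it cut the chain into pieces no wider than the bands,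
  so the diameters add up to at most \<open>4 * M\<close>, whatever \<delta> is.\<close>

lemma hausdorff1_chain_finite:
  assumes "chain s S" "s = 1 \<or> s = -1" "bounded S"
  shows "hausdorff1 S < \<infinity>"
proof -
  define l where "l x = fst x + s * snd x" for x :: pt
  obtain M where M: "\<And>x. x \<in> S \<Longrightarrow> norm x \<le> M" "M > 0"
    using assms(3) by (auto simp: bounded_pos)
  have l: "\<bar>l x\<bar> \<le> 2 * M" if "x \<in> S" for x
  proof -
    have "\<bar>fst x\<bar> \<le> M" "\<bar>snd x\<bar> \<le> M"
      using M(1)[OF that] norm_fst_le[of "fst x" "snd x"] norm_snd_le[of "snd x" "fst x"] by auto
    then show ?thesis
      using assms(2) unfolding l_def by auto
  qed
  have *: "hausdorff1_delta \<delta> S \<le> ennreal (4 * M + 1)" if "\<delta> > 0" for \<delta>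
  proof -
    define N where "N = nat \<lceil>4 * M / min \<delta> 1\<rceil>"
    define d where "d = 4 * M / real (Suc N)"
    have d: "d > 0" "d \<le> \<delta>"
    proof -
      have "4 * M / min \<delta> 1 \<le> real (Suc N)" unfolding N_def by linarith
      moreover have "0 < min \<delta> 1" using that by simp
      ultimately have "4 * M \<le> real (Suc N) * min \<delta> 1"
        by (simp only: pos_divide_le_eq)
      then have "d \<le> min \<delta> 1" unfolding d_def
        by (subst pos_divide_le_eq) (auto simp only: mult.commute)
      then show "d \<le> \<delta>" by simp
      show "d > 0" using M(2) unfolding d_def by simp
    qed
    define C where "C i = (if i \<le> N then {x \<in> S. l x \<in> {-2*M + real i * d .. -2*M + real (Suc i) * d}} else {})" for i
    have cover: "S \<subseteq> (\<Union>i. C i)"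
    proof
      fix x assume x: "x \<in> S"
      define y where "y = (l x + 2 * M) / d"
      have lx: "0 \<le> l x + 2 * M" "l x + 2 * M \<le> real (Suc N) * d"
        using l[OF x] unfolding d_def by auto
      have y: "0 \<le> y" "y \<le> real (Suc N)"
        unfolding y_def using lx d by (auto simp only: pos_divide_le_eq intro!: divide_nonneg_pos)
      \<comment> \<open>The right end of the range has floor \<open>Suc N\<close>, one past the last
        band, and is put into the closed band \<open>C N\<close>.\<close>
      show "x \<in> (\<Union>i. C i)"
      proof (cases "y = real (Suc N)")
        case True
        then have "l x = -2*M + real (Suc N) * d"
          using d unfolding y_def by (simp add: field_simps)
        then have "x \<in> C N" using x d unfolding C_def by (auto simp: algebra_simps)
        then show ?thesis by blast
      next
        case False
        define i where "i = nat \<lfloor>y\<rfloor>"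
        have i: "real i \<le> y" "y < real (Suc i)" "i \<le> N"
          using y False unfolding i_def by linarith+
        have "real i * d \<le> l x + 2 * M" "l x + 2 * M < real (Suc i) * d"
          using i d unfolding y_def by (auto simp: field_simps)
        then have "x \<in> C i" using x i unfolding C_def by auto
        then show ?thesis by blast
      qed
    qed
    have diam: "diameter (C i) \<le> d" for i
    proof (rule diameter_le)
      show "C i \<noteq> {} \<or> 0 \<le> d" using d by simp
      fix x y assume xy: "x \<in> C i" "y \<in> C i"
      then have "x \<in> S" "y \<in> S" "\<bar>l x - l y\<bar> \<le> d"
        by (auto simp: C_def algebra_simps split: if_splits)
      then show "norm (x - y) \<le> d"
        using chain_dist[OF assms(1,2), of x y] by (simp add: dist_norm l_def)
    qed
    have bdd: "bounded (C i)" for i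
      by (rule bounded_subset[OF assms(3)]) (auto simp: C_def)
    have "hausdorff1_delta \<delta> S \<le> (\<Sum>i. ennreal (diameter (C i)))"
      unfolding hausdorff1_delta_def
      by (rule INF_lower) (use cover diam bdd d in \<open>auto intro: order_trans\<close>)
    also have "\<dots> = (\<Sum>i\<in>{..N}. ennreal (diameter (C i)))"
      by (rule suminf_finite) (auto simp: C_def)
    also have "\<dots> \<le> (\<Sum>i\<in>{..N}. ennreal d)"
      by (intro sum_mono ennreal_leI diam)
    also have "\<dots> = ennreal (real (Suc N) * d)"
      using d by (simp add: ennreal_of_nat_eq_real_of_nat ennreal_mult)
    also have "\<dots> \<le> ennreal (4 * M + 1)"
      unfolding d_def by (intro ennreal_leI) simp
    finally show ?thesis .
  qed
  have "hausdorff1 S \<le> ennreal (4 * M + 1)"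
    unfolding hausdorff1_def using * by (intro SUP_least) auto
  also have "\<dots> < \<infinity>" by simp
  finally show ?thesis .
qed

section \<open>Nested planar patterns with one corner\<close>

definition chain_cover :: "pt set \<Rightarrow> bool" where
  "chain_cover S \<longleftrightarrow>
     (\<exists>\<C>. finite \<C> \<and> S \<subseteq> \<Union>\<C> \<and> (\<forall>C\<in>\<C>. chain 1 C \<or> chain (-1) C))"

lemma chain_coverI: "chain s C \<Longrightarrow> s = 1 \<or> s = -1 \<Longrightarrow> S \<subseteq> C \<Longrightarrow> chain_cover S"
  unfolding chain_cover_def by (rule exI[of _ "{C}"]) auto

lemma chain_cover_Un: "chain_cover S \<Longrightarrow> chain_cover T \<Longrightarrow> chain_cover (S \<union> T)"
  unfolding chain_cover_def
proof (elim exE conjE)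
  fix \<C> \<D>
  assume "finite \<C>" "S \<subseteq> \<Union> \<C>" "\<forall>C\<in>\<C>. chain 1 C \<or> chain (- 1) C"
    "finite \<D>" "T \<subseteq> \<Union> \<D>" "\<forall>C\<in>\<D>. chain 1 C \<or> chain (- 1) C"
  then show "\<exists>\<C>. finite \<C> \<and> S \<union> T \<subseteq> \<Union> \<C> \<and> (\<forall>C\<in>\<C>. chain 1 C \<or> chain (- 1) C)"
    by (intro exI[of _ "\<C> \<union> \<D>"]) auto
qed

lemma chain_cover_mono: "chain_cover T \<Longrightarrow> S \<subseteq> T \<Longrightarrow> chain_cover S"
  unfolding chain_cover_def by blast

text \<open>Reversing the first axis exchanges nondecreasing and nonincreasing chains. Being an
  involution, it carries a cover of the image back to the original set.\<close>

lemma chain_cover_reflect: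
  assumes "chain_cover ((\<lambda>x. (- fst x, snd x)) ` S)"
  shows "chain_cover S"
proof -
  obtain \<C> where C: "finite \<C>" "(\<lambda>x. (- fst x, snd x)) ` S \<subseteq> \<Union>\<C>"
    "\<And>C. C \<in> \<C> \<Longrightarrow> chain 1 C \<or> chain (-1) C"
    using assms unfolding chain_cover_def by blast
  let ?r = "\<lambda>x::pt. (- fst x, snd x)"
  have "chain (- s) (?r ` C)" if "chain s C" for s C
  proof -
    have "0 \<le> - s * (- fst x - - fst y) * (snd x - snd y)" if "x \<in> C" "y \<in> C" for x y
    proof -
      have "0 \<le> s * (fst x - fst y) * (snd x - snd y)"
        using \<open>chain s C\<close> that unfolding chain_def by blast
      then show ?thesis by (simp add: algebra_simps)
    qed
    then show ?thesis unfolding chain_def by auto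
  qed
  from this[of 1] this[of "-1"] have "chain 1 (?r ` C) \<or> chain (-1) (?r ` C)" if "C \<in> \<C>" for C
    using C(3)[OF that] by auto
  moreover have "S \<subseteq> \<Union> ((`) ?r ` \<C>)"
  proof
    fix x assume "x \<in> S"
    then obtain C where "C \<in> \<C>" "?r x \<in> C" using C(2) by blast
    then have "?r (?r x) \<in> ?r ` C" by blast
    then show "x \<in> \<Union> ((`) ?r ` \<C>)" using \<open>C \<in> \<C>\<close> by auto
  qed
  ultimately show ?thesis
    unfolding chain_cover_def using C(1) by (intro exI[of _ "(`) ?r ` \<C>"]) auto
qed

lemma chain_cover_swap:
  assumes "chain_cover (prod.swap ` S)"
  shows "chain_cover S"
proof -
  obtain \<C> where C: "finite \<C>" "prod.swap ` S \<subseteq> \<Union>\<C>"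
    "\<And>C. C \<in> \<C> \<Longrightarrow> chain 1 C \<or> chain (-1) C"
    using assms unfolding chain_cover_def by blast
  have "chain s (prod.swap ` C)" if "chain s C" for s C
    using that unfolding chain_def by (auto simp: ac_simps)
  then have "chain 1 (prod.swap ` C) \<or> chain (-1) (prod.swap ` C)" if "C \<in> \<C>" for C
    using C(3)[OF that] by auto
  moreover have "S \<subseteq> \<Union> ((`) prod.swap ` \<C>)"
  proof
    fix x assume "x \<in> S"
    then obtain C where "C \<in> \<C>" "prod.swap x \<in> C" using C(2) by blast
    then have "prod.swap (prod.swap x) \<in> prod.swap ` C" by blast
    then show "x \<in> \<Union> ((`) prod.swap ` \<C>)" using \<open>C \<in> \<C>\<close> by auto
  qed
  ultimately show ?thesis
    unfolding chain_cover_def using C(1) by (intro exI[of _ "(`) prod.swap ` \<C>"]) auto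
qed

definition dense_in :: "real set \<Rightarrow> real \<Rightarrow> real \<Rightarrow> bool" where
  "dense_in X a b \<longleftrightarrow> (\<forall>c d. a \<le> c \<longrightarrow> c < d \<longrightarrow> d \<le> b \<longrightarrow> (\<exists>x\<in>X. c < x \<and> x < d))"

lemma dense_inE:
  assumes "dense_in X a b" "a \<le> c" "c < d" "d \<le> b"
  obtains x where "x \<in> X" "c < x" "x < d"
  using assms unfolding dense_in_def by blast

lemma dense_inD:
  "dense_in X a b \<Longrightarrow> a \<le> c \<Longrightarrow> c < d \<Longrightarrow> d \<le> b \<Longrightarrow> \<exists>x\<in>X. c < x \<and> x < d"
  unfolding dense_in_def by blast

text \<open>Each level discards its own finite set of grid lines, and comparing two or three levels
  needs points that avoid all their sets at once. If the point found happens to be the removed one,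
  a second one to its left replaces it.\<close>

lemma dense_in_minus_finite:
  assumes "finite F" "dense_in X a b"
  shows "dense_in (X - F) a b"
  using assms
proof (induction F)
  case empty
  then show ?case by simp
next
  case (insert y F)
  show ?case
    unfolding dense_in_def
  proof (intro allI impI)
    fix c d assume cd: "a \<le> c" "c < d" "d \<le> b"
    obtain x where x: "x \<in> X - F" "c < x" "x < d"
      using insert.IH[OF insert.prems] cd by (auto elim: dense_inE)
    obtain x' where x': "x' \<in> X - F" "c < x'" "x' < x"
      using insert.IH[OF insert.prems] cd x by (auto elim!: dense_inE[of _ _ _ c x])
    show "\<exists>x\<in>X - insert y F. c < x \<and> x < d"
      using x x' by (cases "x = y") (auto intro: less_trans)
  qed
qed

lemma dense_in_reflect: "dense_in X a b \<Longrightarrow> dense_in (uminus ` X) (- b) (- a)"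
  unfolding dense_in_def
proof (intro allI impI)
  fix c d assume *: "\<forall>c d. a \<le> c \<longrightarrow> c < d \<longrightarrow> d \<le> b \<longrightarrow> (\<exists>x\<in>X. c < x \<and> x < d)"
    "- b \<le> c" "c < d" "d \<le> - a"
  then obtain x where "x \<in> X" "- d < x" "x < - c"
    by (metis minus_less_iff neg_le_iff_le minus_minus neg_less_iff_less)
  then show "\<exists>x\<in>uminus ` X. c < x \<and> x < d" by (intro bexI[of _ "- x"]) auto
qed

text \<open>A planar 0-1 pattern on \<open>Y1 \<times> Y2\<close> whose mixed second difference is \<open>c\<close> times a Dirac mass
  at \<open>(p1, p2)\<close>.\<close>

definition one_corner :: "real set \<Rightarrow> real set \<Rightarrow> (real \<Rightarrow> real \<Rightarrow> bool) \<Rightarrow> real \<Rightarrow> real \<Rightarrow> real \<Rightarrow> bool" where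
  "one_corner Y1 Y2 \<kappa> p1 p2 c \<longleftrightarrow> c \<noteq> 0 \<and> p1 \<notin> Y1 \<and> p2 \<notin> Y2 \<and>
     (\<forall>a\<in>Y1. \<forall>b\<in>Y1. \<forall>e\<in>Y2. \<forall>f\<in>Y2. a < b \<longrightarrow> e < f \<longrightarrow>
        of_bool (\<kappa> b f) - of_bool (\<kappa> a f) - of_bool (\<kappa> b e) + of_bool (\<kappa> a e)
        = (if a < p1 \<and> p1 < b \<and> e < p2 \<and> p2 < f then c else 0))"

text \<open>No horizontal jump line enters the corner from the left. Together with reflections and
  the swap of the axes this covers all four sides.\<close>

definition left_indep :: "real set \<Rightarrow> real set \<Rightarrow> (real \<Rightarrow> real \<Rightarrow> bool) \<Rightarrow> real \<Rightarrow> bool" where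
  "left_indep Y1 Y2 \<kappa> p1 \<longleftrightarrow> (\<forall>a\<in>Y1. a < p1 \<longrightarrow> (\<forall>e\<in>Y2. \<forall>f\<in>Y2. \<kappa> a e = \<kappa> a f))"

text \<open>A horizontal jump line leaves the corner to the right; \<open>s\<close> records whether
  the pattern is filled above or below it.\<close>

definition right_step :: "bool \<Rightarrow> real set \<Rightarrow> real set \<Rightarrow> (real \<Rightarrow> real \<Rightarrow> bool) \<Rightarrow> real \<Rightarrow> real \<Rightarrow> bool" where
  "right_step s Y1 Y2 \<kappa> p1 p2 \<longleftrightarrow>
     (\<forall>b\<in>Y1. p1 < b \<longrightarrow> (\<forall>f\<in>Y2. \<kappa> b f \<longleftrightarrow> (if s then p2 < f else f < p2)))"

lemma one_corner_reflect:
  assumes "one_corner Y1 Y2 \<kappa> p1 p2 c"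
  shows "one_corner (uminus ` Y1) Y2 (\<lambda>a. \<kappa> (- a)) (- p1) p2 (- c)"
  unfolding one_corner_def
proof (intro conjI ballI impI)
  show "- c \<noteq> 0" "- p1 \<notin> uminus ` Y1" "p2 \<notin> Y2"
    using assms unfolding one_corner_def by auto
next
  fix a b e f
  assume *: "a \<in> uminus ` Y1" "b \<in> uminus ` Y1" "e \<in> Y2" "f \<in> Y2" "a < b" "e < f"
  then have "- a \<in> Y1" "- b \<in> Y1" "- b < - a" by auto
  then have 1: "of_bool (\<kappa> (- a) f) - of_bool (\<kappa> (- b) f) - of_bool (\<kappa> (- a) e) + of_bool (\<kappa> (- b) e)
        = (if - b < p1 \<and> p1 < - a \<and> e < p2 \<and> p2 < f then c else 0)"
    using assms * unfolding one_corner_def by blast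
  have 2: "- b < p1 \<and> p1 < - a \<and> e < p2 \<and> p2 < f \<longleftrightarrow> a < - p1 \<and> - p1 < b \<and> e < p2 \<and> p2 < f"
    by linarith
  have if_minus: "(if P then - c else 0) = - (if P then c else 0)" for P
    by simp
  show "of_bool (\<kappa> (- b) f) - of_bool (\<kappa> (- a) f) - of_bool (\<kappa> (- b) e) + of_bool (\<kappa> (- a) e)
        = (if a < - p1 \<and> - p1 < b \<and> e < p2 \<and> p2 < f then - c else 0)"
    unfolding if_minus using 1[unfolded 2] by linarith
qed

lemma one_corner_swap:
  assumes "one_corner Y1 Y2 \<kappa> p1 p2 c"
  shows "one_corner Y2 Y1 (\<lambda>a b. \<kappa> b a) p2 p1 c"
  unfolding one_corner_def
proof (intro conjI ballI impI)
  show "c \<noteq> 0" "p2 \<notin> Y2" "p1 \<notin> Y1"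
    using assms unfolding one_corner_def by auto
next
  fix a b e f
  assume *: "a \<in> Y2" "b \<in> Y2" "e \<in> Y1" "f \<in> Y1" "a < b" "e < f"
  then have 1: "of_bool (\<kappa> f b) - of_bool (\<kappa> e b) - of_bool (\<kappa> f a) + of_bool (\<kappa> e a)
        = (if e < p1 \<and> p1 < f \<and> a < p2 \<and> p2 < b then c else 0)"
    using assms unfolding one_corner_def by blast
  have 2: "e < p1 \<and> p1 < f \<and> a < p2 \<and> p2 < b \<longleftrightarrow> a < p2 \<and> p2 < b \<and> e < p1 \<and> p1 < f"
    by auto
  show "of_bool (\<kappa> f b) - of_bool (\<kappa> f a) - of_bool (\<kappa> e b) + of_bool (\<kappa> e a)
        = (if a < p2 \<and> p2 < b \<and> e < p1 \<and> p1 < f then c else 0)"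
    using 1[unfolded 2] by linarith
qed

text \<open>Constant columns on the left drop out of the mixed difference, so every column on the
  right jumps by \<open>c\<close> across \<open>p2\<close>. For a 0-1 pattern a nonzero jump fixes
  both values, and the sign of \<open>c\<close> gives the orientation.\<close>

lemma left_indep_right_step:
  assumes corner: "one_corner Y1 Y2 \<kappa> p1 p2 c" and left: "left_indep Y1 Y2 \<kappa> p1"
    and Y: "dense_in Y1 a1 b1" "dense_in Y2 a2 b2"
    and p: "a1 < p1" "p1 < b1" "a2 < p2" "p2 < b2"
  shows "\<exists>s. right_step s Y1 Y2 \<kappa> p1 p2"
proof -
  have nY: "p1 \<notin> Y1" "p2 \<notin> Y2" "c \<noteq> 0"
    using corner unfolding one_corner_def by auto
  obtain a where a: "a \<in> Y1" "a < p1" using Y(1) p by (auto elim: dense_inE[of _ _ _ a1 p1])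
  obtain e0 where e0: "e0 \<in> Y2" "e0 < p2" using Y(2) p by (auto elim: dense_inE[of _ _ _ a2 p2])
  obtain f0 where f0: "f0 \<in> Y2" "p2 < f0" using Y(2) p by (auto elim: dense_inE[of _ _ _ p2 b2])
  have *: "of_bool (\<kappa> b f) - of_bool (\<kappa> b e) = c"
    if "b \<in> Y1" "p1 < b" "e \<in> Y2" "f \<in> Y2" "e < p2" "p2 < f" for b e f
  proof -
    have "of_bool (\<kappa> b f) - of_bool (\<kappa> a f) - of_bool (\<kappa> b e) + of_bool (\<kappa> a e) = c"
      using corner that a unfolding one_corner_def by auto
    moreover have "\<kappa> a f = \<kappa> a e"
      using left a that unfolding left_indep_def by blast
    ultimately show ?thesis by simp
  qed
  have "right_step (c > 0) Y1 Y2 \<kappa> p1 p2"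
    unfolding right_step_def
  proof (intro ballI impI)
    fix b f assume bf: "b \<in> Y1" "p1 < b" "f \<in> Y2"
    show "\<kappa> b f \<longleftrightarrow> (if c > 0 then p2 < f else f < p2)"
    proof (cases "p2 < f")
      case True
      then have "of_bool (\<kappa> b f) - of_bool (\<kappa> b e0) = c" using * bf e0 by blast
      then show ?thesis using True nY by (auto simp: of_bool_def split: if_splits)
    next
      case False
      then have "f < p2" using nY bf by (metis linorder_neqE)
      moreover from this have "of_bool (\<kappa> b f0) - of_bool (\<kappa> b f) = c" using * bf f0 by blast
      ultimately show ?thesis using nY by (auto simp: of_bool_def split: if_splits)
    qed
  qed
  then show ?thesis ..
qed

text \<open>No rectangle to the left of \<open>p1\<close> contains the corner, so there the pattern
  is a function of the abscissa plus a function of the ordinate. A 0-1 valued sum of this kind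
  cannot vary in both variables: if some column varies, all columns coincide.\<close>

lemma not_left_indep_columns_eq:
  assumes corner: "one_corner Y1 Y2 \<kappa> p1 p2 c" and left: "\<not> left_indep Y1 Y2 \<kappa> p1"
    and a: "a \<in> Y1" "a < p1" "a' \<in> Y1" "a' < p1" and g: "g \<in> Y2"
  shows "\<kappa> a g = \<kappa> a' g"
proof -
  define K where "K x y = (of_bool (\<kappa> x y) :: real)" for x y
  have K: "\<kappa> x y = \<kappa> x' y' \<longleftrightarrow> K x y = K x' y'" "K x y = 0 \<or> K x y = 1" for x y x' y'
    unfolding K_def by auto
  have diff: "K b f - K a f = K b e - K a e"
    if ab: "a \<in> Y1" "a < p1" "b \<in> Y1" "b < p1" "e \<in> Y2" "f \<in> Y2" for a b e f
  proof -
    have *: "K b f - K a f = K b e - K a e"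
      if "a \<in> Y1" "a < p1" "b \<in> Y1" "b < p1" "e \<in> Y2" "f \<in> Y2" "a < b" "e < f" for a b e f
    proof -
      have "K b f - K a f - K b e + K a e = 0"
        using corner that unfolding one_corner_def K_def by auto
      then show ?thesis by simp
    qed
    consider "a = b" | "e = f" | "a < b" "e < f" | "b < a" "e < f" | "a < b" "f < e" | "b < a" "f < e"
      by linarith
    then show ?thesis
    proof cases
      case 3
      from *[OF ab(1-6) 3] show ?thesis .
    next
      case 4
      from *[OF ab(3,4,1,2,5,6) 4] show ?thesis by linarith
    next
      case 5
      from *[OF ab(1-4) ab(6,5) 5] show ?thesis by linarith
    next
      case 6
      from *[OF ab(3,4,1,2,6,5) 6] show ?thesis by linarith
    qed simp_all
  qed
  show ?thesis
  proof (rule ccontr)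
    assume ne: "\<kappa> a g \<noteq> \<kappa> a' g"
    \<comment> \<open>At \<open>g\<close> the two columns take the values 0 and 1, and their
      difference is the same at every ordinate; this pins down column \<open>a\<close>
      everywhere.\<close>
    have const: "\<kappa> a e = \<kappa> a g" if "e \<in> Y2" for e
      using diff[OF a that g] ne K(2)[of a e] K(2)[of a g] K(2)[of a' e] K(2)[of a' g]
      unfolding K(1) by linarith
    have "left_indep Y1 Y2 \<kappa> p1"
      unfolding left_indep_def
    proof (intro ballI impI)
      fix x e f assume x: "x \<in> Y1" "x < p1" "e \<in> Y2" "f \<in> Y2"
      show "\<kappa> x e = \<kappa> x f"
        using diff[OF a(1,2) x(1,2,4,3)] const[OF x(3)] const[OF x(4)] unfolding K(1) by linarith
    qed
    with left show False by simp
  qed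
qed

lemma left_indep_reflect:
  "left_indep (uminus ` Y1) Y2 (\<lambda>a. \<kappa> (- a)) (- p1) \<longleftrightarrow>
     (\<forall>a\<in>Y1. p1 < a \<longrightarrow> (\<forall>e\<in>Y2. \<forall>f\<in>Y2. \<kappa> a e = \<kappa> a f))"
  unfolding left_indep_def by auto

text \<open>If jump lines leave the corner on all four sides, the pattern is constant on each of the
  four quadrants. A nonzero mixed difference then leaves only the checkerboard, which is a step on
  the right and the opposite step on the left.\<close>

lemma one_corner_cases:
  assumes corner: "one_corner Y1 Y2 \<kappa> p1 p2 c"
    and Y: "dense_in Y1 a1 b1" "dense_in Y2 a2 b2"
    and p: "a1 < p1" "p1 < b1" "a2 < p2" "p2 < b2"
  obtains "left_indep Y1 Y2 \<kappa> p1"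
  | "left_indep (uminus ` Y1) Y2 (\<lambda>a. \<kappa> (- a)) (- p1)"
  | "left_indep Y2 Y1 (\<lambda>a b. \<kappa> b a) p2"
  | "left_indep (uminus ` Y2) Y1 (\<lambda>a b. \<kappa> b (- a)) (- p2)"
  | s where "right_step s Y1 Y2 \<kappa> p1 p2"
      "right_step (\<not> s) (uminus ` Y1) Y2 (\<lambda>a. \<kappa> (- a)) (- p1) p2"
proof -
  note step = that(5)
  have ?thesis
    if nl: "\<not> left_indep Y1 Y2 \<kappa> p1"
    and nr: "\<not> left_indep (uminus ` Y1) Y2 (\<lambda>a. \<kappa> (- a)) (- p1)"
    and nd: "\<not> left_indep Y2 Y1 (\<lambda>a b. \<kappa> b a) p2"
    and nu: "\<not> left_indep (uminus ` Y2) Y1 (\<lambda>a b. \<kappa> b (- a)) (- p2)"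
  proof -
    have nY: "p1 \<notin> Y1" "p2 \<notin> Y2" "c \<noteq> 0"
      using corner unfolding one_corner_def by auto
    note swap = one_corner_swap[OF corner]
    have L: "\<kappa> a g = \<kappa> a' g" if "a \<in> Y1" "a < p1" "a' \<in> Y1" "a' < p1" "g \<in> Y2" for a a' g
      using not_left_indep_columns_eq[OF corner nl that] .
    have R: "\<kappa> a g = \<kappa> a' g" if "a \<in> Y1" "p1 < a" "a' \<in> Y1" "p1 < a'" "g \<in> Y2" for a a' g
      using not_left_indep_columns_eq[OF one_corner_reflect[OF corner] nr, of "- a" "- a'" g] that
      by simp
    have D: "\<kappa> g a = \<kappa> g a'" if "a \<in> Y2" "a < p2" "a' \<in> Y2" "a' < p2" "g \<in> Y1" for a a' g
      using not_left_indep_columns_eq[OF swap nd that] .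
    have U: "\<kappa> g a = \<kappa> g a'" if "a \<in> Y2" "p2 < a" "a' \<in> Y2" "p2 < a'" "g \<in> Y1" for a a' g
      using not_left_indep_columns_eq[OF one_corner_reflect[OF swap] nu, of "- a" "- a'" g] that
      by simp
    obtain a ea fa where a: "a \<in> Y1" "a < p1" "ea \<in> Y2" "fa \<in> Y2" "\<kappa> a ea \<noteq> \<kappa> a fa"
      using nl unfolding left_indep_def by blast
    obtain b eb fb where b: "b \<in> Y1" "p1 < b" "eb \<in> Y2" "fb \<in> Y2" "\<kappa> b eb \<noteq> \<kappa> b fb"
      using nr unfolding left_indep_reflect by blast
    obtain e where e: "e \<in> Y2" "e < p2" using Y(2) p by (auto elim: dense_inE[of _ _ _ a2 p2])
    obtain f where f: "f \<in> Y2" "p2 < f" using Y(2) p by (auto elim: dense_inE[of _ _ _ p2 b2])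
    have side: "y < p2 \<or> p2 < y" if "y \<in> Y2" for y using that nY by (metis linorder_neqE)
    have col: "\<kappa> x y = \<kappa> x (if y < p2 then e else f)" if "x \<in> Y1" "y \<in> Y2" for x y
      using D[of y e x] U[of y f x] side[of y] that e f by auto
    have ae: "\<kappa> a e \<noteq> \<kappa> a f" using col[of a ea] col[of a fa] a by metis
    have be: "\<kappa> b e \<noteq> \<kappa> b f" using col[of b eb] col[of b fb] b by metis
    have "of_bool (\<kappa> b f) - of_bool (\<kappa> a f) - of_bool (\<kappa> b e) + of_bool (\<kappa> a e) = c"
      using corner a b e f unfolding one_corner_def by auto
    \<comment> \<open>Both columns jump. If they agreed at \<open>f\<close> they would also agree at
      \<open>e\<close>, and the mixed difference would vanish.\<close>
    then have ab: "\<kappa> a f \<noteq> \<kappa> b f" using ae be nY(3) by (auto simp: of_bool_def split: if_splits)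
    have "right_step (\<kappa> b f) Y1 Y2 \<kappa> p1 p2"
      unfolding right_step_def
    proof (intro ballI impI)
      fix x y assume xy: "x \<in> Y1" "p1 < x" "y \<in> Y2"
      have "\<kappa> x y = \<kappa> b y" using R[of x b y] xy b by blast
      then show "\<kappa> x y \<longleftrightarrow> (if \<kappa> b f then p2 < y else y < p2)"
        using col[of b y] be b xy side[of y] by auto
    qed
    moreover have "right_step (\<not> \<kappa> b f) (uminus ` Y1) Y2 (\<lambda>a. \<kappa> (- a)) (- p1) p2"
      unfolding right_step_def
    proof (intro ballI impI)
      fix x y assume xy: "x \<in> uminus ` Y1" "- p1 < x" "y \<in> Y2"
      have "\<kappa> (- x) y = \<kappa> a y" using L[of "- x" a y] xy a by auto
      then show "\<kappa> (- x) y \<longleftrightarrow> (if \<not> \<kappa> b f then p2 < y else y < p2)"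
        using col[of a y] ae ab a xy side[of y] by auto
    qed
    ultimately show ?thesis by (rule step)
  qed
  then show ?thesis using that by blast
qed

text \<open>On a column to the right of both corners the two patterns are half-lines, and nested
  half-lines have ordered end points. An ordinate strictly between wrongly ordered corners, off both
  exceptional sets, would violate the nesting.\<close>

lemma right_step_mono:
  assumes step: "right_step s (X1 - Ft) (X2 - Gt) \<kappa>t p1 p2" "right_step s (X1 - Fu) (X2 - Gu) \<kappa>u q1 q2"
    and X: "dense_in X1 a1 b1" "dense_in X2 a2 b2" "finite Ft" "finite Gt" "finite Fu" "finite Gu"
    and box: "a1 < p1" "p1 < b1" "a2 < p2" "p2 < b2" "a1 < q1" "q1 < b1" "a2 < q2" "q2 < b2"
    and le: "\<And>x y. \<kappa>u x y \<Longrightarrow> \<kappa>t x y"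
  shows "if s then p2 \<le> q2 else q2 \<le> p2"
proof (rule ccontr)
  assume not: "\<not> (if s then p2 \<le> q2 else q2 \<le> p2)"
  have X': "dense_in (X1 - (Ft \<union> Fu)) a1 b1" "dense_in (X2 - (Gt \<union> Gu)) a2 b2"
    using X by (auto intro!: dense_in_minus_finite)
  obtain b where b: "b \<in> X1" "b \<notin> Ft" "b \<notin> Fu" "p1 < b" "q1 < b"
    using dense_inD[OF X'(1), of "max p1 q1" b1] box by (auto simp: le_max_iff_disj)
  have "min p2 q2 < max p2 q2" using not by (auto split: if_splits)
  then obtain f where f: "f \<in> X2" "f \<notin> Gt" "f \<notin> Gu" "min p2 q2 < f" "f < max p2 q2"
    using dense_inD[OF X'(2), of "min p2 q2" "max p2 q2"] box by auto
  have "\<kappa>t b f \<longleftrightarrow> (if s then p2 < f else f < p2)" "\<kappa>u b f \<longleftrightarrow> (if s then q2 < f else f < q2)"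
    using step b f unfolding right_step_def by auto
  with le[of b f] not f show False by (auto split: if_splits)
qed

text \<open>On a family of nested patterns of this type the ordinate of the corner is monotone, while its
  abscissa is quasiconvex in the level, hence monotone on each of two subfamilies.\<close>

lemma chain_cover_left_indep:
  fixes p :: "real \<Rightarrow> pt" and \<kappa> :: "real \<Rightarrow> real \<Rightarrow> real \<Rightarrow> bool"
  assumes X: "dense_in X1 a1 b1" "dense_in X2 a2 b2"
    and F: "\<And>t. t \<in> T \<Longrightarrow> finite (F t)" "\<And>t. t \<in> T \<Longrightarrow> finite (G t)"
    and box: "\<And>t. t \<in> T \<Longrightarrow> a1 < fst (p t) \<and> fst (p t) < b1 \<and> a2 < snd (p t) \<and> snd (p t) < b2"
    and anti: "\<And>t u x y. t < u \<Longrightarrow> \<kappa> u x y \<Longrightarrow> \<kappa> t x y"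
    and left: "\<And>t. t \<in> T \<Longrightarrow> left_indep (X1 - F t) (X2 - G t) (\<kappa> t) (fst (p t))"
    and right: "\<And>t. t \<in> T \<Longrightarrow> right_step s (X1 - F t) (X2 - G t) (\<kappa> t) (fst (p t)) (snd (p t))"
  shows "chain_cover (p ` T)"
proof -
  have snd_mono: "if s then snd (p t) \<le> snd (p u) else snd (p u) \<le> snd (p t)"
    if "t \<in> T" "u \<in> T" "t < u" for t u
    by (rule right_step_mono[OF right[OF that(1)] right[OF that(2)] X F[OF that(1)] F[OF that(2)]])
      (simp_all add: box that(1,2) anti[OF that(3)])
  \<comment> \<open>On a column \<open>a\<close> between the abscissae, the middle level is constant
    while both outer levels jump. The filled part of \<open>t1\<close> is filled in
    \<open>t\<close>, hence the column is filled at both \<open>e\<close> and \<open>f\<close> in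
    \<open>t\<close>, and so in \<open>t0\<close>, contradicting the jump of
    \<open>t0\<close>.\<close>
  have quasi: False
    if t: "t0 \<in> T" "t \<in> T" "t1 \<in> T" "t0 < t" "t < t1" and *: "fst (p t0) < fst (p t)" "fst (p t1) < fst (p t)"
    for t0 t t1
  proof -
    have X': "dense_in (X1 - (F t0 \<union> F t \<union> F t1)) a1 b1" "dense_in (X2 - (G t0 \<union> G t \<union> G t1)) a2 b2"
      using X F t by (auto intro!: dense_in_minus_finite)
    have b: "a1 < fst (p t1)" "fst (p t0) < b1" "fst (p t1) < b1" "a1 < fst (p t)" "fst (p t) < b1" "a1 < fst (p t0)" 
      "a2 < snd (p t)" "snd (p t) < b2" "a2 < snd (p t0)" "snd (p t0) < b2" "a2 < snd (p t1)" "snd (p t1) < b2"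
      using box t by blast+
    obtain a where a: "a \<in> X1" "a \<notin> F t0" "a \<notin> F t" "a \<notin> F t1"
      "fst (p t0) < a" "fst (p t1) < a" "a < fst (p t)"
      using dense_inD[OF X'(1), of "max (fst (p t0)) (fst (p t1))" "fst (p t)"] b * by (auto simp: le_max_iff_disj)
    obtain e where e: "e \<in> X2" "e \<notin> G t0" "e \<notin> G t" "e \<notin> G t1" "e < snd (p t0)" "e < snd (p t1)"
      using dense_inD[OF X'(2), of a2 "min (snd (p t0)) (snd (p t1))"] b by (auto simp: min_le_iff_disj)
    obtain f where f: "f \<in> X2" "f \<notin> G t0" "f \<notin> G t" "f \<notin> G t1" "snd (p t0) < f" "snd (p t1) < f"
      using dense_inD[OF X'(2), of "max (snd (p t0)) (snd (p t1))" b2] b by (auto simp: le_max_iff_disj)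
    have "\<kappa> t a e = \<kappa> t a f"
      using left[OF t(2)] a e f unfolding left_indep_def by blast
    moreover have "\<kappa> t0 a y \<longleftrightarrow> (if s then snd (p t0) < y else y < snd (p t0))" if "y = e \<or> y = f" for y
      using right[OF t(1)] a e f that unfolding right_step_def by auto
    moreover have "\<kappa> t1 a y \<longleftrightarrow> (if s then snd (p t1) < y else y < snd (p t1))" if "y = e \<or> y = f" for y
      using right[OF t(3)] a e f that unfolding right_step_def by auto
    ultimately show False
      using anti[OF t(4), of a] anti[OF t(5), of a] e f
      by (metis (full_types) less_asym)
  qed
  \<comment> \<open>By quasiconvexity every level has its abscissa below those of all earlier or of
    all later levels: \<open>T1\<close> is the decreasing branch and \<open>T2\<close> the
    increasing one.\<close>
  define T1 where "T1 = {t\<in>T. \<forall>t'\<in>T. t' < t \<longrightarrow> fst (p t) \<le> fst (p t')}"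
  define T2 where "T2 = {t\<in>T. \<forall>t'\<in>T. t < t' \<longrightarrow> fst (p t) \<le> fst (p t')}"
  have cover: "p ` T \<subseteq> p ` T1 \<union> p ` T2"
  proof (rule image_subsetI)
    fix t assume t: "t \<in> T"
    have "t \<in> T1 \<or> t \<in> T2"
      unfolding T1_def T2_def mem_Collect_eq using t quasi[of _ t] by (meson not_le)
    then show "p t \<in> p ` T1 \<union> p ` T2" by blast
  qed
  have chainI: "chain \<sigma> (p ` T')"
    if *: "\<And>t u. t \<in> T' \<Longrightarrow> u \<in> T' \<Longrightarrow> t < u \<Longrightarrow> 0 \<le> \<sigma> * (fst (p u) - fst (p t)) * (snd (p u) - snd (p t))"
    for \<sigma> T'
  proof -
    have "0 \<le> \<sigma> * (fst (p t) - fst (p u)) * (snd (p t) - snd (p u))" if "t \<in> T'" "u \<in> T'" for t u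
    proof -
      consider "t < u" | "t = u" | "u < t" by linarith
      then show ?thesis
      proof cases
        case 1
        then show ?thesis using *[OF that 1] by (simp add: algebra_simps)
      next
        case 3
        then show ?thesis using *[OF that(2,1) 3] by (simp add: algebra_simps)
      qed simp
    qed
    then show ?thesis unfolding chain_def by auto
  qed
  define \<sigma> :: real where "\<sigma> = (if s then 1 else -1)"
  have s: "0 \<le> \<sigma> * (snd (p u) - snd (p t))" if "t \<in> T" "u \<in> T" "t < u" for t u
    using snd_mono[OF that] unfolding \<sigma>_def by auto
  have c1: "chain (- \<sigma>) (p ` T1)"
  proof (rule chainI)
    fix t u assume "t \<in> T1" "u \<in> T1" "t < u"
    then have "0 \<le> fst (p t) - fst (p u)" "0 \<le> \<sigma> * (snd (p u) - snd (p t))"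
      using s[of t u] by (auto simp: T1_def)
    from mult_nonneg_nonneg[OF this]
    show "0 \<le> - \<sigma> * (fst (p u) - fst (p t)) * (snd (p u) - snd (p t))" by (simp add: algebra_simps)
  qed
  have c2: "chain \<sigma> (p ` T2)"
  proof (rule chainI)
    fix t u assume "t \<in> T2" "u \<in> T2" "t < u"
    then have "0 \<le> fst (p u) - fst (p t)" "0 \<le> \<sigma> * (snd (p u) - snd (p t))"
      using s[of t u] by (auto simp: T2_def)
    from mult_nonneg_nonneg[OF this]
    show "0 \<le> \<sigma> * (fst (p u) - fst (p t)) * (snd (p u) - snd (p t))" by (simp add: algebra_simps)
  qed
  have 1: "chain_cover (p ` T1)" by (rule chain_coverI[OF c1]) (auto simp: \<sigma>_def)
  have 2: "chain_cover (p ` T2)" by (rule chain_coverI[OF c2]) (auto simp: \<sigma>_def)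
  show ?thesis by (rule chain_cover_mono[OF chain_cover_Un[OF 1 2] cover])
qed

text \<open>The orientation supplied by \<open>left_indep_right_step\<close> may change with the
  level, so the family is split into two subfamilies of fixed orientation.\<close>

lemma chain_cover_left_indep':
  fixes p :: "real \<Rightarrow> pt" and \<kappa> :: "real \<Rightarrow> real \<Rightarrow> real \<Rightarrow> bool"
  assumes X: "dense_in X1 a1 b1" "dense_in X2 a2 b2"
    and F: "\<And>t. t \<in> T \<Longrightarrow> finite (F t)" "\<And>t. t \<in> T \<Longrightarrow> finite (G t)"
    and box: "\<And>t. t \<in> T \<Longrightarrow> a1 < fst (p t) \<and> fst (p t) < b1 \<and> a2 < snd (p t) \<and> snd (p t) < b2"
    and anti: "\<And>t u x y. t < u \<Longrightarrow> \<kappa> u x y \<Longrightarrow> \<kappa> t x y"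
    and corner: "\<And>t. t \<in> T \<Longrightarrow> one_corner (X1 - F t) (X2 - G t) (\<kappa> t) (fst (p t)) (snd (p t)) (c t)"
    and left: "\<And>t. t \<in> T \<Longrightarrow> left_indep (X1 - F t) (X2 - G t) (\<kappa> t) (fst (p t))"
  shows "chain_cover (p ` T)"
proof -
  let ?T = "\<lambda>s. {t \<in> T. right_step s (X1 - F t) (X2 - G t) (\<kappa> t) (fst (p t)) (snd (p t))}"
  have cover: "p ` T \<subseteq> p ` ?T True \<union> p ` ?T False"
    unfolding image_Un[symmetric]
  proof (rule image_mono, rule subsetI)
    fix t assume t: "t \<in> T"
    have "dense_in (X1 - F t) a1 b1" "dense_in (X2 - G t) a2 b2"
      using X F[OF t] by (auto intro: dense_in_minus_finite)
    from left_indep_right_step[OF corner[OF t] left[OF t] this] box[OF t] obtain s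
      where "right_step s (X1 - F t) (X2 - G t) (\<kappa> t) (fst (p t)) (snd (p t))" by blast
    then show "t \<in> ?T True \<union> ?T False" using t by (cases s) auto
  qed
  have "chain_cover (p ` ?T s)" for s
    by (rule chain_cover_left_indep[OF X, where F = F and G = G and \<kappa> = \<kappa> and s = s])
      (erule (1) anti | simp add: F box left)+
  then show ?thesis
    by (intro chain_cover_mono[OF chain_cover_Un cover])
qed

lemma uminus_image_Diff: "uminus ` (X - F) = uminus ` X - uminus ` F" for X :: "real set"
  by (rule image_set_diff) simp

text \<open>Four of the five shapes reduce to the first by a reflection or a swap. For checkerboards
  the steps on the two sides have opposite orientation, so nesting pushes the ordinate of the corner
  both ways and it cannot move: for each orientation the corners lie on one horizontal line.\<close>

lemma chain_cover_one_corner: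
  fixes p :: "real \<Rightarrow> pt" and \<kappa> :: "real \<Rightarrow> real \<Rightarrow> real \<Rightarrow> bool"
  assumes X: "dense_in X1 a1 b1" "dense_in X2 a2 b2"
    and F: "\<And>t. t \<in> T \<Longrightarrow> finite (F t)" "\<And>t. t \<in> T \<Longrightarrow> finite (G t)"
    and box: "\<And>t. t \<in> T \<Longrightarrow> a1 < fst (p t) \<and> fst (p t) < b1 \<and> a2 < snd (p t) \<and> snd (p t) < b2"
    and anti: "\<And>t u x y. t < u \<Longrightarrow> \<kappa> u x y \<Longrightarrow> \<kappa> t x y"
    and corner: "\<And>t. t \<in> T \<Longrightarrow> one_corner (X1 - F t) (X2 - G t) (\<kappa> t) (fst (p t)) (snd (p t)) (c t)"
  shows "chain_cover (p ` T)"
proof -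
  let ?L = "{t\<in>T. left_indep (X1 - F t) (X2 - G t) (\<kappa> t) (fst (p t))}"
  let ?R = "{t\<in>T. left_indep (uminus ` X1 - uminus ` F t) (X2 - G t) (\<lambda>a. \<kappa> t (- a)) (- fst (p t))}"
  let ?D = "{t\<in>T. left_indep (X2 - G t) (X1 - F t) (\<lambda>a b. \<kappa> t b a) (snd (p t))}"
  let ?U = "{t\<in>T. left_indep (uminus ` X2 - uminus ` G t) (X1 - F t) (\<lambda>a b. \<kappa> t b (- a)) (- snd (p t))}"
  let ?C = "\<lambda>s. {t\<in>T. right_step s (X1 - F t) (X2 - G t) (\<kappa> t) (fst (p t)) (snd (p t)) \<and>
    right_step (\<not> s) (uminus ` X1 - uminus ` F t) (X2 - G t) (\<lambda>a. \<kappa> t (- a)) (- fst (p t)) (snd (p t))}"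
  have cover: "p ` T \<subseteq> p ` ?L \<union> p ` ?R \<union> p ` ?D \<union> p ` ?U \<union> (p ` ?C True \<union> p ` ?C False)"
  proof
    fix x assume "x \<in> p ` T"
    then obtain t where t: "t \<in> T" "x = p t" by blast
    have d: "dense_in (X1 - F t) a1 b1" "dense_in (X2 - G t) a2 b2"
      using X F[OF t(1)] by (auto intro: dense_in_minus_finite)
    have b: "a1 < fst (p t)" "fst (p t) < b1" "a2 < snd (p t)" "snd (p t) < b2"
      using box[OF t(1)] by auto
    have "t \<in> ?L \<or> t \<in> ?R \<or> t \<in> ?D \<or> t \<in> ?U \<or> t \<in> ?C True \<or> t \<in> ?C False"
    proof (cases rule: one_corner_cases[OF corner[OF t(1)] d b])
      case (5 s)
      then show ?thesis using t(1) by (cases s) (simp_all add: uminus_image_Diff)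
    qed (simp_all add: t(1) uminus_image_Diff)
    then show "x \<in> p ` ?L \<union> p ` ?R \<union> p ` ?D \<union> p ` ?U \<union> (p ` ?C True \<union> p ` ?C False)"
      using t(2) by blast
  qed
  have L: "chain_cover (p ` ?L)"
    by (rule chain_cover_left_indep'[OF X, where F = F and G = G and \<kappa> = \<kappa> and c = c])
      (erule (1) anti | simp add: F box corner)+
  have R: "chain_cover (p ` ?R)"
  proof (rule chain_cover_reflect, unfold image_image,
      rule chain_cover_left_indep'[OF dense_in_reflect[OF X(1)] X(2), where F = "\<lambda>t. uminus ` F t" and G = G
        and \<kappa> = "\<lambda>t a. \<kappa> t (- a)" and c = "\<lambda>t. - c t"])
    fix t assume "t \<in> ?R"
    then show "one_corner (uminus ` X1 - uminus ` F t) (X2 - G t) (\<lambda>a. \<kappa> t (- a))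
      (fst (- fst (p t), snd (p t))) (snd (- fst (p t), snd (p t))) (- c t)"
      using one_corner_reflect[OF corner[of t]] by (simp add: uminus_image_Diff)
  qed (erule (1) anti | simp add: F box)+
  have D: "chain_cover (p ` ?D)"
  proof (rule chain_cover_swap, unfold image_image,
      rule chain_cover_left_indep'[OF X(2,1), where F = G and G = F
        and \<kappa> = "\<lambda>t a b. \<kappa> t b a" and c = c])
    fix t assume "t \<in> ?D"
    then show "one_corner (X2 - G t) (X1 - F t) (\<lambda>a b. \<kappa> t b a)
      (fst (prod.swap (p t))) (snd (prod.swap (p t))) (c t)"
      using one_corner_swap[OF corner[of t]] by simp
  qed (erule (1) anti | simp add: F box)+
  have U: "chain_cover (p ` ?U)"
  proof (rule chain_cover_swap, rule chain_cover_reflect, unfold image_image,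
      rule chain_cover_left_indep'[OF dense_in_reflect[OF X(2)] X(1), where F = "\<lambda>t. uminus ` G t" and G = F
        and \<kappa> = "\<lambda>t a b. \<kappa> t b (- a)" and c = "\<lambda>t. - c t"])
    fix t assume "t \<in> ?U"
    then show "one_corner (uminus ` X2 - uminus ` G t) (X1 - F t) (\<lambda>a b. \<kappa> t b (- a))
      (fst (- fst (prod.swap (p t)), snd (prod.swap (p t))))
      (snd (- fst (prod.swap (p t)), snd (prod.swap (p t)))) (- c t)"
      using one_corner_reflect[OF one_corner_swap[OF corner[of t]]] by (simp add: uminus_image_Diff)
  qed (erule (1) anti | simp add: F box)+
  have C: "chain_cover (p ` ?C s)" for s
  proof (rule chain_coverI[of 1])
    have *: "snd (p t) = snd (p u)" if t: "t \<in> ?C s" and u: "u \<in> ?C s" and tu: "t < u" for t u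
    proof -
      have tu': "t \<in> T" "u \<in> T"
        "right_step s (X1 - F t) (X2 - G t) (\<kappa> t) (fst (p t)) (snd (p t))"
        "right_step s (X1 - F u) (X2 - G u) (\<kappa> u) (fst (p u)) (snd (p u))"
        "right_step (\<not> s) (uminus ` X1 - uminus ` F t) (X2 - G t) (\<lambda>a. \<kappa> t (- a)) (- fst (p t)) (snd (p t))"
        "right_step (\<not> s) (uminus ` X1 - uminus ` F u) (X2 - G u) (\<lambda>a. \<kappa> u (- a)) (- fst (p u)) (snd (p u))"
        using t u by simp_all
      note fin = F[OF tu'(1)] F[OF tu'(2)]
      have "if s then snd (p t) \<le> snd (p u) else snd (p u) \<le> snd (p t)"
        by (rule right_step_mono[OF tu'(3,4) X fin]) (simp_all add: box tu'(1,2) anti[OF tu])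
      moreover have "if \<not> s then snd (p t) \<le> snd (p u) else snd (p u) \<le> snd (p t)"
        by (rule right_step_mono[OF tu'(5,6) dense_in_reflect[OF X(1)] X(2)])
          (simp_all add: fin box tu'(1,2) anti[OF tu])
      ultimately show ?thesis by (auto split: if_splits)
    qed
    have eq: "snd (p t) = snd (p u)" if "t \<in> ?C s" "u \<in> ?C s" for t u
    proof (cases t u rule: linorder_cases)
      case less
      then show ?thesis by (rule *[OF that])
    next
      case greater
      then show ?thesis by (rule *[OF that(2,1), symmetric])
    qed simp
    show "chain 1 (p ` ?C s)"
      unfolding chain_def
    proof (intro ballI)
      fix x y assume "x \<in> p ` ?C s" "y \<in> p ` ?C s"
      then obtain t u where tu: "x = p t" "t \<in> ?C s" "y = p u" "u \<in> ?C s"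
        by (elim imageE)
      have "snd x = snd y"
        unfolding tu(1,3) by (rule eq[OF tu(2,4)])
      then show "0 \<le> 1 * (fst x - fst y) * (snd x - snd y)" by simp
    qed
  qed simp_all
  show ?thesis
    by (rule chain_cover_mono[OF _ cover]) (intro chain_cover_Un L R D U C)
qed

section \<open>From the energy to difference quotients along two steps\<close>

lemma inner_set_interval:
  assumes "0 \<le> \<epsilon>"
  shows "inner_set {a<..<b::real} \<epsilon> = {a + \<epsilon><..<b - \<epsilon>}"
proof (intro set_eqI iffI)
  fix s assume "s \<in> inner_set {a<..<b} \<epsilon>"
  then have s: "a < s" "s < b" "\<epsilon> < infdist s (UNIV - {a<..<b})"
    unfolding inner_set_def by auto
  moreover have "infdist s (UNIV - {a<..<b}) \<le> dist s a" "infdist s (UNIV - {a<..<b}) \<le> dist s b"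
    by (auto intro: infdist_le)
  ultimately show "s \<in> {a + \<epsilon><..<b - \<epsilon>}" by (auto simp: dist_real_def)
next
  fix s assume s: "s \<in> {a + \<epsilon><..<b - \<epsilon>}"
  have "min (s - a) (b - s) \<le> infdist s (UNIV - {a<..<b})"
  proof -
    have ne: "UNIV - {a<..<b} \<noteq> {}" by (auto intro: exI[of _ a])
    show "min (s - a) (b - s) \<le> infdist s (UNIV - {a<..<b})"
      unfolding infdist_notempty[OF ne]
      by (rule cINF_greatest[OF ne]) (auto simp: dist_real_def min_def not_less)
  qed
  then show "s \<in> inner_set {a<..<b} \<epsilon>"
    using s assms unfolding inner_set_def by auto
qed

text \<open>The factors may be negative, so one change of variables covers both the rescaling by
  \<epsilon> and the sign flips.\<close>

lemma nn_integral_lebesgue_diag: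
  fixes f :: "pt \<Rightarrow> ennreal"
  assumes [measurable]: "f \<in> borel_measurable lebesgue" and "c \<noteq> 0" "d \<noteq> 0"
  shows "(\<integral>\<^sup>+z. f z \<partial>lebesgue) = ennreal (\<bar>c\<bar> * \<bar>d\<bar>) * (\<integral>\<^sup>+z. f (c * fst z, d * snd z) \<partial>lebesgue)"
proof -
  define \<gamma> :: "pt \<Rightarrow> real" where "\<gamma> j = (if j = (1, 0) then c else d)" for j
  have ne: "\<And>j. j \<in> Basis \<Longrightarrow> \<gamma> j \<noteq> 0" using assms by (auto simp: \<gamma>_def)
  have Basis: "(Basis :: pt set) = {(1, 0), (0, 1)}" by (auto simp: Basis_prod_def)
  define T where "T x = 0 + (\<Sum>j\<in>Basis. (\<gamma> j * (x \<bullet> j)) *\<^sub>R j)" for x :: pt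
  have T: "T = (\<lambda>z. (c * fst z, d * snd z))"
    by (rule ext) (simp add: T_def Basis \<gamma>_def prod_eq_iff inner_prod_def)
  have prod: "(\<Prod>j\<in>Basis. \<bar>\<gamma> j\<bar>) = \<bar>c\<bar> * \<bar>d\<bar>" by (simp add: Basis \<gamma>_def)
  have [measurable]: "T \<in> lebesgue \<rightarrow>\<^sub>M lebesgue"
    unfolding T_def by (rule lebesgue_affine_measurable[OF ne])
  have "lebesgue = density (distr lebesgue lebesgue T) (\<lambda>_. (\<Prod>j\<in>Basis. \<bar>\<gamma> j\<bar>))"
    unfolding T_def by (rule lebesgue_affine_euclidean[OF ne])
  then have "(\<integral>\<^sup>+z. f z \<partial>lebesgue) = (\<integral>\<^sup>+z. f z \<partial>density (distr lebesgue lebesgue T) (\<lambda>_. ennreal (\<bar>c\<bar> * \<bar>d\<bar>)))"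
    unfolding prod by simp
  also have "\<dots> = (\<integral>\<^sup>+z. ennreal (\<bar>c\<bar> * \<bar>d\<bar>) * f z \<partial>distr lebesgue lebesgue T)"
    by (subst nn_integral_density) auto
  also have "\<dots> = ennreal (\<bar>c\<bar> * \<bar>d\<bar>) * (\<integral>\<^sup>+z. f z \<partial>distr lebesgue lebesgue T)"
    by (subst nn_integral_cmult) auto
  also have "(\<integral>\<^sup>+z. f z \<partial>distr lebesgue lebesgue T) = (\<integral>\<^sup>+z. f (T z) \<partial>lebesgue)"
    by (subst nn_integral_distr) auto
  finally show ?thesis unfolding T .
qed

text \<open>The inner integral of \<open>energy_eps\<close>, isolated because it has to be evaluated
  at the four reflections of one direction.\<close>

definition inner_energy ::
  "real \<Rightarrow> real \<Rightarrow> pt set \<Rightarrow> (pt \<Rightarrow> real) \<Rightarrow> pt \<Rightarrow> ennreal" where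
  "inner_energy \<theta>1 \<theta>2 U v z = (\<integral>\<^sup>+x. indicator U x *
     ennreal (inverse ((norm z)\<^sup>2) * \<bar>v (x + (fst z, 0)) - v x\<bar> powr \<theta>1
                   * \<bar>v (x + (0, snd z)) - v x\<bar> powr \<theta>2) \<partial>lebesgue)"

lemma measurable_inner_energy:
  assumes [measurable]: "v \<in> borel_measurable borel" "U \<in> sets borel"
  shows "inner_energy \<theta>1 \<theta>2 U v \<in> borel_measurable borel"
proof -
  have "inner_energy \<theta>1 \<theta>2 U v = (\<lambda>z. \<integral>\<^sup>+x. indicator U x *
     ennreal (inverse ((norm z)\<^sup>2) * \<bar>v (x + (fst z, 0)) - v x\<bar> powr \<theta>1
                   * \<bar>v (x + (0, snd z)) - v x\<bar> powr \<theta>2) \<partial>lborel)"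
    unfolding inner_energy_def by (intro ext nn_integral_completion) measurable
  also have "\<dots> \<in> borel_measurable borel"
  proof (rule lborel.borel_measurable_nn_integral)
    have sets: "sets (borel \<Otimes>\<^sub>M lborel) = sets (borel :: (pt \<times> pt) measure)"
      by (simp add: borel_prod[symmetric] cong: sets_pair_measure_cong)
    have cont: "(\<lambda>p::pt \<times> pt. snd p + (fst (fst p), 0)) \<in> borel_measurable borel"
        "(\<lambda>p::pt \<times> pt. snd p + (0, snd (fst p))) \<in> borel_measurable borel"
        "(\<lambda>p::pt \<times> pt. snd p) \<in> borel_measurable borel"
        "(\<lambda>p::pt \<times> pt. norm (fst p)) \<in> borel_measurable borel"
      by (intro borel_measurable_continuous_onI continuous_intros)+
    note [measurable] = cont(4) measurable_compose[OF cont(1) assms(1)] measurable_compose[OF cont(2) assms(1)]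
      measurable_compose[OF cont(3) assms(1)]
      measurable_compose[OF cont(3) borel_measurable_indicator[OF assms(2)]]
    have "(\<lambda>p. indicator U (snd p) *
     ennreal (inverse ((norm (fst p))\<^sup>2) * \<bar>v (snd p + (fst (fst p), 0)) - v (snd p)\<bar> powr \<theta>1
                   * \<bar>v (snd p + (0, snd (fst p))) - v (snd p)\<bar> powr \<theta>2)) \<in> borel_measurable borel"
      by measurable
    then show "(\<lambda>(z, x). indicator U x *
     ennreal (inverse ((norm z)\<^sup>2) * \<bar>v (x + (fst z, 0)) - v x\<bar> powr \<theta>1
                   * \<bar>v (x + (0, snd z)) - v x\<bar> powr \<theta>2)) \<in> borel_measurable (borel \<Otimes>\<^sub>M lborel)"
      by (simp add: measurable_cong_sets[OF sets refl] case_prod_beta')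
  qed
  finally show ?thesis .
qed

text \<open>The Jacobian cancels the normalization of \<open>rho_eps\<close>, and sign flips do not
  change a radial weight. So the four reflected integrals are all equal to the same energy.\<close>

lemma energy_eps_reflect:
  fixes \<rho> :: "pt \<Rightarrow> real"
  assumes v: "v \<in> borel_measurable borel" and \<rho>: "\<rho> \<in> borel_measurable lebesgue" "\<And>z. 0 \<le> \<rho> z"
    and radial: "\<And>z w. norm z = norm w \<Longrightarrow> \<rho> z = \<rho> w"
    and "0 < \<epsilon>" and s: "\<bar>s\<bar> = 1" "\<bar>r\<bar> = 1"
  shows "energy_eps \<theta>1 \<theta>2 \<rho> {a1<..<b1} {a2<..<b2} v \<epsilon> =
    (\<integral>\<^sup>+w. inner_energy \<theta>1 \<theta>2 (inner_set {a1<..<b1} \<epsilon> \<times> inner_set {a2<..<b2} \<epsilon>) v (\<epsilon> * s * fst w, \<epsilon> * r * snd w)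
       * ennreal (\<rho> w) \<partial>lebesgue)"
proof -
  let ?U = "inner_set {a1<..<b1} \<epsilon> \<times> inner_set {a2<..<b2} \<epsilon>"
  let ?E = "inner_energy \<theta>1 \<theta>2 ?U v"
  have "?U \<in> sets borel"
    using \<open>0 < \<epsilon>\<close> by (simp add: inner_set_interval open_Times)
  from measurable_inner_energy[OF v this] have [measurable]: "?E \<in> borel_measurable lebesgue"
    by (auto intro: measurable_completion)
  have [measurable]: "(\<lambda>z. \<rho> ((1 / \<epsilon>) *\<^sub>R z)) \<in> borel_measurable lebesgue"
    using measurable_compose[OF lebesgue_measurable_scaling \<rho>(1)] .
  have scale: "rho_eps \<rho> \<epsilon> (\<epsilon> * s * fst w, \<epsilon> * r * snd w) = \<rho> w / \<epsilon>\<^sup>2" for w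
  proof -
    have "norm (s * fst w, r * snd w) = norm w"
      using s by (cases w) (simp add: norm_Pair power_mult_distrib abs_square_eq_1[symmetric])
    from radial[OF this] show ?thesis
      using \<open>0 < \<epsilon>\<close> by (simp add: rho_eps_def)
  qed
  have "energy_eps \<theta>1 \<theta>2 \<rho> {a1<..<b1} {a2<..<b2} v \<epsilon> = (\<integral>\<^sup>+z. ?E z * ennreal (rho_eps \<rho> \<epsilon> z) \<partial>lebesgue)"
    unfolding energy_eps_def inner_energy_def ..
  also have "\<dots> = ennreal (\<bar>\<epsilon> * s\<bar> * \<bar>\<epsilon> * r\<bar>) * (\<integral>\<^sup>+w. ?E (\<epsilon> * s * fst w, \<epsilon> * r * snd w) *
      ennreal (rho_eps \<rho> \<epsilon> (\<epsilon> * s * fst w, \<epsilon> * r * snd w)) \<partial>lebesgue)"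
    by (rule nn_integral_lebesgue_diag) (use s \<open>0 < \<epsilon>\<close> in \<open>auto simp: rho_eps_def[abs_def]\<close>)
  also have "\<dots> = ennreal (\<epsilon>\<^sup>2) * (\<integral>\<^sup>+w. (?E (\<epsilon> * s * fst w, \<epsilon> * r * snd w) *
      ennreal (\<rho> w)) * ennreal (1 / \<epsilon>\<^sup>2) \<partial>lebesgue)"
    unfolding scale using s \<open>0 < \<epsilon>\<close> \<rho>(2)
    by (simp add: abs_mult power2_eq_square divide_inverse ennreal_mult mult.assoc)
  also have "\<dots> = ennreal (\<epsilon>\<^sup>2) * ((\<integral>\<^sup>+w. ?E (\<epsilon> * s * fst w, \<epsilon> * r * snd w) *
      ennreal (\<rho> w) \<partial>lebesgue) * ennreal (1 / \<epsilon>\<^sup>2))"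
  proof (subst nn_integral_multc)
    have "(\<lambda>w. ?E (\<epsilon> * s * fst w, \<epsilon> * r * snd w)) \<in> borel_measurable lebesgue"
      by (intro measurable_completion measurable_compose[OF _ measurable_inner_energy[OF v \<open>?U \<in> sets borel\<close>]])
        (auto intro!: borel_measurable_continuous_onI continuous_intros)
    then show "(\<lambda>w. ?E (\<epsilon> * s * fst w, \<epsilon> * r * snd w) * ennreal (\<rho> w)) \<in> borel_measurable lebesgue"
      using \<rho>(1) by measurable
  qed simp
  also have "\<dots> = (\<integral>\<^sup>+w. ?E (\<epsilon> * s * fst w, \<epsilon> * r * snd w) * ennreal (\<rho> w) \<partial>lebesgue)"
    using \<open>0 < \<epsilon>\<close> by (simp add: mult.assoc[symmetric] mult.commute[of "ennreal (\<epsilon>\<^sup>2)"])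
      (simp add: mult.assoc ennreal_mult[symmetric])
  finally show ?thesis .
qed

text \<open>The axes are null and \<rho> has total mass 1, so the sets where both coordinates are at
  least \<open>1 / Suc n\<close> in absolute value cannot all have weight zero.\<close>

lemma ex_weight_off_axes:
  fixes \<rho> :: "pt \<Rightarrow> real"
  assumes \<rho>: "integrable lebesgue \<rho>" "\<And>z. 0 \<le> \<rho> z" "\<And>z. 1 \<le> norm z \<Longrightarrow> \<rho> z = 0"
    and int: "(\<integral>z. \<rho> z \<partial>lebesgue) = 1"
  obtains c where "0 < c"
    "0 < (\<integral>\<^sup>+w. ennreal (\<rho> w) * indicator {w. norm w < 1 \<and> c \<le> \<bar>fst w\<bar> \<and> c \<le> \<bar>snd w\<bar>} w \<partial>lebesgue)"
proof (rule ccontr)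
  assume not: "\<not> thesis"
  define W where "W n = {w::pt. norm w < 1 \<and> 1 / real (Suc n) \<le> \<bar>fst w\<bar> \<and> 1 / real (Suc n) \<le> \<bar>snd w\<bar>}" for n
  have [measurable]: "W n \<in> sets lebesgue" for n
  proof -
    have "{w::pt. norm w < 1} \<in> sets borel"
      by (intro borel_open open_Collect_less continuous_intros)
    moreover have "{w::pt. 1 / real (Suc n) \<le> \<bar>fst w\<bar>} \<in> sets borel" "{w::pt. 1 / real (Suc n) \<le> \<bar>snd w\<bar>} \<in> sets borel"
      by (intro borel_closed closed_Collect_le continuous_intros)+
    ultimately have "{w::pt. norm w < 1} \<inter> ({w. 1 / real (Suc n) \<le> \<bar>fst w\<bar>} \<inter> {w. 1 / real (Suc n) \<le> \<bar>snd w\<bar>}) \<in> sets borel"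
      by (intro sets.Int)
    also have "{w::pt. norm w < 1} \<inter> ({w. 1 / real (Suc n) \<le> \<bar>fst w\<bar>} \<inter> {w. 1 / real (Suc n) \<le> \<bar>snd w\<bar>}) = W n"
      unfolding W_def by auto
    finally show ?thesis by auto
  qed
  have [measurable]: "\<rho> \<in> borel_measurable lebesgue" using \<rho>(1) by auto
  have "(\<integral>\<^sup>+w. ennreal (\<rho> w) * indicator (W n) w \<partial>lebesgue) = 0" for n
  proof (rule ccontr)
    assume "(\<integral>\<^sup>+w. ennreal (\<rho> w) * indicator (W n) w \<partial>lebesgue) \<noteq> 0"
    then have "0 < (\<integral>\<^sup>+w. ennreal (\<rho> w) * indicator (W n) w \<partial>lebesgue)"
      by (simp only: zero_less_iff_neq_zero simp_thms)
    then have thesis by (intro that[of "1 / real (Suc n)"]) (simp, simp only: W_def)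
    with not show False ..
  qed
  then have "AE w in lebesgue. ennreal (\<rho> w) * indicator (W n) w = 0" for n
    by (subst (asm) nn_integral_0_iff_AE) auto
  then have ae: "AE w in lebesgue. \<forall>n. ennreal (\<rho> w) * indicator (W n) w = 0"
    by (subst AE_all_countable) blast
  have "negligible {z::pt. z \<bullet> (1, 0) = 0}" "negligible {z::pt. z \<bullet> (0, 1) = 0}"
    by (intro negligible_standard_hyperplane; simp add: Basis_prod_def)+
  then have "{z::pt. z \<bullet> (1, 0) = 0} \<in> null_sets lebesgue" "{z::pt. z \<bullet> (0, 1) = 0} \<in> null_sets lebesgue"
    by (simp_all add: negligible_iff_null_sets)
  then have "AE w::pt in lebesgue. fst w \<noteq> 0" "AE w::pt in lebesgue. snd w \<noteq> 0"
    by (auto dest!: AE_not_in simp: inner_prod_def)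
  with ae have "AE w in lebesgue. \<rho> w = 0"
  proof eventually_elim
    case (elim w)
    show "\<rho> w = 0"
    proof (cases "norm w < 1")
      case True
      define m where "m = min \<bar>fst w\<bar> \<bar>snd w\<bar>"
      have "0 < m" using elim by (simp add: m_def)
      then obtain n where "inverse (real (Suc n)) < m" using reals_Archimedean by blast
      then have "w \<in> W n" using True unfolding W_def m_def by (simp add: divide_inverse)
      then show ?thesis using elim(1) \<rho>(2)[of w] by (auto dest!: spec[of _ n] simp: ennreal_eq_0_iff)
    qed (use \<rho>(3) in auto)
  qed
  then have "(\<integral>z. \<rho> z \<partial>lebesgue) = 0" by (simp add: integral_eq_zero_AE)
  with int show False by simp
qed

lemma min_le_powr_mult:
  fixes a b :: real
  assumes "0 \<le> a" "0 \<le> b" "0 < \<theta>1" "0 < \<theta>2" "\<theta>1 + \<theta>2 = 1"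
  shows "min a b \<le> a powr \<theta>1 * b powr \<theta>2"
proof (cases "min a b = 0")
  case False
  then have "min a b = min a b powr \<theta>1 * min a b powr \<theta>2"
    using assms by (simp add: powr_add[symmetric])
  also have "\<dots> \<le> a powr \<theta>1 * b powr \<theta>2"
    using assms by (intro mult_mono powr_mono2) auto
  finally show ?thesis .
qed (use assms in auto)

text \<open>If every direction in \<open>W\<close> failed for some pair of signs, the sum of the
  four reflected integrands would exceed \<open>M\<close> on \<open>W\<close>; integrated against
  \<rho> this would bound \<open>M * m\<close> by four times the energy.\<close>

lemma good_direction:
  fixes \<rho> :: "pt \<Rightarrow> real" and m :: ennreal
  assumes v: "v \<in> borel_measurable borel" and \<rho>: "\<rho> \<in> borel_measurable lebesgue" "\<And>z. 0 \<le> \<rho> z"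
    and radial: "\<And>z w. norm z = norm w \<Longrightarrow> \<rho> z = \<rho> w"
    and "0 < \<epsilon>" and W: "W \<in> sets lebesgue"
    and m: "m \<le> (\<integral>\<^sup>+w. ennreal (\<rho> w) * indicator W w \<partial>lebesgue)"
    and bound: "4 * energy_eps \<theta>1 \<theta>2 \<rho> {a1<..<b1} {a2<..<b2} v \<epsilon> < M * m"
  shows "\<exists>w\<in>W. \<forall>s\<in>{-1,1}. \<forall>r\<in>{-1,1}. inner_energy \<theta>1 \<theta>2 (inner_set {a1<..<b1} \<epsilon> \<times> inner_set {a2<..<b2} \<epsilon>) v
    (\<epsilon> * s * fst w, \<epsilon> * r * snd w) \<le> M"
proof (rule ccontr)
  assume not: "\<not> ?thesis"
  let ?U = "inner_set {a1<..<b1} \<epsilon> \<times> inner_set {a2<..<b2} \<epsilon>"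
  let ?E = "\<lambda>s r w. inner_energy \<theta>1 \<theta>2 ?U v (\<epsilon> * s * fst w, \<epsilon> * r * snd w)"
  have U: "?U \<in> sets borel"
    using \<open>0 < \<epsilon>\<close> by (simp add: inner_set_interval open_Times)
  have [measurable]: "?E s r \<in> borel_measurable lebesgue" for s r
    by (intro measurable_completion measurable_compose[OF _ measurable_inner_energy[OF v U]])
      (auto intro!: borel_measurable_continuous_onI continuous_intros)
  note [measurable] = \<rho>(1) W
  have E: "(\<integral>\<^sup>+w. ?E s r w * ennreal (\<rho> w) \<partial>lebesgue) = energy_eps \<theta>1 \<theta>2 \<rho> {a1<..<b1} {a2<..<b2} v \<epsilon>"
    if "s \<in> {-1, 1}" "r \<in> {-1, 1}" for s r
    by (rule energy_eps_reflect[OF v \<rho> radial \<open>0 < \<epsilon>\<close>, symmetric]) (use that in auto)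
  have add4: "(\<integral>\<^sup>+w. (f1 w + f2 w) + (f3 w + f4 w) \<partial>lebesgue) =
      ((\<integral>\<^sup>+w. f1 w \<partial>lebesgue) + (\<integral>\<^sup>+w. f2 w \<partial>lebesgue)) + ((\<integral>\<^sup>+w. f3 w \<partial>lebesgue) + (\<integral>\<^sup>+w. f4 w \<partial>lebesgue))"
    if "f1 \<in> borel_measurable lebesgue" "f2 \<in> borel_measurable lebesgue"
      "f3 \<in> borel_measurable lebesgue" "f4 \<in> borel_measurable lebesgue" for f1 f2 f3 f4 :: "pt \<Rightarrow> ennreal"
    using that by (simp add: nn_integral_add)
  have "M * (\<integral>\<^sup>+w. ennreal (\<rho> w) * indicator W w \<partial>lebesgue) =
    (\<integral>\<^sup>+w. M * (ennreal (\<rho> w) * indicator W w) \<partial>lebesgue)"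
    by (rule nn_integral_cmult[symmetric]) measurable
  also have "\<dots> \<le> (\<integral>\<^sup>+w. (?E 1 1 w * ennreal (\<rho> w) + ?E 1 (-1) w * ennreal (\<rho> w)) +
      (?E (-1) 1 w * ennreal (\<rho> w) + ?E (-1) (-1) w * ennreal (\<rho> w)) \<partial>lebesgue)"
  proof (rule nn_integral_mono)
    fix w
    show "M * (ennreal (\<rho> w) * indicator W w) \<le> (?E 1 1 w * ennreal (\<rho> w) + ?E 1 (-1) w * ennreal (\<rho> w)) +
      (?E (-1) 1 w * ennreal (\<rho> w) + ?E (-1) (-1) w * ennreal (\<rho> w))"
    proof (cases "w \<in> W")
      case True
      then obtain s r where sr: "s \<in> {-1, 1}" "r \<in> {-1, 1}" "M < ?E s r w"
        using not by (meson not_le_imp_less)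
      have "M * ennreal (\<rho> w) \<le> ?E s r w * ennreal (\<rho> w)"
        using sr(3) by (intro mult_right_mono) auto
      also have "\<dots> \<le> (?E 1 1 w * ennreal (\<rho> w) + ?E 1 (-1) w * ennreal (\<rho> w)) +
        (?E (-1) 1 w * ennreal (\<rho> w) + ?E (-1) (-1) w * ennreal (\<rho> w))"
      proof -
        have *: "a \<le> (a + b) + (c + d)" "b \<le> (a + b) + (c + d)" "c \<le> (a + b) + (c + d)" "d \<le> (a + b) + (c + d)"
          for a b c d :: ennreal
          by (simp_all add: add_increasing add_increasing2)
        from sr(1,2) show ?thesis by (elim insertE emptyE) (simp_all only: *)
      qed
      finally show ?thesis using True by simp
    qed simp
  qed
  also have "\<dots> = ((\<integral>\<^sup>+w. ?E 1 1 w * ennreal (\<rho> w) \<partial>lebesgue) + (\<integral>\<^sup>+w. ?E 1 (-1) w * ennreal (\<rho> w) \<partial>lebesgue)) +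
    ((\<integral>\<^sup>+w. ?E (-1) 1 w * ennreal (\<rho> w) \<partial>lebesgue) + (\<integral>\<^sup>+w. ?E (-1) (-1) w * ennreal (\<rho> w) \<partial>lebesgue))"
    by (rule add4) measurable
  also have "\<dots> = 4 * energy_eps \<theta>1 \<theta>2 \<rho> {a1<..<b1} {a2<..<b2} v \<epsilon>"
  proof -
    have "(x + x) + (x + x) = 4 * x" for x :: ennreal
      by (metis (no_types) add.assoc mult_2 mult.assoc numeral_Bit0 distrib_right)
    then show ?thesis by (simp only: E insert_iff simp_thms)
  qed
  also have "\<dots> < M * m" by (rule bound)
  also have "\<dots> \<le> M * (\<integral>\<^sup>+w. ennreal (\<rho> w) * indicator W w \<partial>lebesgue)"
    using m by (intro mult_left_mono) auto
  finally show False by simp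
qed

text \<open>Local integrability gives measurability on compact boxes, and exhausting the open box by
  them gives it on the whole box. A Borel representative is taken because the function will be
  composed with lattice maps and evaluated at single points.\<close>

lemma L1_loc_borel_version:
  assumes "L1_loc ({a1<..<b1} \<times> {a2<..<b2}) u"
  obtains v where "v \<in> borel_measurable borel" "AE x in lebesgue. x \<in> {a1<..<b1} \<times> {a2<..<b2} \<longrightarrow> u x = v x"
    "(\<lambda>x. indicator ({a1<..<b1} \<times> {a2<..<b2}) x *\<^sub>R u x) \<in> borel_measurable lebesgue"
proof -
  let ?\<Omega> = "{a1<..<b1} \<times> {a2<..<b2}"
  define C where "C n = {a1 + 1 / real (Suc n)..b1 - 1 / real (Suc n)} \<times> {a2 + 1 / real (Suc n)..b2 - 1 / real (Suc n)}" for n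
  have C_sub: "C n \<subseteq> ?\<Omega>" for n
  proof -
    define d where "d = 1 / real (Suc n)"
    have "0 < d" by (simp add: d_def)
    then show ?thesis unfolding C_def d_def[symmetric] by auto
  qed
  have "compact (C n)" for n
    unfolding C_def by (intro compact_Times compact_Icc)
  then have "set_integrable lebesgue (C n) u" for n
    using assms C_sub unfolding L1_loc_def by blast
  then have meas: "(\<lambda>x. indicator (C n) x *\<^sub>R u x) \<in> borel_measurable lebesgue" for n
    unfolding set_integrable_def by (rule borel_measurable_integrable)
  have "(\<lambda>n. indicator (C n) x *\<^sub>R u x) \<longlonglongrightarrow> indicator ?\<Omega> x *\<^sub>R u x" for x
  proof (cases "x \<in> ?\<Omega>")
    case True
    define m where "m = min (min (fst x - a1) (b1 - fst x)) (min (snd x - a2) (b2 - snd x))"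
    have "0 < m" using True unfolding m_def by auto
    then have "eventually (\<lambda>n. 1 / real (Suc n) < m) sequentially"
      using order_tendstoD(2)[OF lim_1_over_n[THEN LIMSEQ_Suc]] by auto
    then have "eventually (\<lambda>n. indicator (C n) x *\<^sub>R u x = indicator ?\<Omega> x *\<^sub>R u x) sequentially"
    proof eventually_elim
      case (elim n)
      then have "x \<in> C n" unfolding C_def m_def by (cases x) auto
      then show ?case using True by simp
    qed
    then show ?thesis by (rule tendsto_eventually)
  next
    case False
    then have "x \<notin> C n" for n using C_sub by blast
    then show ?thesis using False by simp
  qed
  then have limit: "(\<lambda>x. indicator ?\<Omega> x *\<^sub>R u x) \<in> borel_measurable lebesgue"
    by (rule borel_measurable_LIMSEQ_real[OF _ meas])
  from completion_ex_borel_measurable_real[OF limit] obtain v where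
    v: "v \<in> borel_measurable lborel" "AE x in lborel. indicator ?\<Omega> x *\<^sub>R u x = v x" by blast
  show thesis
  proof (rule that)
    show "v \<in> borel_measurable borel" using v(1) by simp
    have "AE x in lebesgue. indicator ?\<Omega> x *\<^sub>R u x = v x" by (rule AE_completion[OF v(2)])
    then show "AE x in lebesgue. x \<in> ?\<Omega> \<longrightarrow> u x = v x"
      by eventually_elim auto
  qed (rule limit)
qed

lemma AE_lebesgue_translation:
  fixes a :: pt
  assumes "AE x in lebesgue. P x"
  shows "AE x in lebesgue. P (x + a)"
proof -
  from assms obtain N where N: "{x. \<not> P x} \<subseteq> N" "N \<in> null_sets lebesgue"
    by (auto simp: eventually_ae_filter)
  have "negligible N" using N(2) by (simp add: negligible_iff_null_sets)
  then have "negligible ((+) (- a) ` N)" by (rule negligible_translation)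
  then have "(+) (- a) ` N \<in> null_sets lebesgue" by (simp add: negligible_iff_null_sets)
  moreover have "{x. \<not> P (x + a)} \<subseteq> (+) (- a) ` N"
    using N(1) by (force intro: image_eqI[of _ _ "x + a" for x])
  ultimately show ?thesis by (auto simp: eventually_ae_filter)
qed

text \<open>For directions shorter than \<epsilon> both translates of the inner box stay in the box,
  so three almost everywhere identities suffice; longer directions carry no weight.\<close>

lemma energy_eps_cong_AE:
  assumes ae: "AE x in lebesgue. x \<in> {a1<..<b1} \<times> {a2<..<b2} \<longrightarrow> u x = v x"
    and "0 < \<epsilon>" and \<rho>: "\<And>z. 1 \<le> norm z \<Longrightarrow> \<rho> z = 0"
  shows "energy_eps \<theta>1 \<theta>2 \<rho> {a1<..<b1} {a2<..<b2} u \<epsilon> = energy_eps \<theta>1 \<theta>2 \<rho> {a1<..<b1} {a2<..<b2} v \<epsilon>"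
  unfolding energy_eps_def
proof (rule nn_integral_cong, goal_cases)
  case (1 z)
  let ?U = "inner_set {a1<..<b1} \<epsilon> \<times> inner_set {a2<..<b2} \<epsilon>"
  show ?case
  proof (cases "norm z < \<epsilon>")
    case False
    then have "\<rho> ((1 / \<epsilon>) *\<^sub>R z) = 0"
      using \<open>0 < \<epsilon>\<close> by (intro \<rho>) (simp add: field_simps)
    then show ?thesis by (simp add: rho_eps_def)
  next
    case True
    have z: "\<bar>fst z\<bar> < \<epsilon>" "\<bar>snd z\<bar> < \<epsilon>"
      using True norm_fst_le[of "fst z" "snd z"] norm_snd_le[of "snd z" "fst z"] by auto
    have "(\<integral>\<^sup>+ x. indicator ?U x *
          ennreal (inverse ((norm z)\<^sup>2) * \<bar>u (x + (fst z, 0)) - u x\<bar> powr \<theta>1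
                   * \<bar>u (x + (0, snd z)) - u x\<bar> powr \<theta>2) \<partial>lebesgue) =
       (\<integral>\<^sup>+ x. indicator ?U x *
          ennreal (inverse ((norm z)\<^sup>2) * \<bar>v (x + (fst z, 0)) - v x\<bar> powr \<theta>1
                   * \<bar>v (x + (0, snd z)) - v x\<bar> powr \<theta>2) \<partial>lebesgue)"
    proof (rule nn_integral_cong_AE)
      show "AE x in lebesgue. indicator ?U x *
          ennreal (inverse ((norm z)\<^sup>2) * \<bar>u (x + (fst z, 0)) - u x\<bar> powr \<theta>1
                   * \<bar>u (x + (0, snd z)) - u x\<bar> powr \<theta>2) = indicator ?U x *
          ennreal (inverse ((norm z)\<^sup>2) * \<bar>v (x + (fst z, 0)) - v x\<bar> powr \<theta>1
                   * \<bar>v (x + (0, snd z)) - v x\<bar> powr \<theta>2)"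
        using ae AE_lebesgue_translation[OF ae, of "(fst z, 0)"] AE_lebesgue_translation[OF ae, of "(0, snd z)"]
      proof eventually_elim
        case (elim x)
        show ?case
        proof (cases "x \<in> ?U")
          case True
          then have "x \<in> {a1 + \<epsilon><..<b1 - \<epsilon>} \<times> {a2 + \<epsilon><..<b2 - \<epsilon>}"
            using \<open>0 < \<epsilon>\<close> by (simp add: inner_set_interval)
          then have "x \<in> {a1<..<b1} \<times> {a2<..<b2}" "x + (fst z, 0) \<in> {a1<..<b1} \<times> {a2<..<b2}"
            "x + (0, snd z) \<in> {a1<..<b1} \<times> {a2<..<b2}"
            using z \<open>0 < \<epsilon>\<close> by (cases x, auto)+
          then show ?thesis using elim by simp
        qed simp
      qed
    qed
    then show ?thesis by simp
  qed
qed

text \<open>The liminf supplies the scales and averaging supplies a direction \<open>w n\<close> at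
  each scale; the steps are the absolute values of its rescaled coordinates. The minimum enters
  through the weighted geometric mean.\<close>

lemma energy_steps:
  fixes \<rho> u :: "pt \<Rightarrow> real"
  assumes \<theta>: "\<theta>1 > 0" "\<theta>2 > 0" "\<theta>1 + \<theta>2 = 1"
    and \<rho>: "integrable lebesgue \<rho>" "\<forall>z. \<rho> z \<ge> 0" "\<forall>z w. norm z = norm w \<longrightarrow> \<rho> z = \<rho> w"
      "\<forall>z. norm z \<ge> 1 \<longrightarrow> \<rho> z = 0" "(\<integral>z. \<rho> z \<partial>lebesgue) = 1"
    and v: "v \<in> borel_measurable borel" "AE x in lebesgue. x \<in> {a1<..<b1} \<times> {a2<..<b2} \<longrightarrow> u x = v x"
    and finite: "energy \<theta>1 \<theta>2 \<rho> {a1<..<b1} {a2<..<b2} u < \<infinity>"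
  obtains C \<epsilon> h k where "0 < C" "\<epsilon> \<longlonglongrightarrow> 0" "\<And>n. 0 < h n \<and> h n \<le> \<epsilon> n" "\<And>n. 0 < k n \<and> k n \<le> \<epsilon> n"
    "\<And>n s r. s \<in> {-1,1} \<Longrightarrow> r \<in> {-1,1} \<Longrightarrow>
       (\<integral>\<^sup>+x. indicator ({a1 + \<epsilon> n<..<b1 - \<epsilon> n} \<times> {a2 + \<epsilon> n<..<b2 - \<epsilon> n}) x *
         ennreal (min \<bar>v (x + (s * h n, 0)) - v x\<bar> \<bar>v (x + (0, r * k n)) - v x\<bar>) \<partial>lborel)
       \<le> ennreal (C * h n * k n)"
proof -
  obtain c where c: "0 < c" and pos: 
    "0 < (\<integral>\<^sup>+w. ennreal (\<rho> w) * indicator {w. norm w < 1 \<and> c \<le> \<bar>fst w\<bar> \<and> c \<le> \<bar>snd w\<bar>} w \<partial>lebesgue)"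
    using ex_weight_off_axes[OF \<rho>(1) _ _ \<rho>(5)] \<rho>(2,4) by blast
  define W where "W = {w::pt. norm w < 1 \<and> c \<le> \<bar>fst w\<bar> \<and> c \<le> \<bar>snd w\<bar>}"
  have W: "W \<in> sets lebesgue"
  proof -
    have "{w::pt. norm w < 1} \<in> sets borel"
      by (intro borel_open open_Collect_less continuous_intros)
    moreover have "{w::pt. c \<le> \<bar>fst w\<bar>} \<in> sets borel" "{w::pt. c \<le> \<bar>snd w\<bar>} \<in> sets borel"
      by (intro borel_closed closed_Collect_le continuous_intros)+
    ultimately have "{w::pt. norm w < 1} \<inter> ({w. c \<le> \<bar>fst w\<bar>} \<inter> {w. c \<le> \<bar>snd w\<bar>}) \<in> sets borel"
      by (intro sets.Int)
    also have "{w::pt. norm w < 1} \<inter> ({w. c \<le> \<bar>fst w\<bar>} \<inter> {w. c \<le> \<bar>snd w\<bar>}) = W"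
      unfolding W_def by auto
    finally show ?thesis by auto
  qed
  \<comment> \<open>Capping at 1 keeps the weight finite; all that is asked of it is to be a
    positive lower bound.\<close>
  define m' where "m' = min 1 (\<integral>\<^sup>+w. ennreal (\<rho> w) * indicator W w \<partial>lebesgue)"
  define m where "m = enn2real m'"
  have m: "0 < m" "ennreal m \<le> (\<integral>\<^sup>+w. ennreal (\<rho> w) * indicator W w \<partial>lebesgue)"
  proof -
    have "0 < m'" "m' \<le> 1" using pos unfolding m'_def W_def by auto
    then have "m' < top" by (meson ennreal_one_less_top le_less_trans)
    then show "0 < m" unfolding m_def using \<open>0 < m'\<close> by (simp add: enn2real_positive_iff)
    have "ennreal m = m'" unfolding m_def using \<open>m' < top\<close> by simp
    then show "ennreal m \<le> (\<integral>\<^sup>+w. ennreal (\<rho> w) * indicator W w \<partial>lebesgue)"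
      by (simp add: m'_def)
  qed
  define E where "E = energy_eps \<theta>1 \<theta>2 \<rho> {a1<..<b1} {a2<..<b2} v"
  obtain A where A: "energy \<theta>1 \<theta>2 \<rho> {a1<..<b1} {a2<..<b2} u < ennreal A" "0 < A"
  proof -
    obtain B where B: "energy \<theta>1 \<theta>2 \<rho> {a1<..<b1} {a2<..<b2} u = ennreal B" "0 \<le> B"
      using finite by (cases "energy \<theta>1 \<theta>2 \<rho> {a1<..<b1} {a2<..<b2} u") auto
    show ?thesis by (rule that[of "B + 1"]) (use B in \<open>auto simp: ennreal_less_iff\<close>)
  qed
  have freq: "\<exists>\<epsilon>. 0 < \<epsilon> \<and> \<epsilon> < \<delta> \<and> E \<epsilon> < ennreal A" if "0 < \<delta>" for \<delta>
  proof (rule ccontr)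
    assume not: "\<not> ?thesis"
    have "eventually (\<lambda>\<epsilon>. ennreal A \<le> energy_eps \<theta>1 \<theta>2 \<rho> {a1<..<b1} {a2<..<b2} u \<epsilon>) (at_right 0)"
      unfolding eventually_at_right_field
    proof (intro exI[of _ \<delta>] conjI allI impI that)
      fix y assume "0 < y" "y < \<delta>"
      then have "ennreal A \<le> E y" using not by (meson not_le)
      then show "ennreal A \<le> energy_eps \<theta>1 \<theta>2 \<rho> {a1<..<b1} {a2<..<b2} u y"
        using energy_eps_cong_AE[OF v(2) \<open>0 < y\<close>, of \<rho>] \<rho>(4) unfolding E_def by simp
    qed
    then have "ennreal A \<le> energy \<theta>1 \<theta>2 \<rho> {a1<..<b1} {a2<..<b2} u"
      unfolding energy_def by (rule Liminf_bounded)
    with A(1) show False by simp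
  qed
  have "\<forall>n. \<exists>\<epsilon>. 0 < \<epsilon> \<and> \<epsilon> < 1 / real (Suc n) \<and> E \<epsilon> < ennreal A"
    using freq by simp
  then obtain \<epsilon> where \<epsilon>: "\<And>n. 0 < \<epsilon> n" "\<And>n. \<epsilon> n < 1 / real (Suc n)" "\<And>n. E (\<epsilon> n) < ennreal A"
    by metis
  have lim: "\<epsilon> \<longlonglongrightarrow> 0"
    by (rule tendsto_sandwich[OF _ _ tendsto_const lim_1_over_n[THEN LIMSEQ_Suc]])
      (auto intro!: always_eventually less_imp_le \<epsilon> simp del: of_nat_Suc)
  \<comment> \<open>Chosen so that \<open>M * m\<close> is four times the energy bound, one for each
    pair of signs.\<close>
  define M where "M = 4 * A / m"
  have M: "0 < M" "M * m = 4 * A" using A m by (auto simp: M_def)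
  have \<rho>': "\<rho> \<in> borel_measurable lebesgue" "\<And>z. 0 \<le> \<rho> z" "\<And>z w. norm z = norm w \<Longrightarrow> \<rho> z = \<rho> w"
    using \<rho>(2) by (auto intro: borel_measurable_integrable[OF \<rho>(1)] \<rho>(3)[rule_format])
  have "\<exists>w\<in>W. \<forall>s\<in>{-1,1}. \<forall>r\<in>{-1,1}. inner_energy \<theta>1 \<theta>2 (inner_set {a1<..<b1} (\<epsilon> n) \<times> inner_set {a2<..<b2} (\<epsilon> n)) v
    (\<epsilon> n * s * fst w, \<epsilon> n * r * snd w) \<le> ennreal M" for n
  proof (rule good_direction[OF v(1) \<rho>' \<epsilon>(1) W m(2)])
    have "4 * E (\<epsilon> n) < 4 * ennreal A"
      by (rule ennreal_mult_strict_left_mono[OF \<epsilon>(3)[of n]]) (simp_all add: less_top[symmetric])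
    also have "\<dots> = ennreal M * ennreal m"
      using M m A by (simp add: ennreal_mult[symmetric]) (simp add: ennreal_mult)
    finally show "4 * energy_eps \<theta>1 \<theta>2 \<rho> {a1<..<b1} {a2<..<b2} v (\<epsilon> n) < ennreal M * ennreal m"
      unfolding E_def .
  qed
  then obtain w where w: "\<And>n. w n \<in> W" "\<And>n s r. s \<in> {-1,1} \<Longrightarrow> r \<in> {-1,1} \<Longrightarrow>
     inner_energy \<theta>1 \<theta>2 (inner_set {a1<..<b1} (\<epsilon> n) \<times> inner_set {a2<..<b2} (\<epsilon> n)) v
      (\<epsilon> n * s * fst (w n), \<epsilon> n * r * snd (w n)) \<le> ennreal M" by metis
  define h where "h n = \<epsilon> n * \<bar>fst (w n)\<bar>" for n
  define k where "k n = \<epsilon> n * \<bar>snd (w n)\<bar>" for n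
  have w_bd: "norm (w n) < 1" "c \<le> \<bar>fst (w n)\<bar>" "c \<le> \<bar>snd (w n)\<bar>" "\<bar>fst (w n)\<bar> < 1" "\<bar>snd (w n)\<bar> < 1" for n
    using w(1)[of n] norm_fst_le[of "fst (w n)" "snd (w n)"] norm_snd_le[of "snd (w n)" "fst (w n)"]
    unfolding W_def by auto
  show thesis
  proof (rule that)
    \<comment> \<open>Since \<open>w n\<close> keeps a distance \<open>c\<close> from both axes, the
      square of \<open>\<epsilon> n\<close> is at most \<open>h n * k n\<close> divided by the
      square of \<open>c\<close>.\<close>
    show "0 < M / c\<^sup>2" using M c by simp
    show "\<epsilon> \<longlonglongrightarrow> 0" by (rule lim)
    show "0 < h n \<and> h n \<le> \<epsilon> n" "0 < k n \<and> k n \<le> \<epsilon> n" for n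
      using \<epsilon>(1)[of n] w_bd[of n] c unfolding h_def k_def
      by (auto intro!: mult_pos_pos mult_left_le)
    fix n and s r :: real assume sr: "s \<in> {-1,1}" "r \<in> {-1,1}"
    \<comment> \<open>The signs of the coordinates of \<open>w n\<close> are moved into
      \<open>s\<close> and \<open>r\<close>; the bound holds for all four pairs, so positive steps
      lose nothing.\<close>
    define s' where "s' = s * sgn (fst (w n))"
    define r' where "r' = r * sgn (snd (w n))"
    have "fst (w n) \<noteq> 0" "snd (w n) \<noteq> 0" using w_bd[of n] c by auto
    then have sr': "s' \<in> {-1,1}" "r' \<in> {-1,1}" using sr by (auto simp: s'_def r'_def sgn_if)
    have eq: "\<epsilon> n * s' * fst (w n) = s * h n" "\<epsilon> n * r' * snd (w n) = r * k n"
      unfolding s'_def r'_def h_def k_def by (auto simp: abs_sgn ac_simps)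
    define z where "z = (s * h n, r * k n)"
    have norm_z: "norm z = \<epsilon> n * norm (w n)"
    proof -
      have "(s * h n)\<^sup>2 + (r * k n)\<^sup>2 = (\<epsilon> n)\<^sup>2 * ((fst (w n))\<^sup>2 + (snd (w n))\<^sup>2)"
        using sr by (auto simp: h_def k_def power_mult_distrib algebra_simps)
      then show ?thesis using \<epsilon>(1)[of n]
        unfolding z_def by (cases "w n") (simp add: norm_Pair real_sqrt_mult)
    qed
    have z_pos: "0 < norm z" 
      using norm_z \<epsilon>(1)[of n] \<open>fst (w n) \<noteq> 0\<close> by (cases "w n") (auto simp: zero_prod_def)
    have z_le: "(norm z)\<^sup>2 \<le> (\<epsilon> n)\<^sup>2"
      using norm_z w_bd(1)[of n] \<epsilon>(1)[of n] by (intro power_mono) (auto intro!: mult_left_le)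
    let ?U = "{a1 + \<epsilon> n<..<b1 - \<epsilon> n} \<times> {a2 + \<epsilon> n<..<b2 - \<epsilon> n}"
    have U[measurable]: "?U \<in> sets borel" by (simp add: open_Times)
    note [measurable] = v(1)
    let ?f = "\<lambda>x. \<bar>v (x + (s * h n, 0)) - v x\<bar> powr \<theta>1 * \<bar>v (x + (0, r * k n)) - v x\<bar> powr \<theta>2"
    have "(\<integral>\<^sup>+x. indicator ?U x *
         ennreal (min \<bar>v (x + (s * h n, 0)) - v x\<bar> \<bar>v (x + (0, r * k n)) - v x\<bar>) \<partial>lborel) \<le>
      (\<integral>\<^sup>+x. ennreal ((norm z)\<^sup>2) * (indicator ?U x * ennreal (inverse ((norm z)\<^sup>2) * ?f x)) \<partial>lborel)"
    proof (rule nn_integral_mono)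
      fix x
      have "ennreal (min \<bar>v (x + (s * h n, 0)) - v x\<bar> \<bar>v (x + (0, r * k n)) - v x\<bar>) \<le> ennreal (?f x)"
        by (intro ennreal_leI min_le_powr_mult) (use \<theta> in auto)
      also have "\<dots> = ennreal ((norm z)\<^sup>2) * ennreal (inverse ((norm z)\<^sup>2) * ?f x)"
        using z_pos by (simp add: ennreal_mult[symmetric])
      finally show "indicator ?U x * ennreal (min \<bar>v (x + (s * h n, 0)) - v x\<bar> \<bar>v (x + (0, r * k n)) - v x\<bar>)
        \<le> ennreal ((norm z)\<^sup>2) * (indicator ?U x * ennreal (inverse ((norm z)\<^sup>2) * ?f x))"
        by (auto simp: indicator_def)
    qed
    also have "\<dots> = ennreal ((norm z)\<^sup>2) * (\<integral>\<^sup>+x. indicator ?U x * ennreal (inverse ((norm z)\<^sup>2) * ?f x) \<partial>lborel)"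
      by (rule nn_integral_cmult) measurable
    also have "(\<integral>\<^sup>+x. indicator ?U x * ennreal (inverse ((norm z)\<^sup>2) * ?f x) \<partial>lborel) =
        (\<integral>\<^sup>+x. indicator ?U x * ennreal (inverse ((norm z)\<^sup>2) * ?f x) \<partial>lebesgue)"
      by (rule nn_integral_completion[symmetric]) measurable
    also have "\<dots> = inner_energy \<theta>1 \<theta>2 (inner_set {a1<..<b1} (\<epsilon> n) \<times> inner_set {a2<..<b2} (\<epsilon> n)) v
      (\<epsilon> n * s' * fst (w n), \<epsilon> n * r' * snd (w n))"
      using \<epsilon>(1)[of n] unfolding inner_energy_def eq z_def by (simp add: inner_set_interval mult.assoc)
    also have "ennreal ((norm z)\<^sup>2) * \<dots> \<le> ennreal ((\<epsilon> n)\<^sup>2) * ennreal M"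
      using w(2)[OF sr', of n] z_le by (intro mult_mono ennreal_leI) auto
    also have "\<dots> = ennreal ((\<epsilon> n)\<^sup>2 * M)" using M by (simp add: ennreal_mult)
    also have "\<dots> \<le> ennreal (M / c\<^sup>2 * h n * k n)"
    proof (rule ennreal_leI)
      have "c * c \<le> \<bar>fst (w n)\<bar> * \<bar>snd (w n)\<bar>"
        using w_bd[of n] c by (intro mult_mono) auto
      then have "(\<epsilon> n)\<^sup>2 * M * (c * c) \<le> (\<epsilon> n)\<^sup>2 * M * (\<bar>fst (w n)\<bar> * \<bar>snd (w n)\<bar>)"
        using M by (intro mult_left_mono) auto
      then show "(\<epsilon> n)\<^sup>2 * M \<le> M / c\<^sup>2 * h n * k n"
        using c unfolding h_def k_def by (simp add: field_simps power2_eq_square)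
    qed
    finally show "(\<integral>\<^sup>+x. indicator ?U x *
         ennreal (min \<bar>v (x + (s * h n, 0)) - v x\<bar> \<bar>v (x + (0, r * k n)) - v x\<bar>) \<partial>lborel)
       \<le> ennreal (M / c\<^sup>2 * h n * k n)" .
  qed
qed

section \<open>Random lattices\<close>

lemma floor_divide_eq_iff:
  fixes h :: real
  assumes "0 < h"
  shows "\<lfloor>x / h\<rfloor> = \<lfloor>y / h\<rfloor> \<longleftrightarrow> h * of_int \<lfloor>x / h\<rfloor> \<le> y \<and> y < h * of_int \<lfloor>x / h\<rfloor> + h"
proof -
  have "\<lfloor>y / h\<rfloor> = i \<longleftrightarrow> h * of_int i \<le> y \<and> y < h * of_int i + h" for i
    using assms by (auto simp: floor_eq_iff field_simps)
  then show ?thesis by (simp add: eq_commute)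
qed

text \<open>For fixed \<open>x\<close> and a uniformly distributed shift \<open>s\<close> the sample
  point is uniform in the cell of \<open>x\<close>. Averaging over \<open>s\<close> thus replaces
  \<open>g\<close> by its cell average, which preserves the integral.\<close>

lemma nn_integral_lattice1:
  fixes g :: "real \<Rightarrow> ennreal" and h :: real
  assumes [measurable]: "g \<in> borel_measurable borel" and h: "0 < h"
  shows "(\<integral>\<^sup>+s. (\<integral>\<^sup>+x. g (h * (s + of_int \<lfloor>x / h\<rfloor>)) \<partial>lborel) * indicator {0..<1} s \<partial>lborel) = (\<integral>\<^sup>+y. g y \<partial>lborel)"
proof -
  \<comment> \<open>The kernel of lying in the same cell. Its symmetry yields the total mass
    \<open>h\<close> in the other variable after Fubini.\<close>
  define same :: "real \<Rightarrow> real \<Rightarrow> ennreal" where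
    "same x y = (if \<lfloor>x / h\<rfloor> = \<lfloor>y / h\<rfloor> then 1 else 0)" for x y
  have same: "same x y = indicator {h * of_int \<lfloor>x / h\<rfloor>..<h * of_int \<lfloor>x / h\<rfloor> + h} y" for x y
    unfolding same_def floor_divide_eq_iff[OF h] by (simp add: indicator_def)
  have sym: "same x y = same y x" for x y by (auto simp: same_def)
  have total: "(\<integral>\<^sup>+x. same x y \<partial>lborel) = ennreal h" for y
  proof -
    have "(\<integral>\<^sup>+x. same x y \<partial>lborel) = (\<integral>\<^sup>+x. indicator {h * of_int \<lfloor>y / h\<rfloor>..<h * of_int \<lfloor>y / h\<rfloor> + h} x \<partial>lborel)"
      by (intro nn_integral_cong) (simp only: sym[of _ y] same[of y])
    also have "\<dots> = ennreal h" using h by simp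
    finally show ?thesis .
  qed
  have inner: "(\<integral>\<^sup>+s. g (h * (s + of_int \<lfloor>x / h\<rfloor>)) * indicator {0..<1} s \<partial>lborel) =
     (\<integral>\<^sup>+y. ennreal (1 / h) * (g y * same x y) \<partial>lborel)" for x
  proof -
    let ?i = "real_of_int \<lfloor>x / h\<rfloor>"
    have "(\<integral>\<^sup>+y. g y * same x y \<partial>lborel) = ennreal \<bar>h\<bar> * (\<integral>\<^sup>+s. g (h * ?i + h * s) * same x (h * ?i + h * s) \<partial>lborel)"
      unfolding same by (rule nn_integral_real_affine) (use h in auto)
    also have "(\<lambda>s. g (h * ?i + h * s) * same x (h * ?i + h * s)) = (\<lambda>s. g (h * (s + ?i)) * indicator {0..<1} s)"
      unfolding same using h by (auto simp: indicator_def fun_eq_iff algebra_simps zero_le_mult_iff)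
    finally have "(\<integral>\<^sup>+y. g y * same x y \<partial>lborel) = ennreal h * (\<integral>\<^sup>+s. g (h * (s + ?i)) * indicator {0..<1} s \<partial>lborel)"
      using h by simp
    then have "ennreal (1 / h) * (\<integral>\<^sup>+y. g y * same x y \<partial>lborel) =
        (ennreal (1 / h) * ennreal h) * (\<integral>\<^sup>+s. g (h * (s + ?i)) * indicator {0..<1} s \<partial>lborel)"
      by (simp add: mult.assoc)
    also have "ennreal (1 / h) * ennreal h = 1" using h by (simp add: ennreal_mult[symmetric])
    finally show ?thesis
      by (subst nn_integral_cmult) (auto simp: same)
  qed
  have [measurable]: "(\<lambda>(x, y). same x y) \<in> borel_measurable (borel \<Otimes>\<^sub>M borel)"
    unfolding same_def by measurable
  have "(\<integral>\<^sup>+s. (\<integral>\<^sup>+x. g (h * (s + of_int \<lfloor>x / h\<rfloor>)) \<partial>lborel) * indicator {0..<1} s \<partial>lborel) =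
    (\<integral>\<^sup>+s. (\<integral>\<^sup>+x. g (h * (s + of_int \<lfloor>x / h\<rfloor>)) * indicator {0..<1} s \<partial>lborel) \<partial>lborel)"
    by (intro nn_integral_cong nn_integral_multc[symmetric]) measurable
  also have "\<dots> = (\<integral>\<^sup>+x. (\<integral>\<^sup>+s. g (h * (s + of_int \<lfloor>x / h\<rfloor>)) * indicator {0..<1} s \<partial>lborel) \<partial>lborel)"
    by (rule lborel_pair.Fubini') measurable
  also have "\<dots> = (\<integral>\<^sup>+x. (\<integral>\<^sup>+y. ennreal (1 / h) * (g y * same x y) \<partial>lborel) \<partial>lborel)"
    unfolding inner ..
  also have "\<dots> = (\<integral>\<^sup>+y. (\<integral>\<^sup>+x. ennreal (1 / h) * (g y * same x y) \<partial>lborel) \<partial>lborel)"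
    by (rule lborel_pair.Fubini') measurable
  also have "\<dots> = (\<integral>\<^sup>+y. ennreal (1 / h) * (g y * ennreal h) \<partial>lborel)"
    by (simp add: nn_integral_cmult total)
  also have "\<dots> = (\<integral>\<^sup>+y. g y \<partial>lborel)"
    using h by (simp add: mult.left_commute[of _ "g _"] ennreal_mult[symmetric])
  finally show ?thesis .
qed

text \<open>The sample point attached to the cell of \<open>x\<close>, with the same relative offset
  \<open>q\<close> in every cell; for fixed \<open>q\<close> it is constant on cells.\<close>

definition lat :: "real \<Rightarrow> real \<Rightarrow> pt \<Rightarrow> pt \<Rightarrow> pt" where
  "lat h k q x = (h * (fst q + of_int \<lfloor>fst x / h\<rfloor>), k * (snd q + of_int \<lfloor>snd x / k\<rfloor>))"

definition unit_square :: "pt set" where "unit_square = {0..<1} \<times> {0..<1}"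

lemma measurable_lat:
  assumes "(f :: pt \<Rightarrow> 'a::topological_space) \<in> borel_measurable borel"
  shows "(\<lambda>(q, x). f (lat h k q x)) \<in> borel_measurable (borel \<Otimes>\<^sub>M borel)"
proof -
  have [measurable]: "f \<in> borel_measurable (borel \<Otimes>\<^sub>M borel)" using assms by (simp add: borel_prod)
  have "(\<lambda>(q, x). f (lat h k q x)) \<in> borel_measurable ((borel \<Otimes>\<^sub>M borel) \<Otimes>\<^sub>M (borel \<Otimes>\<^sub>M borel))"
    unfolding lat_def by measurable
  then show ?thesis by (simp add: borel_prod)
qed

lemma unit_square_borel [measurable]: "unit_square \<in> sets borel"
  unfolding unit_square_def by (simp add: borel_prod[symmetric])

lemma emeasure_unit_square: "emeasure lborel unit_square = 1"
  unfolding unit_square_def lborel_prod[symmetric]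
  by (subst lborel.emeasure_pair_measure_Times) auto

lemma nn_integral_lattice2:
  fixes f :: "pt \<Rightarrow> ennreal"
  assumes f: "f \<in> borel_measurable borel" and hk: "0 < h" "0 < k"
  shows "(\<integral>\<^sup>+q. (\<integral>\<^sup>+x. f (lat h k q x) \<partial>lborel) * indicator unit_square q \<partial>lborel) = (\<integral>\<^sup>+x. f x \<partial>lborel)"
proof -
  have [measurable]: "f \<in> borel_measurable (borel \<Otimes>\<^sub>M borel)" using f by (simp add: borel_prod)
  let ?a = "\<lambda>s x. h * (s + real_of_int \<lfloor>x / h\<rfloor>)" and ?b = "\<lambda>s x. k * (s + real_of_int \<lfloor>x / k\<rfloor>)"
  have split: "(\<integral>\<^sup>+x. F x \<partial>lborel) = (\<integral>\<^sup>+x1. \<integral>\<^sup>+x2. F (x1, x2) \<partial>lborel \<partial>lborel)"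
    if "F \<in> borel_measurable borel" for F :: "pt \<Rightarrow> ennreal"
    unfolding lborel_prod[symmetric]
    by (rule lborel.nn_integral_fst[symmetric]) (use that in \<open>simp add: lborel_prod\<close>)
  have f_lat: "(\<lambda>x. f (lat h k q x)) \<in> borel_measurable borel" for q
    using measurable_compose[OF measurable_Pair1' measurable_lat[OF f]] by simp
  have int_lat: "(\<lambda>q. (\<integral>\<^sup>+x. f (lat h k q x) \<partial>lborel) * indicator unit_square q) \<in> borel_measurable borel"
    by (intro borel_measurable_times_ennreal lborel.borel_measurable_nn_integral borel_measurable_indicator)
      (use measurable_lat[OF f, of h k] in \<open>auto simp: unit_square_borel\<close>)
  have "(\<integral>\<^sup>+q. (\<integral>\<^sup>+x. f (lat h k q x) \<partial>lborel) * indicator unit_square q \<partial>lborel) =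
    (\<integral>\<^sup>+s. \<integral>\<^sup>+r. (\<integral>\<^sup>+x1. \<integral>\<^sup>+x2. f (?a s x1, ?b r x2) \<partial>lborel \<partial>lborel) * indicator unit_square (s, r) \<partial>lborel \<partial>lborel)"
    unfolding split[OF int_lat] unfolding split[OF f_lat] by (simp add: lat_def)
  also have "\<dots> = (\<integral>\<^sup>+s. (\<integral>\<^sup>+x1. \<integral>\<^sup>+y. f (?a s x1, y) \<partial>lborel \<partial>lborel) * indicator {0..<1} s \<partial>lborel)"
  proof (rule nn_integral_cong)
    fix s
    have "(\<integral>\<^sup>+r. (\<integral>\<^sup>+x1. \<integral>\<^sup>+x2. f (?a s x1, ?b r x2) \<partial>lborel \<partial>lborel) * indicator unit_square (s, r) \<partial>lborel) =
      (\<integral>\<^sup>+r. (\<integral>\<^sup>+x1. (\<integral>\<^sup>+x2. f (?a s x1, ?b r x2) \<partial>lborel) * indicator {0..<1} r \<partial>lborel) * indicator {0..<1} s \<partial>lborel)"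
      by (intro nn_integral_cong)
        (auto simp: unit_square_def indicator_def)
    also have "\<dots> = (\<integral>\<^sup>+r. (\<integral>\<^sup>+x1. (\<integral>\<^sup>+x2. f (?a s x1, ?b r x2) \<partial>lborel) * indicator {0..<1} r \<partial>lborel) \<partial>lborel) * indicator {0..<1} s"
      by (rule nn_integral_multc) measurable
    also have "(\<integral>\<^sup>+r. (\<integral>\<^sup>+x1. (\<integral>\<^sup>+x2. f (?a s x1, ?b r x2) \<partial>lborel) * indicator {0..<1} r \<partial>lborel) \<partial>lborel) =
      (\<integral>\<^sup>+x1. (\<integral>\<^sup>+r. (\<integral>\<^sup>+x2. f (?a s x1, ?b r x2) \<partial>lborel) * indicator {0..<1} r \<partial>lborel) \<partial>lborel)"
      by (rule lborel_pair.Fubini') measurable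
    also have "\<dots> = (\<integral>\<^sup>+x1. (\<integral>\<^sup>+y. f (?a s x1, y) \<partial>lborel) \<partial>lborel)"
      by (intro nn_integral_cong nn_integral_lattice1 hk) measurable
    finally show "(\<integral>\<^sup>+r. (\<integral>\<^sup>+x1. \<integral>\<^sup>+x2. f (?a s x1, ?b r x2) \<partial>lborel \<partial>lborel) * indicator unit_square (s, r) \<partial>lborel) =
      (\<integral>\<^sup>+x1. (\<integral>\<^sup>+y. f (?a s x1, y) \<partial>lborel) \<partial>lborel) * indicator {0..<1} s" .
  qed
  also have "\<dots> = (\<integral>\<^sup>+x1. \<integral>\<^sup>+y. f (x1, y) \<partial>lborel \<partial>lborel)"
    by (rule nn_integral_lattice1) (use hk in measurable)
  also have "\<dots> = (\<integral>\<^sup>+x. f x \<partial>lborel)" by (rule split[OF f, symmetric])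
  finally show ?thesis .
qed

lemma lat_close:
  assumes "q \<in> unit_square" "0 < h" "0 < k"
  shows "\<bar>fst (lat h k q x) - fst x\<bar> \<le> h" "\<bar>snd (lat h k q x) - snd x\<bar> \<le> k"
proof -
  have *: "\<bar>h * (s + real_of_int \<lfloor>y / h\<rfloor>) - y\<bar> \<le> h" if "0 \<le> s" "s < 1" "0 < h" for s y h :: real
  proof -
    have "h * (s + real_of_int \<lfloor>y / h\<rfloor>) - y = h * (s - (y / h - real_of_int \<lfloor>y / h\<rfloor>))"
      using that by (simp add: field_simps)
    also have "\<bar>\<dots>\<bar> = h * \<bar>s - (y / h - real_of_int \<lfloor>y / h\<rfloor>)\<bar>"
      using that by (simp add: abs_mult)
    also have "\<dots> \<le> h * 1"
      using that by (intro mult_left_mono) linarith+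
    finally show ?thesis by simp
  qed
  show "\<bar>fst (lat h k q x) - fst x\<bar> \<le> h" "\<bar>snd (lat h k q x) - snd x\<bar> \<le> k"
    using assms unfolding lat_def unit_square_def by (auto intro!: *)
qed

text \<open>Measurability provides continuous approximants that converge almost everywhere.
  Truncating them at the bound of \<open>w\<close> keeps the limit and permits dominated convergence
  on \<open>B\<close>.\<close>

lemma continuous_L1_approx:
  fixes w :: "pt \<Rightarrow> real"
  assumes w: "w \<in> borel_measurable borel" "\<And>x. \<bar>w x\<bar> \<le> 2"
    and B: "B \<in> sets borel" "emeasure lborel B < \<infinity>" and "0 < \<eta>"
  obtains g where "continuous_on UNIV g" "\<And>x. \<bar>g x\<bar> \<le> 2"
    "(\<integral>\<^sup>+x. ennreal \<bar>w x - g x\<bar> * indicator B x \<partial>lborel) \<le> ennreal \<eta>"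
proof -
  have "w \<in> borel_measurable lebesgue" using w(1) by (intro measurable_completion) simp
  then have "w measurable_on UNIV" by (rule lebesgue_measurable_imp_measurable_on) simp
  then obtain N g where N: "negligible N" and g: "\<And>n. continuous_on UNIV (g n)"
    "\<And>x. x \<notin> N \<Longrightarrow> (\<lambda>n. g n x) \<longlonglongrightarrow> w x"
    unfolding measurable_on_def by auto
  define g' where "g' n x = max (-2) (min 2 (g n x))" for n :: nat and x
  have g': "continuous_on UNIV (g' n)" "\<bar>g' n x\<bar> \<le> 2" for n x
    unfolding g'_def by (auto intro!: continuous_intros g(1))
  have [measurable]: "g' n \<in> borel_measurable borel" for n
    by (rule borel_measurable_continuous_onI[OF g'(1)])
  note [measurable] = w(1) B(1)
  have g'_lim: "(\<lambda>n. g' n x) \<longlonglongrightarrow> w x" if "x \<notin> N" for x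
  proof -
    have "(\<lambda>n. g' n x) \<longlonglongrightarrow> max (-2) (min 2 (w x))"
      unfolding g'_def by (intro tendsto_intros g(2) that)
    also have "max (-2) (min 2 (w x)) = w x" using w(2)[of x] by auto
    finally show ?thesis .
  qed
  have "AE x in lebesgue. x \<notin> N"
    using N by (intro AE_not_in) (simp add: negligible_iff_null_sets)
  then have "AE x in lebesgue. (\<lambda>n. ennreal \<bar>w x - g' n x\<bar> * indicator B x) \<longlonglongrightarrow> 0"
  proof eventually_elim
    case (elim x)
    have "(\<lambda>n. \<bar>w x - g' n x\<bar>) \<longlonglongrightarrow> \<bar>w x - w x\<bar>"
      by (intro tendsto_intros g'_lim elim)
    then have "(\<lambda>n. ennreal \<bar>w x - g' n x\<bar>) \<longlonglongrightarrow> 0"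
      using tendsto_ennrealI by fastforce
    then show ?case by (cases "x \<in> B") auto
  qed
  then have ae: "AE x in lborel. (\<lambda>n. ennreal \<bar>w x - g' n x\<bar> * indicator B x) \<longlonglongrightarrow> 0"
    by (subst (asm) AE_completion_iff) auto
  have "(\<lambda>n. \<integral>\<^sup>+x. ennreal \<bar>w x - g' n x\<bar> * indicator B x \<partial>lborel) \<longlonglongrightarrow> (\<integral>\<^sup>+x. 0 \<partial>(lborel :: pt measure))"
  proof (rule nn_integral_dominated_convergence[where w = "\<lambda>x. 4 * indicator B x" and
      u = "\<lambda>n x. ennreal \<bar>w x - g' n x\<bar> * indicator B x" and u' = "\<lambda>x. 0"])
    show "(\<integral>\<^sup>+x. 4 * indicator B x \<partial>lborel) < \<infinity>"
      using B by (simp add: nn_integral_cmult ennreal_mult_less_top)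
    show "AE x in lborel. ennreal \<bar>w x - g' n x\<bar> * indicator B x \<le> 4 * indicator B x" for n
    proof (rule AE_I2)
      fix x
      have "\<bar>w x - g' n x\<bar> \<le> 4" using w(2)[of x] g'(2)[of n x] by linarith
      then have "ennreal \<bar>w x - g' n x\<bar> \<le> 4" by (metis ennreal_leI ennreal_numeral zero_le_numeral)
      then show "ennreal \<bar>w x - g' n x\<bar> * indicator B x \<le> 4 * indicator B x"
        by (intro mult_right_mono) auto
    qed
  qed (use ae in auto)
  then have "(\<lambda>n. \<integral>\<^sup>+x. ennreal \<bar>w x - g' n x\<bar> * indicator B x \<partial>lborel) \<longlonglongrightarrow> 0" by simp
  from order_tendstoD(2)[OF this, of "ennreal \<eta>"] \<open>0 < \<eta>\<close> obtain n where
    "(\<integral>\<^sup>+x. ennreal \<bar>w x - g' n x\<bar> * indicator B x \<partial>lborel) < ennreal \<eta>"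
    by (auto simp: eventually_sequentially)
  then show thesis by (intro that[of "g' n"] g') auto
qed

text \<open>Compare with a continuous \<open>g\<close>: averaged over the shift, the error at the
  sample points is bounded by the L1 error of \<open>g\<close> itself, by
  \<open>nn_integral_lattice2\<close>, and \<open>g\<close> moves little between \<open>x\<close>
  and its sample point. For a fixed shift, samples of a merely measurable function need not be
  controlled by any L1 error.\<close>

lemma lattice_average_converges:
  fixes w :: "pt \<Rightarrow> real"
  assumes w: "w \<in> borel_measurable borel" "\<And>x. \<bar>w x\<bar> \<le> 2"
    and U: "U \<in> sets borel" "bounded U" and "0 < \<eta>"
  shows "\<exists>\<delta>>0. \<forall>h k. 0 < h \<longrightarrow> h < \<delta> \<longrightarrow> 0 < k \<longrightarrow> k < \<delta> \<longrightarrow>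
    (\<integral>\<^sup>+q. (\<integral>\<^sup>+x. ennreal \<bar>w (lat h k q x) - w x\<bar> * indicator U x \<partial>lborel) * indicator unit_square q \<partial>lborel) \<le> ennreal \<eta>"
proof -
  obtain M where M: "\<And>x. x \<in> U \<Longrightarrow> norm x \<le> M" using U(2) by (auto simp: bounded_iff)
  \<comment> \<open>The margin 2 leaves room for the sample point, whose distance from
    \<open>x\<close> is at most \<open>h + k\<close>.\<close>
  define B where "B = cball (0::pt) (M + 2)"
  have B: "compact B" "B \<in> sets borel" "emeasure lborel B < \<infinity>" unfolding B_def
    using emeasure_lborel_cball_finite[of "0::pt" "M + 2"] by auto
  define m where "m = measure lborel B"
  have m: "0 \<le> m" "emeasure lborel B = ennreal m"
    using B(3) by (auto simp: m_def emeasure_eq_ennreal_measure)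
  \<comment> \<open>Two L1 errors and one uniform error over \<open>B\<close>, of measure
    \<open>m\<close>, add up to \<open>\<eta>' * (2 + m)\<close>.\<close>
  define \<eta>' where "\<eta>' = \<eta> / (2 + m)"
  have \<eta>': "0 < \<eta>'" "\<eta>' + (\<eta>' * m + \<eta>') = \<eta>"
  proof -
    show "0 < \<eta>'" using \<open>0 < \<eta>\<close> m(1) unfolding \<eta>'_def by simp
    have "\<eta>' * (2 + m) = \<eta>" using m(1) unfolding \<eta>'_def by simp
    then show "\<eta>' + (\<eta>' * m + \<eta>') = \<eta>" by (simp add: algebra_simps)
  qed
  obtain g where g: "continuous_on UNIV g" "\<And>x. \<bar>g x\<bar> \<le> 2"
    "(\<integral>\<^sup>+x. ennreal \<bar>w x - g x\<bar> * indicator B x \<partial>lborel) \<le> ennreal \<eta>'"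
    by (rule continuous_L1_approx[OF w B(2,3) \<eta>'(1)]) (rule that, assumption+)
  have "uniformly_continuous_on B g"
    by (rule compact_uniformly_continuous[OF continuous_on_subset[OF g(1)] B(1)]) simp
  then obtain d where d: "0 < d" "\<And>x y. x \<in> B \<Longrightarrow> y \<in> B \<Longrightarrow> dist y x < d \<Longrightarrow> dist (g y) (g x) < \<eta>'"
    unfolding uniformly_continuous_on_def using \<eta>'(1) by meson
  have [measurable]: "g \<in> borel_measurable borel" by (rule borel_measurable_continuous_onI[OF g(1)])
  note [measurable] = w(1) U(1) B(2)
  show ?thesis
  proof (intro exI[of _ "min 1 (d / 2)"] conjI allI impI)
    show "0 < min 1 (d / 2)" using d by simp
    fix h k assume hk: "0 < h" "h < min 1 (d / 2)" "0 < k" "k < min 1 (d / 2)"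
    define f1 where "f1 x = ennreal \<bar>w x - g x\<bar> * indicator B x" for x
    have f1[measurable]: "f1 \<in> borel_measurable borel" unfolding f1_def by measurable
    have f1_lat: "(\<lambda>x. f1 (lat h k q x)) \<in> borel_measurable lborel" for q
      using measurable_compose[OF measurable_Pair1' measurable_lat[OF f1]] by simp
    have point: "ennreal \<bar>w (lat h k q x) - w x\<bar> * indicator U x \<le>
       f1 (lat h k q x) + (ennreal \<eta>' * indicator B x + f1 x)" if q: "q \<in> unit_square" for q x
    proof (cases "x \<in> U")
      case True
      let ?y = "lat h k q x"
      have close: "\<bar>fst ?y - fst x\<bar> \<le> h" "\<bar>snd ?y - snd x\<bar> \<le> k"
        using lat_close[OF q hk(1,3)] by auto
      have dist: "dist ?y x \<le> h + k"
      proof -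
        show ?thesis using dist_le_sum_abs[of ?y x] close by linarith
      qed
      then have "dist ?y x < d" "dist ?y x < 2" using hk by auto
      moreover have xB: "x \<in> B" using M[OF True] by (simp add: B_def)
      moreover have "norm ?y \<le> norm x + dist ?y x"
        by (metis dist_norm norm_triangle_sub add.commute norm_minus_commute)
      then have yB: "?y \<in> B"
        using M[OF True] \<open>dist ?y x < 2\<close> by (simp add: B_def)
      ultimately have "dist (g ?y) (g x) < \<eta>'" using d by blast
      then have "\<bar>w ?y - w x\<bar> \<le> \<bar>w ?y - g ?y\<bar> + (\<eta>' + \<bar>w x - g x\<bar>)"
        by (simp add: dist_real_def)
      then have "ennreal \<bar>w ?y - w x\<bar> \<le> ennreal \<bar>w ?y - g ?y\<bar> + (ennreal \<eta>' + ennreal \<bar>w x - g x\<bar>)"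
        using \<eta>'(1) by (simp add: ennreal_plus[symmetric] del: ennreal_plus)
      then show ?thesis using True xB yB by (simp add: f1_def)
    qed simp
    have f1_int: "(\<integral>\<^sup>+x. f1 x \<partial>lborel) \<le> ennreal \<eta>'" using g(3) unfolding f1_def .
    have "(\<integral>\<^sup>+q. (\<integral>\<^sup>+x. ennreal \<bar>w (lat h k q x) - w x\<bar> * indicator U x \<partial>lborel) * indicator unit_square q \<partial>lborel) \<le>
       (\<integral>\<^sup>+q. (\<integral>\<^sup>+x. f1 (lat h k q x) \<partial>lborel) * indicator unit_square q +
         (ennreal \<eta>' * emeasure lborel B + ennreal \<eta>') * indicator unit_square q \<partial>lborel)"
    proof (rule nn_integral_mono)
      fix q
      show "(\<integral>\<^sup>+x. ennreal \<bar>w (lat h k q x) - w x\<bar> * indicator U x \<partial>lborel) * indicator unit_square q \<le>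
        (\<integral>\<^sup>+x. f1 (lat h k q x) \<partial>lborel) * indicator unit_square q +
         (ennreal \<eta>' * emeasure lborel B + ennreal \<eta>') * indicator unit_square q"
      proof (cases "q \<in> unit_square")
        case True
        have "(\<integral>\<^sup>+x. ennreal \<bar>w (lat h k q x) - w x\<bar> * indicator U x \<partial>lborel) \<le>
          (\<integral>\<^sup>+x. f1 (lat h k q x) + (ennreal \<eta>' * indicator B x + f1 x) \<partial>lborel)"
          by (intro nn_integral_mono point True)
        also have "\<dots> = (\<integral>\<^sup>+x. f1 (lat h k q x) \<partial>lborel) + (ennreal \<eta>' * emeasure lborel B + (\<integral>\<^sup>+x. f1 x \<partial>lborel))"
          using f1_lat by (simp add: nn_integral_add nn_integral_cmult)
        also have "\<dots> \<le> (\<integral>\<^sup>+x. f1 (lat h k q x) \<partial>lborel) + (ennreal \<eta>' * emeasure lborel B + ennreal \<eta>')"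
          by (intro add_left_mono f1_int)
        finally show ?thesis using True by simp
      qed simp
    qed
    also have "\<dots> = (\<integral>\<^sup>+x. f1 x \<partial>lborel) + (ennreal \<eta>' * emeasure lborel B + ennreal \<eta>')"
    proof (subst nn_integral_add)
      show "(\<lambda>q. (\<integral>\<^sup>+x. f1 (lat h k q x) \<partial>lborel) * indicator unit_square q) \<in> borel_measurable lborel"
        by (intro borel_measurable_times_ennreal lborel.borel_measurable_nn_integral borel_measurable_indicator)
          (use measurable_lat[OF f1, of h k] in \<open>auto simp: unit_square_borel\<close>)
      show "(\<integral>\<^sup>+q. (\<integral>\<^sup>+x. f1 (lat h k q x) \<partial>lborel) * indicator unit_square q \<partial>lborel) +
         (\<integral>\<^sup>+q. (ennreal \<eta>' * emeasure lborel B + ennreal \<eta>') * indicator unit_square q \<partial>lborel) =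
         (\<integral>\<^sup>+x. f1 x \<partial>lborel) + (ennreal \<eta>' * emeasure lborel B + ennreal \<eta>')"
        unfolding nn_integral_lattice2[OF f1 hk(1,3)]
        by (simp add: nn_integral_cmult_indicator emeasure_unit_square)
    qed simp
    also have "\<dots> \<le> ennreal \<eta>' + (ennreal \<eta>' * ennreal m + ennreal \<eta>')"
      unfolding m(2) by (intro add_right_mono f1_int)
    also have "\<dots> = ennreal (\<eta>' + (\<eta>' * m + \<eta>'))"
      using \<eta>'(1) m(1) by (simp add: ennreal_mult[symmetric] ennreal_plus[symmetric] del: ennreal_plus)
    finally show "(\<integral>\<^sup>+q. (\<integral>\<^sup>+x. ennreal \<bar>w (lat h k q x) - w x\<bar> * indicator U x \<partial>lborel) *
        indicator unit_square q \<partial>lborel) \<le> ennreal \<eta>"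
      unfolding \<eta>'(2) .
  qed
qed

section \<open>Sums over lattice nodes and the choice of the shift\<close>

definition node :: "real \<Rightarrow> real \<Rightarrow> pt \<Rightarrow> int \<times> int \<Rightarrow> pt" where
  "node h k q p = (h * (fst q + of_int (fst p)), k * (snd q + of_int (snd p)))"

text \<open>The sampled function takes the value at the node on a whole cell of area
  \<open>h * k\<close>, so a sum over nodes is an integral over disjoint cells.\<close>

lemma lattice_sum_le:
  fixes e :: "pt \<Rightarrow> ennreal"
  assumes "0 < h" "0 < k" "finite S"
  shows "(\<Sum>p\<in>S. e (node h k q p)) \<le> ennreal (1 / (h * k)) * (\<integral>\<^sup>+x. e (lat h k q x) \<partial>lborel)"
proof -
  define cell where "cell p = {h * of_int (fst p)..<h * of_int (fst p) + h} \<times> {k * of_int (snd p)..<k * of_int (snd p) + k}"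
    for p :: "int \<times> int"
  have cell_iff: "x \<in> cell p \<longleftrightarrow> p = (\<lfloor>fst x / h\<rfloor>, \<lfloor>snd x / k\<rfloor>)" for x p
  proof -
    have "h * of_int i \<le> y \<and> y < h * of_int i + h \<longleftrightarrow> i = \<lfloor>y / h\<rfloor>" if "0 < h" for i and y h :: real
      using that by (subst eq_commute, subst floor_eq_iff) (auto simp: field_simps)
    from this[OF assms(1)] this[OF assms(2)] show ?thesis
      unfolding cell_def by (cases p; cases x) auto
  qed
  have [measurable]: "cell p \<in> sets borel" for p
    unfolding cell_def by (simp add: borel_prod[symmetric])
  have cell: "emeasure lborel (cell p) = ennreal (h * k)" for p
    unfolding cell_def lborel_prod[symmetric] using assms
    by (subst lborel.emeasure_pair_measure_Times) (auto simp: ennreal_mult)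
  have "ennreal (h * k) * (\<Sum>p\<in>S. e (node h k q p)) = (\<Sum>p\<in>S. \<integral>\<^sup>+x. e (node h k q p) * indicator (cell p) x \<partial>lborel)"
    unfolding sum_distrib_left
    by (intro sum.cong refl, subst nn_integral_cmult_indicator) (auto simp: cell mult.commute)
  also have "\<dots> = (\<integral>\<^sup>+x. (\<Sum>p\<in>S. e (node h k q p) * indicator (cell p) x) \<partial>lborel)"
    by (rule nn_integral_sum[symmetric]) measurable
  also have "\<dots> \<le> (\<integral>\<^sup>+x. e (lat h k q x) \<partial>lborel)"
  proof (rule nn_integral_mono)
    fix x
    have "(\<Sum>p\<in>S. e (node h k q p) * indicator (cell p) x) =
        (\<Sum>p\<in>S. if p = (\<lfloor>fst x / h\<rfloor>, \<lfloor>snd x / k\<rfloor>) then e (lat h k q x) else 0)"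
      by (intro sum.cong refl) (auto simp: indicator_def cell_iff node_def lat_def)
    also have "\<dots> \<le> e (lat h k q x)"
      using assms(3) by simp
    finally show "(\<Sum>p\<in>S. e (node h k q p) * indicator (cell p) x) \<le> e (lat h k q x)" .
  qed
  finally have "ennreal (1 / (h * k)) * (ennreal (h * k) * (\<Sum>p\<in>S. e (node h k q p))) \<le>
      ennreal (1 / (h * k)) * (\<integral>\<^sup>+x. e (lat h k q x) \<partial>lborel)"
    by (rule mult_left_mono) simp
  then show ?thesis
    using assms by (simp add: mult.assoc[symmetric] ennreal_mult[symmetric])
qed

definition step_energy :: "(pt \<Rightarrow> real) \<Rightarrow> real \<Rightarrow> real \<Rightarrow> pt \<Rightarrow> real" where
  "step_energy v h k x = (\<Sum>s\<in>{-1,1}. \<Sum>r\<in>{-1,1}. min \<bar>v (x + (s * h, 0)) - v x\<bar> \<bar>v (x + (0, r * k)) - v x\<bar>)"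

lemma step_energy_nonneg: "0 \<le> step_energy v h k x"
  unfolding step_energy_def by (intro sum_nonneg) auto

text \<open>The shift has to meet two demands at once. Scales with summable mean sampling error give
  almost everywhere convergence for almost every shift, and Fatou makes the liminf of the sampled
  energies finite for almost every shift. The shift is fixed first; the subsequence of bounded
  energy is extracted afterwards and inherits the convergence.\<close>

lemma lattice_selection:
  fixes v :: "pt \<Rightarrow> real"
  assumes v: "v \<in> borel_measurable borel" and C: "0 < C" and \<epsilon>: "\<epsilon> \<longlonglongrightarrow> 0"
    and h: "\<And>n. 0 < h n \<and> h n \<le> \<epsilon> n" and k: "\<And>n. 0 < k n \<and> k n \<le> \<epsilon> n"
    and bound: "\<And>n s r. s \<in> {-1,1} \<Longrightarrow> r \<in> {-1,1} \<Longrightarrow>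
       (\<integral>\<^sup>+x. indicator ({a1 + \<epsilon> n<..<b1 - \<epsilon> n} \<times> {a2 + \<epsilon> n<..<b2 - \<epsilon> n}) x *
         ennreal (min \<bar>v (x + (s * h n, 0)) - v x\<bar> \<bar>v (x + (0, r * k n)) - v x\<bar>) \<partial>lborel)
       \<le> ennreal (C * h n * k n)"
  obtains K q r where "q \<in> unit_square" "(\<lambda>n. \<epsilon> (r n)) \<longlonglongrightarrow> 0"
    "AE x in lborel. x \<in> {a1<..<b1} \<times> {a2<..<b2} \<longrightarrow> (\<lambda>n. v (lat (h (r n)) (k (r n)) q x)) \<longlonglongrightarrow> v x"
    "\<And>n S. finite S \<Longrightarrow>
       node (h (r n)) (k (r n)) q ` S \<subseteq> {a1 + \<epsilon> (r n)<..<b1 - \<epsilon> (r n)} \<times> {a2 + \<epsilon> (r n)<..<b2 - \<epsilon> (r n)} \<Longrightarrow>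
       (\<Sum>p\<in>S. step_energy v (h (r n)) (k (r n)) (node (h (r n)) (k (r n)) q p)) \<le> K"
proof -
  let ?\<Omega> = "{a1<..<b1} \<times> {a2<..<b2}"
  define U where "U n = {a1 + \<epsilon> n<..<b1 - \<epsilon> n} \<times> {a2 + \<epsilon> n<..<b2 - \<epsilon> n}" for n
  have [measurable]: "U n \<in> sets borel" "?\<Omega> \<in> sets borel" for n by (simp_all add: U_def open_Times)
  note [measurable] = v
  \<comment> \<open>No integrability of \<open>v\<close> is available up to the boundary, so it is
    compressed to a bounded function for the L1 estimates; \<open>tan\<close> recovers the
    convergence at the end. The bound 2 exceeds half of pi.\<close>
  define w where "w x = arctan (v x)" for x
  have w_meas: "w \<in> borel_measurable borel"
    unfolding w_def by (rule measurable_compose[OF v borel_measurable_continuous_onI]) (intro continuous_intros)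
  have w2: "\<bar>w x\<bar> \<le> 2" for x
    using arctan_bounded[of "v x"] pi_half_less_two unfolding w_def by auto
  have "bounded ?\<Omega>" by (intro bounded_Times) auto
  have "\<exists>n. \<epsilon> n < 1 / real (Suc m) \<and>
    (\<integral>\<^sup>+q. (\<integral>\<^sup>+x. ennreal \<bar>w (lat (h n) (k n) q x) - w x\<bar> * indicator ?\<Omega> x \<partial>lborel) * indicator unit_square q \<partial>lborel)
      \<le> ennreal ((1/2)^m)" for m
  proof -
    obtain \<delta> where \<delta>: "0 < \<delta>" "\<And>h k. 0 < h \<Longrightarrow> h < \<delta> \<Longrightarrow> 0 < k \<Longrightarrow> k < \<delta> \<Longrightarrow>
      (\<integral>\<^sup>+q. (\<integral>\<^sup>+x. ennreal \<bar>w (lat h k q x) - w x\<bar> * indicator ?\<Omega> x \<partial>lborel) * indicator unit_square q \<partial>lborel) \<le> ennreal ((1/2)^m)"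
      using lattice_average_converges[OF w_meas w2 _ \<open>bounded ?\<Omega>\<close>, of "(1/2)^m"] by auto
    have "0 < min \<delta> (1 / real (Suc m))" using \<delta> by simp
    from order_tendstoD(2)[OF \<epsilon> this] obtain n where "\<epsilon> n < min \<delta> (1 / real (Suc m))"
      unfolding eventually_sequentially by blast
    then show ?thesis using h[of n] k[of n] by (intro exI[of _ n] conjI \<delta>(2)) auto
  qed
  then have "\<exists>N. \<forall>m. \<epsilon> (N m) < 1 / real (Suc m) \<and>
    (\<integral>\<^sup>+q. (\<integral>\<^sup>+x. ennreal \<bar>w (lat (h (N m)) (k (N m)) q x) - w x\<bar> * indicator ?\<Omega> x \<partial>lborel) * indicator unit_square q \<partial>lborel)
      \<le> ennreal ((1/2)^m)"
    by (intro choice allI)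
  then obtain N where N': "\<forall>m. \<epsilon> (N m) < 1 / real (Suc m) \<and>
    (\<integral>\<^sup>+q. (\<integral>\<^sup>+x. ennreal \<bar>w (lat (h (N m)) (k (N m)) q x) - w x\<bar> * indicator ?\<Omega> x \<partial>lborel) * indicator unit_square q \<partial>lborel)
      \<le> ennreal ((1/2)^m)" ..
  note N = conjunct1[OF spec[OF N']] conjunct2[OF spec[OF N']]
  define \<Phi> where "\<Phi> m q = (\<integral>\<^sup>+x. ennreal \<bar>w (lat (h (N m)) (k (N m)) q x) - w x\<bar> * indicator ?\<Omega> x \<partial>lborel)" for m q
  define e where "e m x = indicator (U (N m)) x * ennreal (step_energy v (h (N m)) (k (N m)) x)" for m x
  \<comment> \<open>By \<open>lattice_sum_le\<close> this dominates the sum of the step energies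
    over the nodes of the inner box. Its mean over the shift is at most \<open>4 * C\<close> at
    every scale, the 4 counting pairs of signs.\<close>
  define \<Psi> where "\<Psi> m q = ennreal (1 / (h (N m) * k (N m))) * (\<integral>\<^sup>+x. e m (lat (h (N m)) (k (N m)) q x) \<partial>lborel)" for m q
  have w_lat: "(\<lambda>(q, x). w (lat h k q x)) \<in> borel_measurable (borel \<Otimes>\<^sub>M borel)" for h k
    by (rule measurable_lat[OF w_meas])
  have abs_meas: "(\<lambda>(q, x). ennreal \<bar>w (lat h k q x) - w x\<bar> * indicator ?\<Omega> x) \<in> borel_measurable (borel \<Otimes>\<^sub>M borel)" for h k
    using w_lat[of h k] measurable_compose[OF measurable_snd w_meas]
      measurable_compose[OF measurable_snd borel_measurable_indicator[of ?\<Omega> borel]]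
    by (auto simp: case_prod_beta' intro!: borel_measurable_times_ennreal measurable_compose[OF _ measurable_ennreal] borel_measurable_abs borel_measurable_diff)
  have \<Phi>_meas[measurable]: "\<Phi> m \<in> borel_measurable borel" for m
    unfolding \<Phi>_def[abs_def] by (rule lborel.borel_measurable_nn_integral) (use abs_meas in \<open>auto cong: measurable_cong_sets\<close>)
  have e_meas[measurable]: "e m \<in> borel_measurable borel" for m
  proof -
    have "(\<lambda>x. v (x + (s * h (N m), 0))) \<in> borel_measurable borel" "(\<lambda>x. v (x + (0, s * k (N m)))) \<in> borel_measurable borel" for s
      by (rule measurable_compose[OF _ v], intro borel_measurable_continuous_onI continuous_intros)+
    note [measurable] = this
    show ?thesis unfolding e_def[abs_def] step_energy_def by measurable
  qed
  have \<Psi>_meas[measurable]: "\<Psi> m \<in> borel_measurable borel" for m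
    unfolding \<Psi>_def[abs_def]
    by (intro borel_measurable_times_ennreal lborel.borel_measurable_nn_integral)
      (use measurable_lat[OF e_meas] in auto)
  have e_int: "(\<integral>\<^sup>+x. e m x \<partial>lborel) \<le> ennreal (4 * C * (h (N m) * k (N m)))" for m
  proof -
    let ?h = "h (N m)" and ?k = "k (N m)"
    have [measurable]: "(\<lambda>x. v (x + (s * ?h, 0))) \<in> borel_measurable borel" "(\<lambda>x. v (x + (0, s * ?k))) \<in> borel_measurable borel" for s
      by (rule measurable_compose[OF _ v], intro borel_measurable_continuous_onI continuous_intros)+
    have ennreal_step: "ennreal (step_energy v ?h ?k x) =
        (\<Sum>s\<in>{-1,1}. \<Sum>r\<in>{-1,1}. ennreal (min \<bar>v (x + (s * ?h, 0)) - v x\<bar> \<bar>v (x + (0, r * ?k)) - v x\<bar>))" for x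
      by (simp add: step_energy_def)
    have "(\<integral>\<^sup>+x. e m x \<partial>lborel) = (\<integral>\<^sup>+x. (\<Sum>s\<in>{-1,1}. \<Sum>r\<in>{-1,1}. indicator (U (N m)) x *
         ennreal (min \<bar>v (x + (s * ?h, 0)) - v x\<bar> \<bar>v (x + (0, r * ?k)) - v x\<bar>)) \<partial>lborel)"
      unfolding e_def ennreal_step sum_distrib_left ..
    also have "\<dots> = (\<Sum>s\<in>{-1,1}. \<integral>\<^sup>+x. (\<Sum>r\<in>{-1,1}. indicator (U (N m)) x *
         ennreal (min \<bar>v (x + (s * ?h, 0)) - v x\<bar> \<bar>v (x + (0, r * ?k)) - v x\<bar>)) \<partial>lborel)"
      by (rule nn_integral_sum) measurable
    also have "\<dots> = (\<Sum>s\<in>{-1,1}. \<Sum>r\<in>{-1,1}. \<integral>\<^sup>+x. indicator (U (N m)) x *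
         ennreal (min \<bar>v (x + (s * ?h, 0)) - v x\<bar> \<bar>v (x + (0, r * ?k)) - v x\<bar>) \<partial>lborel)"
      by (intro sum.cong refl nn_integral_sum) measurable
    also have "\<dots> \<le> (\<Sum>s\<in>{-1,1::real}. \<Sum>r\<in>{-1,1::real}. ennreal (C * ?h * ?k))"
      unfolding U_def by (intro sum_mono bound)
    also have "\<dots> = ennreal (4 * C * (?h * ?k))"
    proof -
      have "ennreal (4 * C * (?h * ?k)) = ennreal 4 * ennreal (C * ?h * ?k)"
        using C h[of "N m"] k[of "N m"] by (subst ennreal_mult[symmetric]) (auto simp: mult.assoc)
      then show ?thesis by simp
    qed
    finally show ?thesis .
  qed
  have \<Psi>_int: "(\<integral>\<^sup>+q. \<Psi> m q * indicator unit_square q \<partial>lborel) \<le> ennreal (4 * C)" for m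
  proof -
    have pos: "0 < h (N m)" "0 < k (N m)" using h k by auto
    have "(\<integral>\<^sup>+q. \<Psi> m q * indicator unit_square q \<partial>lborel) =
      (\<integral>\<^sup>+q. ennreal (1 / (h (N m) * k (N m))) * ((\<integral>\<^sup>+x. e m (lat (h (N m)) (k (N m)) q x) \<partial>lborel) * indicator unit_square q) \<partial>lborel)"
      by (simp add: \<Psi>_def mult.assoc)
    also have "\<dots> = ennreal (1 / (h (N m) * k (N m))) * (\<integral>\<^sup>+q. (\<integral>\<^sup>+x. e m (lat (h (N m)) (k (N m)) q x) \<partial>lborel) * indicator unit_square q \<partial>lborel)"
      by (rule nn_integral_cmult)
        (intro borel_measurable_times_ennreal lborel.borel_measurable_nn_integral borel_measurable_indicator;
         use measurable_lat[OF e_meas] in \<open>auto simp: unit_square_borel\<close>)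
    also have "\<dots> \<le> ennreal (1 / (h (N m) * k (N m))) * ennreal (4 * C * (h (N m) * k (N m)))"
      unfolding nn_integral_lattice2[OF e_meas pos] by (intro mult_left_mono e_int) simp
    also have "\<dots> = ennreal (4 * C)"
      using pos C by (simp add: ennreal_mult[symmetric])
    finally show ?thesis .
  qed
  have "(\<integral>\<^sup>+q. (\<Sum>m. \<Phi> m q * indicator unit_square q) \<partial>lborel) = (\<Sum>m. \<integral>\<^sup>+q. \<Phi> m q * indicator unit_square q \<partial>lborel)"
    by (rule nn_integral_suminf) measurable
  also have "\<dots> \<le> (\<Sum>m. ennreal ((1/2)^m))"
    by (intro suminf_le) (use N(2) in \<open>auto simp: \<Phi>_def\<close>)
  also have "\<dots> = ennreal (\<Sum>m. (1/2)^m)"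
    by (rule suminf_ennreal2) (auto intro: summable_geometric)
  also have "\<dots> < \<infinity>" by simp
  finally have "AE q in lborel. (\<Sum>m. \<Phi> m q * indicator unit_square q) \<noteq> \<infinity>"
    by (intro nn_integral_PInf_AE) auto
  moreover have "AE q in lborel. liminf (\<lambda>m. \<Psi> m q * indicator unit_square q) \<noteq> \<infinity>"
  proof (rule nn_integral_PInf_AE)
    have "(\<integral>\<^sup>+q. liminf (\<lambda>m. \<Psi> m q * indicator unit_square q) \<partial>lborel) \<le>
      liminf (\<lambda>m. \<integral>\<^sup>+q. \<Psi> m q * indicator unit_square q \<partial>lborel)"
      by (rule nn_integral_liminf) measurable
    also have "\<dots> \<le> ennreal (4 * C)"
      by (intro Liminf_le) (auto simp: \<Psi>_int)
    also have "\<dots> < \<infinity>" by simp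
    finally show "(\<integral>\<^sup>+q. liminf (\<lambda>m. \<Psi> m q * indicator unit_square q) \<partial>lborel) \<noteq> \<infinity>" by simp
  qed measurable
  ultimately have ae: "AE q in lborel. (\<Sum>m. \<Phi> m q * indicator unit_square q) \<noteq> \<infinity> \<and>
      liminf (\<lambda>m. \<Psi> m q * indicator unit_square q) \<noteq> \<infinity>" by eventually_elim simp
  have "\<exists>q\<in>unit_square. (\<Sum>m. \<Phi> m q * indicator unit_square q) \<noteq> \<infinity> \<and>
      liminf (\<lambda>m. \<Psi> m q * indicator unit_square q) \<noteq> \<infinity>"
  proof (rule ccontr)
    assume not: "\<not> ?thesis"
    from ae have "AE q in lborel. q \<notin> unit_square"
      by eventually_elim (use not in blast)
    then have "emeasure lborel {q \<in> space lborel. q \<in> unit_square} = 0" by (rule emeasure_eq_0_AE)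
    then show False by (simp add: emeasure_unit_square)
  qed
  then obtain q where q: "q \<in> unit_square" "(\<Sum>m. \<Phi> m q) \<noteq> \<infinity>" "liminf (\<lambda>m. \<Psi> m q) \<noteq> \<infinity>"
    by auto
  obtain K where K: "0 \<le> K" "liminf (\<lambda>m. \<Psi> m q) < ennreal K"
  proof -
    obtain K0 where "liminf (\<lambda>m. \<Psi> m q) = ennreal K0" "0 \<le> K0"
      using q(3) by (cases "liminf (\<lambda>m. \<Psi> m q)") auto
    then show ?thesis by (intro that[of "K0 + 1"]) (auto simp: ennreal_less_iff)
  qed
  have "frequently (\<lambda>m. \<Psi> m q < ennreal K) sequentially"
  proof (rule ccontr)
    assume "\<not> ?thesis"
    then have "eventually (\<lambda>m. ennreal K \<le> \<Psi> m q) sequentially"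
      by (simp add: not_frequently not_less)
    from Liminf_bounded[OF this] K(2) show False by simp
  qed
  then have "infinite {m. \<Psi> m q < ennreal K}"
    by (simp add: cofinite_eq_sequentially[symmetric] frequently_cofinite)
  from infinite_enumerate[OF this] obtain r :: "nat \<Rightarrow> nat" where
    r: "strict_mono r" "\<And>n. \<Psi> (r n) q < ennreal K" by auto
  show thesis
  proof (rule that[of q "\<lambda>n. N (r n)" K])
    show "q \<in> unit_square" by (rule q(1))
    have \<epsilon>_pos: "0 < \<epsilon> n" for n using h[of n] by linarith
    have "(\<lambda>m. \<epsilon> (N m)) \<longlonglongrightarrow> 0"
      by (rule tendsto_sandwich[OF _ _ tendsto_const lim_1_over_n[THEN LIMSEQ_Suc]])
        (auto intro!: always_eventually less_imp_le N \<epsilon>_pos simp del: of_nat_Suc)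
    from LIMSEQ_subseq_LIMSEQ[OF this r(1)] show "(\<lambda>n. \<epsilon> (N (r n))) \<longlonglongrightarrow> 0"
      by (simp add: o_def)
    have "(\<integral>\<^sup>+x. (\<Sum>m. ennreal \<bar>w (lat (h (N m)) (k (N m)) q x) - w x\<bar> * indicator ?\<Omega> x) \<partial>lborel) = (\<Sum>m. \<Phi> m q)"
      unfolding \<Phi>_def
      by (rule nn_integral_suminf)
        (use measurable_compose[OF measurable_Pair1' abs_meas] in auto)
    with q(2) have fin: "(\<integral>\<^sup>+x. (\<Sum>m. ennreal \<bar>w (lat (h (N m)) (k (N m)) q x) - w x\<bar> * indicator ?\<Omega> x) \<partial>lborel) \<noteq> \<infinity>"
      by simp
    have "AE x in lborel. (\<Sum>m. ennreal \<bar>w (lat (h (N m)) (k (N m)) q x) - w x\<bar> * indicator ?\<Omega> x) \<noteq> \<infinity>"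
      by (rule nn_integral_PInf_AE[OF _ fin], intro borel_measurable_suminf_order)
        (use measurable_compose[OF measurable_Pair1' abs_meas] in auto)
    then show "AE x in lborel. x \<in> ?\<Omega> \<longrightarrow> (\<lambda>n. v (lat (h (N (r n))) (k (N (r n))) q x)) \<longlonglongrightarrow> v x"
    proof eventually_elim
      case (elim x)
      show ?case
      proof
        assume "x \<in> ?\<Omega>"
        with elim have "(\<Sum>m. ennreal \<bar>w (lat (h (N m)) (k (N m)) q x) - w x\<bar>) \<noteq> top" by simp
        then have "summable (\<lambda>m. \<bar>w (lat (h (N m)) (k (N m)) q x) - w x\<bar>)"
          by (intro summable_suminf_not_top) auto
        then have "(\<lambda>m. w (lat (h (N m)) (k (N m)) q x) - w x) \<longlonglongrightarrow> 0"
          by (intro tendsto_rabs_zero_cancel[OF summable_LIMSEQ_zero])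
        then have "(\<lambda>m. w (lat (h (N m)) (k (N m)) q x)) \<longlonglongrightarrow> w x"
          by (simp add: LIM_zero_iff)
        then have "(\<lambda>m. tan (w (lat (h (N m)) (k (N m)) q x))) \<longlonglongrightarrow> tan (w x)"
          by (intro isCont_tendsto_compose[OF isCont_tan]) (simp_all add: w_def)
        then have "(\<lambda>m. v (lat (h (N m)) (k (N m)) q x)) \<longlonglongrightarrow> v x"
          by (simp add: w_def tan_arctan)
        from LIMSEQ_subseq_LIMSEQ[OF this r(1)]
        show "(\<lambda>n. v (lat (h (N (r n))) (k (N (r n))) q x)) \<longlonglongrightarrow> v x" by (simp add: o_def)
      qed
    qed
    fix n and S :: "(int \<times> int) set"
    let ?h = "h (N (r n))" and ?k = "k (N (r n))"
    assume S: "finite S" "node ?h ?k q ` S \<subseteq> {a1 + \<epsilon> (N (r n))<..<b1 - \<epsilon> (N (r n))} \<times> {a2 + \<epsilon> (N (r n))<..<b2 - \<epsilon> (N (r n))}"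
    have "ennreal (\<Sum>p\<in>S. step_energy v ?h ?k (node ?h ?k q p)) = (\<Sum>p\<in>S. e (r n) (node ?h ?k q p))"
    proof -
      have "node ?h ?k q p \<in> U (N (r n))" if "p \<in> S" for p
        using S(2) that unfolding U_def by blast
      then have "(\<Sum>p\<in>S. e (r n) (node ?h ?k q p)) = (\<Sum>p\<in>S. ennreal (step_energy v ?h ?k (node ?h ?k q p)))"
        unfolding e_def by (intro sum.cong refl) simp
      also have "\<dots> = ennreal (\<Sum>p\<in>S. step_energy v ?h ?k (node ?h ?k q p))"
        by (rule sum_ennreal) (rule step_energy_nonneg)
      finally show ?thesis ..
    qed
    also have "\<dots> \<le> \<Psi> (r n) q"
      unfolding \<Psi>_def using lattice_sum_le[OF conjunct1[OF h] conjunct1[OF k] S(1), of "e (r n)" "N (r n)" "N (r n)" q] .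
    also have "\<dots> < ennreal K" by (rule r(2))
    finally show "(\<Sum>p\<in>S. step_energy v ?h ?k (node ?h ?k q p)) \<le> K"
      using K(1) by (simp add: ennreal_le_iff less_imp_le ennreal_less_iff sum_nonneg step_energy_nonneg)
  qed
qed

section \<open>Corners of superlevel sets\<close>

definition mixed :: "(pt \<Rightarrow> real) \<Rightarrow> real \<Rightarrow> real \<Rightarrow> real \<Rightarrow> real \<Rightarrow> real" where
  "mixed w a b e f = w (b, f) - w (a, f) - w (b, e) + w (a, e)"

definition lev :: "(pt \<Rightarrow> real) \<Rightarrow> real \<Rightarrow> pt \<Rightarrow> real" where
  "lev v t x = of_bool (t < v x)"

text \<open>On the rectangles with vertices in \<open>Q\<close> and sides avoiding \<open>F\<close> the mixed second
  difference of \<open>w\<close> is given by the finitely supported measure with weights \<open>c\<close> on \<open>P\<close>.\<close>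

definition corner_data ::
  "pt set \<Rightarrow> (pt \<Rightarrow> real) \<Rightarrow> pt set \<Rightarrow> (pt \<Rightarrow> real) \<Rightarrow> real set \<Rightarrow> bool" where
  "corner_data Q w P c F \<longleftrightarrow> finite P \<and> finite F \<and> (\<forall>p\<in>P. c p \<noteq> 0 \<and> fst p \<in> F \<and> snd p \<in> F) \<and>
     (\<forall>a b e f. a < b \<longrightarrow> e < f \<longrightarrow> {a, b, e, f} \<inter> F = {} \<longrightarrow> {a, b} \<times> {e, f} \<subseteq> Q \<longrightarrow>
        mixed w a b e f = (\<Sum>p\<in>{p\<in>P. a < fst p \<and> fst p < b \<and> e < snd p \<and> snd p < f}. c p))"

section \<open>One level: from lattice blocks to limiting atoms\<close>

lemma sum_int_telescope:
  fixes f :: "int \<Rightarrow> 'a::ab_group_add"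
  assumes "a \<le> b"
  shows "(\<Sum>i\<in>{a..<b}. f (i + 1) - f i) = f b - f a"
  using assms
proof (induction b rule: int_ge_induct)
  case (step b)
  have "{a..<b + 1} = insert b {a..<b}" using step.hyps by auto
  then show ?case using step.IH by simp
qed simp

lemma convergent_subseq_finite_family:
  fixes f :: "nat \<Rightarrow> nat \<Rightarrow> 'a::heine_borel"
  assumes "\<And>k. k < N \<Longrightarrow> bounded (range (\<lambda>n. f n k))"
  shows "\<exists>r l. strict_mono (r :: nat \<Rightarrow> nat) \<and> (\<forall>k<N. (\<lambda>n. f (r n) k) \<longlonglongrightarrow> l k)"
  using assms
proof (induction N)
  case 0
  show ?case by (rule exI[of _ id]) (auto simp: strict_mono_def)
next
  case (Suc N)
  then obtain r l where r: "strict_mono r" "\<And>k. k < N \<Longrightarrow> (\<lambda>n. f (r n) k) \<longlonglongrightarrow> l k"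
    by (metis less_Suc_eq)
  have "bounded (range (\<lambda>n. f (r n) N))"
    by (rule bounded_subset[OF Suc.prems[of N]]) auto
  then obtain r' l' where r': "strict_mono r'" "((\<lambda>n. f (r n) N) \<circ> r') \<longlonglongrightarrow> l'"
    using bounded_imp_convergent_subsequence by blast
  have "(\<lambda>n. f ((r \<circ> r') n) k) \<longlonglongrightarrow> (l(N := l')) k" if "k < Suc N" for k
  proof (cases "k = N")
    case True
    then show ?thesis using r'(2) by (simp add: o_def)
  next
    case False
    then have "(\<lambda>n. f (r n) k) \<longlonglongrightarrow> l k" using that r(2) by simp
    from LIMSEQ_subseq_LIMSEQ[OF this r'(1)] show ?thesis
      using False by (simp add: o_def)
  qed
  moreover have "strict_mono (r \<circ> r')" using r(1) r'(1) by (rule strict_mono_o)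
  ultimately show ?case by blast
qed

text \<open>As long as the limits differ, weak and strict inequalities have the same limit; this is
  how half-open lattice rectangles turn into open ones.\<close>

lemma eventually_less_iff_limit:
  fixes f g :: "nat \<Rightarrow> real"
  assumes "f \<longlonglongrightarrow> x" "g \<longlonglongrightarrow> y" "x \<noteq> y"
  shows "eventually (\<lambda>n. (f n \<le> g n \<longleftrightarrow> x < y) \<and> (f n < g n \<longleftrightarrow> x < y)) sequentially"
proof -
  have lim: "(\<lambda>n. g n - f n) \<longlonglongrightarrow> y - x"
    by (intro tendsto_diff assms)
  show ?thesis
  proof (cases "x < y")
    case True
    with order_tendstoD(1)[OF lim, of 0] have "eventually (\<lambda>n. 0 < g n - f n) sequentially" by simp
    then show ?thesis by eventually_elim (use True in auto)
  next
    case False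
    with assms(3) order_tendstoD(2)[OF lim, of 0] have "eventually (\<lambda>n. g n - f n < 0) sequentially" by simp
    then show ?thesis by eventually_elim (use False in auto)
  qed
qed

text \<open>Going round the block the signs alternate. If every vertex agreed with one of its
  neighbours, the values would be equal in pairs along two opposite edges and the alternating sum
  would cancel.\<close>

lemma nonzero_mixed_difference_vertex:
  fixes a b c d :: real
  assumes "d - c - b + a \<noteq> 0" "a = 0 \<or> a = 1" "b = 0 \<or> b = 1" "c = 0 \<or> c = 1" "d = 0 \<or> d = 1"
  shows "b \<noteq> a \<and> c \<noteq> a \<or> b \<noteq> a \<and> d \<noteq> b \<or> d \<noteq> c \<and> c \<noteq> a \<or> d \<noteq> c \<and> d \<noteq> b"
  using assms(2-5) assms(1) by (elim disjE) simp_all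

text \<open>The sampled lattices in abstract form: \<alpha> and \<beta> give the coordinates of the
  lattice lines, \<open>I\<close> and \<open>J\<close> the index of the line attached to a position,
  \<open>S\<close> the nodes at which the energy is available, and \<open>G\<close> the points where
  the samples converge.\<close>

locale lattice_limit =
  fixes v :: "pt \<Rightarrow> real" and \<alpha> \<beta> :: "nat \<Rightarrow> int \<Rightarrow> real" and I J :: "nat \<Rightarrow> real \<Rightarrow> int"
    and S :: "nat \<Rightarrow> (int \<times> int) set" and \<Omega> G :: "pt set" and M :: real
  assumes \<alpha>_mono: "strict_mono (\<alpha> n)" and \<beta>_mono: "strict_mono (\<beta> n)"
    and I_mono: "s \<le> s' \<Longrightarrow> I n s \<le> I n s'" and J_mono: "s \<le> s' \<Longrightarrow> J n s \<le> J n s'"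
    and \<alpha>_lim: "(\<lambda>n. \<alpha> n (I n s)) \<longlonglongrightarrow> s" and \<beta>_lim: "(\<lambda>n. \<beta> n (J n s)) \<longlonglongrightarrow> s"
    and finite_S: "finite (S n)"
    and S_bounded: "(i, j) \<in> S n \<Longrightarrow> \<bar>\<alpha> n i\<bar> \<le> M \<and> \<bar>\<beta> n j\<bar> \<le> M"
    and S_exhausts: "(a, e) \<in> \<Omega> \<Longrightarrow> (b, f) \<in> \<Omega> \<Longrightarrow>
      eventually (\<lambda>n. {I n a..I n b} \<times> {J n e..J n f} \<subseteq> S n) sequentially"
    and \<Omega>_box: "(a, e) \<in> \<Omega> \<Longrightarrow> (b, f) \<in> \<Omega> \<Longrightarrow> {a..b} \<times> {e..f} \<subseteq> \<Omega>"
    and G_subset: "G \<subseteq> \<Omega>"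
    and G_lim: "x \<in> G \<Longrightarrow> (\<lambda>n. v (\<alpha> n (I n (fst x)), \<beta> n (J n (snd x)))) \<longlonglongrightarrow> v x"
begin

definition X :: "real \<Rightarrow> nat \<Rightarrow> int \<Rightarrow> int \<Rightarrow> real" where
  "X t n i j = lev v t (\<alpha> n i, \<beta> n j)"

text \<open>Corners together with their orientation: \<sigma> and \<tau> point to the neighbours
  across which the indicator jumps. Only the corner itself has to lie in \<open>S\<close>, in
  accordance with the sums of step energies.\<close>

definition K :: "real \<Rightarrow> nat \<Rightarrow> (int \<times> int \<times> int \<times> int) set" where
  "K t n = {(i, j, \<sigma>, \<tau>). (i, j) \<in> S n \<and> \<sigma> \<in> {-1, 1} \<and> \<tau> \<in> {-1, 1} \<and>
     X t n (i + \<sigma>) j \<noteq> X t n i j \<and> X t n i (j + \<tau>) \<noteq> X t n i j}"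

definition D :: "real \<Rightarrow> nat \<Rightarrow> int \<Rightarrow> int \<Rightarrow> real" where
  "D t n i j = X t n (i + 1) (j + 1) - X t n i (j + 1) - X t n (i + 1) j + X t n i j"

text \<open>All four vertices are required in \<open>S\<close>, so that the one which turns out to
  be a corner is counted by \<open>K\<close>.\<close>

definition B :: "real \<Rightarrow> nat \<Rightarrow> (int \<times> int) set" where
  "B t n = {(i, j). {i, i + 1} \<times> {j, j + 1} \<subseteq> S n \<and> D t n i j \<noteq> 0}"

lemma X_01: "X t n i j = 0 \<or> X t n i j = 1"
  unfolding X_def lev_def by auto

lemma abs_D_le: "\<bar>D t n i j\<bar> \<le> 2"
  using X_01[of t n "i+1" "j+1"] X_01[of t n i "j+1"] X_01[of t n "i+1" j] X_01[of t n i j]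
  unfolding D_def by (elim disjE) simp_all

lemma finite_K: "finite (K t n)"
proof (rule finite_subset)
  show "K t n \<subseteq> (\<lambda>((i, j), \<sigma>, \<tau>). (i, j, \<sigma>, \<tau>)) ` (S n \<times> {-1, 1} \<times> {-1, 1})"
    unfolding K_def by force
  show "finite ((\<lambda>((i, j), \<sigma>, \<tau>). (i, j, \<sigma>, \<tau>)) ` (S n \<times> {-1, 1} \<times> {-1, 1 :: int}))"
    using finite_S by simp
qed

text \<open>A block with nonzero mixed difference has a vertex at which both neighbours in the block
  have the other value.\<close>

lemma card_B_le: "finite (B t n) \<and> card (B t n) \<le> card (K t n)"
proof -
  \<comment> \<open>Sends an oriented corner to the lower left index of the block into which it
    opens.\<close>
  define \<pi> :: "int \<times> int \<times> int \<times> int \<Rightarrow> int \<times> int" where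
    "\<pi> = (\<lambda>(i, j, \<sigma>, \<tau>). (if \<sigma> = 1 then i else i - 1, if \<tau> = 1 then j else j - 1))"
  have "B t n \<subseteq> \<pi> ` K t n"
  proof
    fix x assume "x \<in> B t n"
    then obtain i j where x: "x = (i, j)" and sub: "{i, i + 1} \<times> {j, j + 1} \<subseteq> S n" and D: "D t n i j \<noteq> 0"
      unfolding B_def by blast
    let ?X = "X t n"
    have vert: "(i, j) \<in> S n" "(i + 1, j) \<in> S n" "(i, j + 1) \<in> S n" "(i + 1, j + 1) \<in> S n"
      using sub by auto
    consider "?X (i + 1) j \<noteq> ?X i j" "?X i (j + 1) \<noteq> ?X i j"
      | "?X (i + 1) j \<noteq> ?X i j" "?X (i + 1) (j + 1) \<noteq> ?X (i + 1) j"
      | "?X (i + 1) (j + 1) \<noteq> ?X i (j + 1)" "?X i (j + 1) \<noteq> ?X i j"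
      | "?X (i + 1) (j + 1) \<noteq> ?X i (j + 1)" "?X (i + 1) (j + 1) \<noteq> ?X (i + 1) j"
      using nonzero_mixed_difference_vertex[OF D[unfolded D_def] X_01 X_01 X_01 X_01] by blast
    then show "x \<in> \<pi> ` K t n"
    proof cases
      case 1
      then have "(i, j, 1, 1) \<in> K t n" using vert unfolding K_def by simp
      moreover have "\<pi> (i, j, 1, 1) = x" by (simp add: \<pi>_def x)
      ultimately show ?thesis by (metis image_eqI)
    next
      case 2
      then have "(i + 1, j, -1, 1) \<in> K t n" using vert unfolding K_def by simp
      moreover have "\<pi> (i + 1, j, -1, 1) = x" by (simp add: \<pi>_def x)
      ultimately show ?thesis by (metis image_eqI)
    next
      case 3
      then have "(i, j + 1, 1, -1) \<in> K t n" using vert unfolding K_def by simp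
      moreover have "\<pi> (i, j + 1, 1, -1) = x" by (simp add: \<pi>_def x)
      ultimately show ?thesis by (metis image_eqI)
    next
      case 4
      then have "(i + 1, j + 1, -1, -1) \<in> K t n" using vert unfolding K_def by simp
      moreover have "\<pi> (i + 1, j + 1, -1, -1) = x" by (simp add: \<pi>_def x)
      ultimately show ?thesis by (metis image_eqI)
    qed
  qed
  then show ?thesis
    using finite_K[of t n] by (meson card_image_le card_mono finite_imageI finite_subset order_trans)
qed

lemma sum_D:
  assumes "a \<le> b" "e \<le> f"
  shows "X t n b f - X t n a f - X t n b e + X t n a e = (\<Sum>(i, j)\<in>{a..<b} \<times> {e..<f}. D t n i j)"
proof -
  let ?d = "\<lambda>i j. X t n (i + 1) j - X t n i j"
  have "(\<Sum>(i, j)\<in>{a..<b} \<times> {e..<f}. D t n i j) = (\<Sum>i\<in>{a..<b}. \<Sum>j\<in>{e..<f}. ?d i (j + 1) - ?d i j)"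
    unfolding D_def by (simp add: sum.cartesian_product algebra_simps)
  also have "\<dots> = (\<Sum>i\<in>{a..<b}. ?d i f - ?d i e)"
    by (intro sum.cong refl sum_int_telescope assms)
  also have "\<dots> = (\<Sum>i\<in>{a..<b}. (X t n (i + 1) f - X t n (i + 1) e) - (X t n i f - X t n i e))"
    by (simp add: algebra_simps)
  also have "\<dots> = (X t n b f - X t n b e) - (X t n a f - X t n a e)"
    by (rule sum_int_telescope[OF assms(1)])
  finally show ?thesis by simp
qed

text \<open>Off the value \<open>t\<close> the indicator is locally constant in the value of
  \<open>v\<close>, so convergence of the samples becomes eventual equality. This is why vertices
  with \<open>v x = t\<close> are excluded throughout.\<close>

lemma X_eventually:
  assumes "x \<in> G" "v x \<noteq> t"
  shows "eventually (\<lambda>n. X t n (I n (fst x)) (J n (snd x)) = lev v t x) sequentially"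
proof (cases "t < v x")
  case True
  from order_tendstoD(1)[OF G_lim[OF assms(1)] True] show ?thesis
    by eventually_elim (use True in \<open>simp add: X_def lev_def\<close>)
next
  case False
  then have "v x < t" using assms(2) by simp
  from order_tendstoD(2)[OF G_lim[OF assms(1)] this] show ?thesis
    by eventually_elim (use False in \<open>simp add: X_def lev_def\<close>)
qed

text \<open>By strict monotonicity, membership in an index rectangle becomes inequalities between
  real coordinates, the form that passes to the limit.\<close>

lemma mixed_lev_eq:
  assumes "finite S'" "B t n = S'"
    and rect: "{I n a..I n b} \<times> {J n e..J n f} \<subseteq> S n" "a < b" "e < f"
  shows "X t n (I n b) (J n f) - X t n (I n a) (J n f) - X t n (I n b) (J n e) + X t n (I n a) (J n e) =
    (\<Sum>(i, j)\<in>S'. D t n i j * of_bool (\<alpha> n (I n a) \<le> \<alpha> n i \<and> \<alpha> n i < \<alpha> n (I n b) \<and>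
       \<beta> n (J n e) \<le> \<beta> n j \<and> \<beta> n j < \<beta> n (J n f)))"
proof -
  let ?R = "{I n a..<I n b} \<times> {J n e..<J n f}"
  have "{i, i + 1} \<times> {j, j + 1} \<subseteq> S n" if "(i, j) \<in> ?R" for i j
  proof -
    have "{i, i + 1} \<times> {j, j + 1} \<subseteq> {I n a..I n b} \<times> {J n e..J n f}" using that by auto
    then show ?thesis using rect(1) by (rule subset_trans)
  qed
  then have zero: "D t n i j = 0" if "(i, j) \<in> ?R - S'" for i j
    using that assms(2) unfolding B_def by blast
  have "I n a \<le> I n b" "J n e \<le> J n f"
    using rect by (auto intro: I_mono J_mono)
  from sum_D[OF this, of t n]
  have "X t n (I n b) (J n f) - X t n (I n a) (J n f) - X t n (I n b) (J n e) + X t n (I n a) (J n e) =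
    (\<Sum>(i, j)\<in>?R. D t n i j)" by simp
  also have "\<dots> = (\<Sum>(i, j)\<in>?R \<inter> S'. D t n i j)"
    by (rule sum.mono_neutral_right) (auto intro!: zero)
  also have "\<dots> = (\<Sum>x\<in>S'. if x \<in> ?R then (case x of (i, j) \<Rightarrow> D t n i j) else 0)"
    using assms(1) by (simp add: sum.If_cases Int_commute)
  also have "\<dots> = (\<Sum>(i, j)\<in>S'. D t n i j * of_bool (\<alpha> n (I n a) \<le> \<alpha> n i \<and> \<alpha> n i < \<alpha> n (I n b) \<and>
       \<beta> n (J n e) \<le> \<beta> n j \<and> \<beta> n j < \<beta> n (J n f)))"
    by (rule sum.cong)
      (auto simp: strict_mono_less[OF \<alpha>_mono] strict_mono_less_eq[OF \<alpha>_mono]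
        strict_mono_less[OF \<beta>_mono] strict_mono_less_eq[OF \<beta>_mono])
  finally show ?thesis .
qed

text \<open>Infinitely often at most \<open>N\<close> blocks are nonzero, so the positions and
  weights of all of them converge along a further subsequence. The mixed difference at good vertices
  is eventually constant, and the block sum converges once the sides avoid the limit
  positions.\<close>

lemma limit_atoms:
  assumes freq: "frequently (\<lambda>n. card (K t n) \<le> N) sequentially"
  obtains p :: "nat \<Rightarrow> pt" and c where "\<And>k. \<bar>c k\<bar> \<le> 2"
    "\<And>a b e f. a < b \<Longrightarrow> e < f \<Longrightarrow> {a, b} \<times> {e, f} \<subseteq> {x\<in>G. v x \<noteq> t} \<Longrightarrow>
       {a, b, e, f} \<inter> (fst ` p ` {..<N} \<union> snd ` p ` {..<N}) = {} \<Longrightarrow>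
       mixed (lev v t) a b e f =
       (\<Sum>k<N. c k * of_bool (a < fst (p k) \<and> fst (p k) < b \<and> e < snd (p k) \<and> snd (p k) < f))"
proof -
  have "infinite {n. card (K t n) \<le> N}"
    using freq by (simp add: cofinite_eq_sequentially[symmetric] frequently_cofinite)
  from infinite_enumerate[OF this] obtain r0 :: "nat \<Rightarrow> nat" where
    r0: "strict_mono r0" "\<And>n. card (K t (r0 n)) \<le> N" by auto
  have card_B: "card (B t (r0 n)) \<le> N" for n
    using card_B_le[of t "r0 n"] r0(2)[of n] by linarith
  have "\<exists>q. bij_betw q {0..<card (B t (r0 n))} (B t (r0 n))" for n
    using card_B_le[of t "r0 n"] by (blast intro: ex_bij_betw_nat_finite)
  then obtain q where q: "\<And>n. bij_betw (q n) {0..<card (B t (r0 n))} (B t (r0 n))" by metis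
  \<comment> \<open>Empty slots are filled with weight 0, so that exactly \<open>N\<close> sequences
    have to converge.\<close>
  define g :: "nat \<Rightarrow> nat \<Rightarrow> pt \<times> real" where
    "g n k = (if k < card (B t (r0 n)) then
       (case q n k of (i, j) \<Rightarrow> ((\<alpha> (r0 n) i, \<beta> (r0 n) j), D t (r0 n) i j)) else (0, 0))" for n k
  have g_bd: "norm (g n k) \<le> 2 * \<bar>M\<bar> + 2 \<and> \<bar>snd (g n k)\<bar> \<le> 2" for n k
  proof (cases "k < card (B t (r0 n))")
    case True
    obtain i j where ij: "q n k = (i, j)" by fastforce
    have "(i, j) \<in> B t (r0 n)"
      using q[of n] True ij by (metis atLeastLessThan_iff bij_betwE zero_le)
    then have "(i, j) \<in> S (r0 n)" unfolding B_def by auto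
    from S_bounded[OF this] have *: "\<bar>\<alpha> (r0 n) i\<bar> \<le> M" "\<bar>\<beta> (r0 n) j\<bar> \<le> M" by auto
    have "norm (g n k) \<le> (\<bar>\<alpha> (r0 n) i\<bar> + \<bar>\<beta> (r0 n) j\<bar>) + \<bar>D t (r0 n) i j\<bar>"
      using True ij unfolding g_def
      by (auto intro!: order_trans[OF norm_Pair_le] add_mono simp flip: real_norm_def)
    then show ?thesis
      using * abs_D_le[of t "r0 n" i j] True ij by (auto simp: g_def)
  next
    case False
    then show ?thesis by (simp add: g_def zero_prod_def[symmetric])
  qed
  have "bounded (range (\<lambda>n. g n k))" for k
    unfolding bounded_iff using g_bd by blast
  from convergent_subseq_finite_family[of N g, OF this] obtain r :: "nat \<Rightarrow> nat" and l where
    r: "strict_mono r" "\<And>k. k < N \<Longrightarrow> (\<lambda>n. g (r n) k) \<longlonglongrightarrow> l k" by auto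
  define p where "p k = fst (l k)" for k
  define c where "c k = (if k < N then snd (l k) else 0)" for k
  define R where "R n = r0 (r n)" for n
  have R: "strict_mono R" using r0(1) r(1) unfolding R_def strict_mono_def by simp
  have p_lim: "(\<lambda>n. fst (g (r n) k)) \<longlonglongrightarrow> p k" if "k < N" for k
    unfolding p_def by (intro tendsto_fst r(2) that)
  have c_lim: "(\<lambda>n. snd (g (r n) k)) \<longlonglongrightarrow> c k" if "k < N" for k
    using tendsto_snd[OF r(2)[OF that]] that by (simp add: c_def)
  have c_le: "\<bar>c k\<bar> \<le> 2" for k
  proof (cases "k < N")
    case True
    show ?thesis
      by (rule LIMSEQ_le_const2[OF tendsto_rabs[OF c_lim[OF True]]]) (use g_bd in auto)
  qed (simp add: c_def)
  have "mixed (lev v t) a b e f =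
      (\<Sum>k<N. c k * of_bool (a < fst (p k) \<and> fst (p k) < b \<and> e < snd (p k) \<and> snd (p k) < f))"
    if ab: "a < b" "e < f" and Q: "{a, b} \<times> {e, f} \<subseteq> {x\<in>G. v x \<noteq> t}"
      and F: "{a, b, e, f} \<inter> (fst ` p ` {..<N} \<union> snd ` p ` {..<N}) = {}"
    for a b e f
  proof -
    define in_rect where "in_rect n k \<longleftrightarrow>
      \<alpha> (R n) (I (R n) a) \<le> fst (fst (g (r n) k)) \<and> fst (fst (g (r n) k)) < \<alpha> (R n) (I (R n) b) \<and>
      \<beta> (R n) (J (R n) e) \<le> snd (fst (g (r n) k)) \<and> snd (fst (g (r n) k)) < \<beta> (R n) (J (R n) f)" for n k
    have ev_R: "eventually (\<lambda>n. P (R n)) sequentially" if "eventually P sequentially" for P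
      using eventually_subseq[OF R that] .
    have Q': "(a, e) \<in> G" "(a, f) \<in> G" "(b, e) \<in> G" "(b, f) \<in> G"
      "v (a, e) \<noteq> t" "v (a, f) \<noteq> t" "v (b, e) \<noteq> t" "v (b, f) \<noteq> t"
      using Q by auto
    have "(a, e) \<in> \<Omega>" "(b, f) \<in> \<Omega>" using Q' G_subset by auto
    note ev = ev_R[OF S_exhausts[OF this]] ev_R[OF X_eventually[OF Q'(1,5)]] ev_R[OF X_eventually[OF Q'(2,6)]]
      ev_R[OF X_eventually[OF Q'(3,7)]] ev_R[OF X_eventually[OF Q'(4,8)]]
    have "eventually (\<lambda>n. mixed (lev v t) a b e f = (\<Sum>k<N. snd (g (r n) k) * of_bool (in_rect n k))) sequentially"
      using ev
    proof eventually_elim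
      case (elim n)
      have "mixed (lev v t) a b e f = X t (R n) (I (R n) b) (J (R n) f) - X t (R n) (I (R n) a) (J (R n) f)
        - X t (R n) (I (R n) b) (J (R n) e) + X t (R n) (I (R n) a) (J (R n) e)"
        using elim(2-5) unfolding mixed_def by simp
      also have "\<dots> = (\<Sum>(i, j)\<in>B t (R n). D t (R n) i j *
          of_bool (\<alpha> (R n) (I (R n) a) \<le> \<alpha> (R n) i \<and> \<alpha> (R n) i < \<alpha> (R n) (I (R n) b) \<and>
       \<beta> (R n) (J (R n) e) \<le> \<beta> (R n) j \<and> \<beta> (R n) j < \<beta> (R n) (J (R n) f)))"
        by (rule mixed_lev_eq) (use card_B_le elim ab in auto)
      also have "\<dots> = (\<Sum>k\<in>{0..<card (B t (R n))}. case q (r n) k of (i, j) \<Rightarrow> D t (R n) i j *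
          of_bool (\<alpha> (R n) (I (R n) a) \<le> \<alpha> (R n) i \<and> \<alpha> (R n) i < \<alpha> (R n) (I (R n) b) \<and>
       \<beta> (R n) (J (R n) e) \<le> \<beta> (R n) j \<and> \<beta> (R n) j < \<beta> (R n) (J (R n) f)))"
        by (rule sum.reindex_bij_betw[symmetric]) (simp add: R_def q)
      also have "\<dots> = (\<Sum>k\<in>{0..<card (B t (R n))}. snd (g (r n) k) * of_bool (in_rect n k))"
        by (rule sum.cong) (auto simp: g_def in_rect_def R_def split: prod.split)
      also have "\<dots> = (\<Sum>k<N. snd (g (r n) k) * of_bool (in_rect n k))"
        by (rule sum.mono_neutral_left) (use card_B[of "r n"] in \<open>auto simp: g_def R_def\<close>)
      finally show ?case .
    qed
    then have "(\<lambda>n. \<Sum>k<N. snd (g (r n) k) * of_bool (in_rect n k)) \<longlonglongrightarrow> mixed (lev v t) a b e f"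
      by (intro tendsto_eventually) (simp only: eq_commute)
    moreover have "(\<lambda>n. \<Sum>k<N. snd (g (r n) k) * of_bool (in_rect n k)) \<longlonglongrightarrow>
      (\<Sum>k<N. c k * of_bool (a < fst (p k) \<and> fst (p k) < b \<and> e < snd (p k) \<and> snd (p k) < f))"
    proof (intro tendsto_sum tendsto_mult c_lim tendsto_eventually)
      fix k assume k: "k \<in> {..<N}"
      have ne: "a \<noteq> fst (p k)" "fst (p k) \<noteq> b" "e \<noteq> snd (p k)" "snd (p k) \<noteq> f"
        using F k by auto
      have k': "k < N" using k by simp
      have \<alpha>_R: "(\<lambda>n. \<alpha> (R n) (I (R n) s)) \<longlonglongrightarrow> s" and \<beta>_R: "(\<lambda>n. \<beta> (R n) (J (R n) s)) \<longlonglongrightarrow> s" for s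
        using LIMSEQ_subseq_LIMSEQ[OF \<alpha>_lim R] LIMSEQ_subseq_LIMSEQ[OF \<beta>_lim R] by (simp_all add: o_def)
      show "eventually (\<lambda>n. of_bool (in_rect n k) =
        (of_bool (a < fst (p k) \<and> fst (p k) < b \<and> e < snd (p k) \<and> snd (p k) < f) :: real)) sequentially"
        using eventually_less_iff_limit[OF \<alpha>_R tendsto_fst[OF p_lim[OF k']] ne(1)]
          eventually_less_iff_limit[OF tendsto_fst[OF p_lim[OF k']] \<alpha>_R ne(2)]
          eventually_less_iff_limit[OF \<beta>_R tendsto_snd[OF p_lim[OF k']] ne(3)]
          eventually_less_iff_limit[OF tendsto_snd[OF p_lim[OF k']] \<beta>_R ne(4)]
        by eventually_elim (simp only: in_rect_def)
    qed simp
    ultimately show ?thesis by (rule LIMSEQ_unique)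
  qed
  from that[of c p, OF c_le this] show thesis .
qed

text \<open>Limit points may coincide, cancel or fall outside the box. Coinciding ones are merged,
  and those of total weight 0 or outside \<Omega> are dropped; rectangles with vertices in
  \<open>G\<close> lie in \<Omega> and do not see the loss. \<open>F\<close> keeps the coordinates
  of all limit points, dropped ones included.\<close>

lemma corner_data_exists:
  assumes freq: "frequently (\<lambda>n. card (K t n) \<le> N) sequentially"
  shows "\<exists>P c F. corner_data {x\<in>G. v x \<noteq> t} (lev v t) P c F \<and> P \<subseteq> \<Omega> \<and> (\<Sum>p\<in>P. \<bar>c p\<bar>) \<le> 2 * real N"
proof -
  obtain p :: "nat \<Rightarrow> pt" and c where c: "\<And>k. \<bar>c k\<bar> \<le> 2"
    and eq: "\<And>a b e f. a < b \<Longrightarrow> e < f \<Longrightarrow> {a, b} \<times> {e, f} \<subseteq> {x\<in>G. v x \<noteq> t} \<Longrightarrow>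
       {a, b, e, f} \<inter> (fst ` p ` {..<N} \<union> snd ` p ` {..<N}) = {} \<Longrightarrow>
       mixed (lev v t) a b e f =
       (\<Sum>k<N. c k * of_bool (a < fst (p k) \<and> fst (p k) < b \<and> e < snd (p k) \<and> snd (p k) < f))"
    by (rule limit_atoms[OF freq]) (rule that, assumption+)
  define F where "F = fst ` p ` {..<N} \<union> snd ` p ` {..<N}"
  define c' where "c' x = (\<Sum>k\<in>{k\<in>{..<N}. p k = x}. c k)" for x
  define P where "P = {x \<in> p ` {..<N}. x \<in> \<Omega> \<and> c' x \<noteq> 0}"
  have fin: "finite P" unfolding P_def by simp
  have "mixed (lev v t) a b e f = (\<Sum>x\<in>{x\<in>P. a < fst x \<and> fst x < b \<and> e < snd x \<and> snd x < f}. c' x)"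
    if *: "a < b" "e < f" "{a, b, e, f} \<inter> F = {}" "{a, b} \<times> {e, f} \<subseteq> {x\<in>G. v x \<noteq> t}" for a b e f
  proof -
    let ?in = "\<lambda>x. a < fst x \<and> fst x < b \<and> e < snd x \<and> snd x < f"
    have "(a, e) \<in> \<Omega>" "(b, f) \<in> \<Omega>" using * G_subset by auto
    from \<Omega>_box[OF this] have sub: "x \<in> \<Omega>" if "?in x" for x
      using that by (cases x) auto
    have "mixed (lev v t) a b e f = (\<Sum>k<N. c k * of_bool (?in (p k)))"
      by (rule eq) (use * in \<open>auto simp: F_def\<close>)
    also have "\<dots> = (\<Sum>k\<in>{k\<in>{..<N}. ?in (p k)}. c k)"
      by (rule sum.mono_neutral_cong_right) auto
    also have "\<dots> = (\<Sum>x\<in>{x\<in>p ` {..<N}. ?in x}. \<Sum>k\<in>{k\<in>{k\<in>{..<N}. ?in (p k)}. p k = x}. c k)"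
      by (rule sum.group[symmetric]) auto
    also have "\<dots> = (\<Sum>x\<in>{x\<in>p ` {..<N}. ?in x}. c' x)"
      unfolding c'_def by (intro sum.cong refl) auto
    also have "\<dots> = (\<Sum>x\<in>{x\<in>P. ?in x}. c' x)"
      by (rule sum.mono_neutral_right) (use sub in \<open>auto simp: P_def\<close>)
    finally show ?thesis .
  qed
  moreover have "(\<Sum>x\<in>P. \<bar>c' x\<bar>) \<le> 2 * real N"
  proof -
    have "(\<Sum>x\<in>P. \<bar>c' x\<bar>) \<le> (\<Sum>x\<in>p ` {..<N}. \<bar>c' x\<bar>)"
      by (rule sum_mono2) (auto simp: P_def)
    also have "\<dots> \<le> (\<Sum>x\<in>p ` {..<N}. \<Sum>k\<in>{k\<in>{..<N}. p k = x}. \<bar>c k\<bar>)"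
      unfolding c'_def by (intro sum_mono sum_abs)
    also have "\<dots> = (\<Sum>k\<in>{..<N}. \<bar>c k\<bar>)"
      by (rule sum.group) auto
    also have "\<dots> \<le> (\<Sum>k\<in>{..<N}. 2)"
      by (intro sum_mono c)
    finally show ?thesis by simp
  qed
  ultimately have "corner_data {x\<in>G. v x \<noteq> t} (lev v t) P c' F \<and> P \<subseteq> \<Omega> \<and> (\<Sum>p\<in>P. \<bar>c' p\<bar>) \<le> 2 * real N"
    unfolding corner_data_def using fin by (auto simp: P_def F_def)
  then show ?thesis by blast
qed

end

section \<open>Counting corners over all levels\<close>

lemma emeasure_two_crossings:
  fixes a b c :: real
  shows "(\<integral>\<^sup>+t. of_bool ((t < b) \<noteq> (t < a) \<and> (t < c) \<noteq> (t < a)) \<partial>lborel) \<le> ennreal (min \<bar>b - a\<bar> \<bar>c - a\<bar>)"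
proof -
  have cross: "(\<integral>\<^sup>+t. of_bool ((t < b) \<noteq> (t < a) \<and> (t < c) \<noteq> (t < a)) \<partial>lborel) \<le> ennreal \<bar>d - a\<bar>"
    if "d = b \<or> d = c" for d
  proof -
    have "(\<integral>\<^sup>+t. of_bool ((t < b) \<noteq> (t < a) \<and> (t < c) \<noteq> (t < a)) \<partial>lborel) \<le>
      (\<integral>\<^sup>+t. indicator {min a d..max a d} t \<partial>lborel)"
      by (rule nn_integral_mono) (use that in \<open>auto simp: indicator_def\<close>)
    also have "\<dots> = ennreal (max a d - min a d)"
      by (subst nn_integral_indicator) auto
    also have "max a d - min a d = \<bar>d - a\<bar>" by auto
    finally show ?thesis .
  qed
  show ?thesis
    using cross[of b] cross[of c] by (simp add: min_def)
qed

context lattice_limit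
begin

lemma real_card_K:
  "real (card (K t n)) = (\<Sum>z\<in>(S n \<times> {-1,1}) \<times> {-1,1}. case z of (((i, j), \<sigma>), \<tau>) \<Rightarrow>
     of_bool ((t < v (\<alpha> n (i + \<sigma>), \<beta> n j)) \<noteq> (t < v (\<alpha> n i, \<beta> n j)) \<and>
       (t < v (\<alpha> n i, \<beta> n (j + \<tau>))) \<noteq> (t < v (\<alpha> n i, \<beta> n j))))"
proof -
  let ?V = "\<lambda>i j. v (\<alpha> n i, \<beta> n j)"
  let ?T = "\<lambda>t i j \<sigma> \<tau>. (t < ?V (i + \<sigma>) j) \<noteq> (t < ?V i j) \<and> (t < ?V i (j + \<tau>)) \<noteq> (t < ?V i j)"
  let ?Z = "(S n \<times> {-1,1}) \<times> {-1,1::int}"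
    have "K t n = (\<lambda>(((i, j), \<sigma>), \<tau>). (i, j, \<sigma>, \<tau>)) ` {z \<in> ?Z. case z of (((i, j), \<sigma>), \<tau>) \<Rightarrow> ?T t i j \<sigma> \<tau>}"
      unfolding K_def X_def lev_def by (auto simp: image_iff)
    moreover have "inj_on (\<lambda>(((i, j), \<sigma>), \<tau>). (i, j, \<sigma>, \<tau>)) {z \<in> ?Z. case z of (((i, j), \<sigma>), \<tau>) \<Rightarrow> ?T t i j \<sigma> \<tau>}"
      by (auto simp: inj_on_def)
    ultimately have "card (K t n) = card {z \<in> ?Z. case z of (((i, j), \<sigma>), \<tau>) \<Rightarrow> ?T t i j \<sigma> \<tau>}"
      by (simp only: card_image)
    then have "real (card (K t n)) = (\<Sum>z\<in>{z \<in> ?Z. case z of (((i, j), \<sigma>), \<tau>) \<Rightarrow> ?T t i j \<sigma> \<tau>}. 1)"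
      by (simp only: real_of_card)
    also have "\<dots> = (\<Sum>z\<in>?Z. of_bool (case z of (((i, j), \<sigma>), \<tau>) \<Rightarrow> ?T t i j \<sigma> \<tau>))"
      by (rule sum.mono_neutral_cong_left) (use finite_S[of n] in auto)
    finally show ?thesis by (simp add: case_prod_beta')
qed

text \<open>A potential oriented corner is present exactly at the levels that both of its edges
  cross; the measure of these levels is bounded by the smaller increment, and the sum over all
  potential corners is the sampled energy.\<close>

lemma nn_integral_card_K:
  "(\<integral>\<^sup>+t. ennreal (real (card (K t n))) \<partial>lborel) \<le>
     ennreal (\<Sum>(i, j)\<in>S n. \<Sum>\<sigma>\<in>{-1,1}. \<Sum>\<tau>\<in>{-1,1}.
       min \<bar>v (\<alpha> n (i + \<sigma>), \<beta> n j) - v (\<alpha> n i, \<beta> n j)\<bar> \<bar>v (\<alpha> n i, \<beta> n (j + \<tau>)) - v (\<alpha> n i, \<beta> n j)\<bar>)"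
proof -
  let ?V = "\<lambda>i j. v (\<alpha> n i, \<beta> n j)"
  let ?T = "\<lambda>t i j \<sigma> \<tau>. (t < ?V (i + \<sigma>) j) \<noteq> (t < ?V i j) \<and> (t < ?V i (j + \<tau>)) \<noteq> (t < ?V i j)"
  let ?Z = "(S n \<times> {-1,1}) \<times> {-1,1::int}"
  note card = real_card_K[of _ n]
  have ennreal_sum_of_bool: "ennreal (\<Sum>z\<in>Z. of_bool (Q z)) = (\<Sum>z\<in>Z. of_bool (Q z))" for Z :: "'z set" and Q
  proof -
    have "(\<Sum>z\<in>Z. of_bool (Q z)) = (\<Sum>z\<in>Z. ennreal (of_bool (Q z)))"
      by (intro sum.cong refl) simp
    also have "\<dots> = ennreal (\<Sum>z\<in>Z. of_bool (Q z))"
      by (rule sum_ennreal) simp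
    finally show ?thesis ..
  qed
  have "(\<integral>\<^sup>+t. ennreal (real (card (K t n))) \<partial>lborel) =
    (\<integral>\<^sup>+t. (\<Sum>z\<in>?Z. case z of (((i, j), \<sigma>), \<tau>) \<Rightarrow> of_bool (?T t i j \<sigma> \<tau>)) \<partial>lborel)"
    unfolding card case_prod_beta' ennreal_sum_of_bool ..
  also have "\<dots> = (\<Sum>z\<in>?Z. \<integral>\<^sup>+t. (case z of (((i, j), \<sigma>), \<tau>) \<Rightarrow> of_bool (?T t i j \<sigma> \<tau>)) \<partial>lborel)"
    by (subst nn_integral_sum[symmetric]) (auto simp: case_prod_beta')
  also have "\<dots> \<le> (\<Sum>z\<in>?Z. case z of (((i, j), \<sigma>), \<tau>) \<Rightarrow>
      ennreal (min \<bar>?V (i + \<sigma>) j - ?V i j\<bar> \<bar>?V i (j + \<tau>) - ?V i j\<bar>))"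
    unfolding case_prod_beta' by (intro sum_mono emeasure_two_crossings)
  also have "\<dots> = ennreal (\<Sum>z\<in>?Z. case z of (((i, j), \<sigma>), \<tau>) \<Rightarrow> min \<bar>?V (i + \<sigma>) j - ?V i j\<bar> \<bar>?V i (j + \<tau>) - ?V i j\<bar>)"
    by (subst sum_ennreal[symmetric]) (auto simp: case_prod_beta')
  also have "(\<Sum>z\<in>?Z. case z of (((i, j), \<sigma>), \<tau>) \<Rightarrow> min \<bar>?V (i + \<sigma>) j - ?V i j\<bar> \<bar>?V i (j + \<tau>) - ?V i j\<bar>) =
    (\<Sum>(i, j)\<in>S n. \<Sum>\<sigma>\<in>{-1,1}. \<Sum>\<tau>\<in>{-1,1}. min \<bar>?V (i + \<sigma>) j - ?V i j\<bar> \<bar>?V i (j + \<tau>) - ?V i j\<bar>)"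
    by (simp only: sum.cartesian_product' case_prod_beta' fst_conv snd_conv)
  finally show ?thesis .
qed

lemma measurable_card_K [measurable]: "(\<lambda>t. ennreal (real (card (K t n)))) \<in> borel_measurable borel"
  unfolding real_card_K case_prod_beta' by measurable

text \<open>A liminf, so that Fatou bounds its integral over the levels by the lattice energies,
  while its finiteness at one level gives infinitely many scales with few corners.\<close>

definition multiplicity :: "real \<Rightarrow> ennreal" where
  "multiplicity t = liminf (\<lambda>n. ennreal (real (card (K t n))))"

lemma corner_data_of_multiplicity:
  assumes "multiplicity t < \<infinity>"
  shows "\<exists>P c F. corner_data {x\<in>G. v x \<noteq> t} (lev v t) P c F \<and> P \<subseteq> \<Omega> \<and> ennreal (\<Sum>p\<in>P. \<bar>c p\<bar>) \<le> 4 * multiplicity t"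
proof -
  obtain l where l: "multiplicity t = ennreal l" "0 \<le> l"
    using assms by (cases "multiplicity t") auto
  \<comment> \<open>If eventually more than \<open>N\<close> corners were present, the integer
    counts would exceed \<open>l + 1/2\<close> and so would not have liminf \<open>l\<close>.
    Moreover \<open>N\<close> is at most \<open>2 * l\<close>, being 0 for \<open>l < 1/2\<close>: a
    bound proportional to \<open>l\<close>, without an additive constant, remains integrable over
    the whole line of levels.\<close>
  define N where "N = nat \<lfloor>l + 1 / 2\<rfloor>"
  have "frequently (\<lambda>n. card (K t n) \<le> N) sequentially"
  proof (rule ccontr)
    assume "\<not> ?thesis"
    then have "eventually (\<lambda>n. N < card (K t n)) sequentially"
      by (simp add: not_frequently not_le)
    then have "eventually (\<lambda>n. ennreal (l + 1 / 2) \<le> ennreal (real (card (K t n)))) sequentially"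
      by eventually_elim (auto intro!: ennreal_leI simp: N_def, linarith)
    then have "ennreal (l + 1 / 2) \<le> multiplicity t"
      unfolding multiplicity_def by (rule Liminf_bounded)
    then show False using l by (simp add: ennreal_le_iff)
  qed
  from corner_data_exists[OF this] obtain P c F where
    PcF: "corner_data {x\<in>G. v x \<noteq> t} (lev v t) P c F" "P \<subseteq> \<Omega>" "(\<Sum>p\<in>P. \<bar>c p\<bar>) \<le> 2 * real N" by blast
  have "real N \<le> 2 * l"
  proof (cases "l < 1 / 2")
    case True
    then have "\<lfloor>l + 1 / 2\<rfloor> = 0" using l(2) by (simp add: floor_eq_iff)
    then show ?thesis using l(2) by (simp add: N_def)
  next
    case False
    have "real N \<le> l + 1 / 2" using l(2) unfolding N_def by linarith
    then show ?thesis using False by simp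
  qed
  then have "ennreal (\<Sum>p\<in>P. \<bar>c p\<bar>) \<le> ennreal (4 * l)"
    using PcF(3) by (intro ennreal_leI) linarith
  also have "\<dots> = 4 * multiplicity t" using l by (simp add: ennreal_mult)
  finally show ?thesis using PcF by blast
qed

end

lemma level_structure:
  fixes v :: "pt \<Rightarrow> real"
  assumes q: "q \<in> unit_square" and \<epsilon>: "\<epsilon> \<longlonglongrightarrow> 0"
    and h: "\<And>n. 0 < h n \<and> h n \<le> \<epsilon> n" and k: "\<And>n. 0 < k n \<and> k n \<le> \<epsilon> n"
    and ae: "AE x in lborel. x \<in> {a1<..<b1} \<times> {a2<..<b2} \<longrightarrow> (\<lambda>n. v (lat (h n) (k n) q x)) \<longlonglongrightarrow> v x"
    and sum: "\<And>n S. finite S \<Longrightarrow>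
       node (h n) (k n) q ` S \<subseteq> {a1 + \<epsilon> n<..<b1 - \<epsilon> n} \<times> {a2 + \<epsilon> n<..<b2 - \<epsilon> n} \<Longrightarrow>
       (\<Sum>p\<in>S. step_energy v (h n) (k n) (node (h n) (k n) q p)) \<le> A"
  obtains G L where "G \<subseteq> {a1<..<b1} \<times> {a2<..<b2}"
    "AE x in lborel. x \<in> {a1<..<b1} \<times> {a2<..<b2} \<longrightarrow> x \<in> G"
    "L \<in> borel_measurable borel" "(\<integral>\<^sup>+t. L t \<partial>lborel) \<le> ennreal A"
    "\<And>t. L t < \<infinity> \<Longrightarrow> \<exists>P c F. corner_data {x\<in>G. v x \<noteq> t} (lev v t) P c F \<and>
       P \<subseteq> {a1<..<b1} \<times> {a2<..<b2} \<and> ennreal (\<Sum>p\<in>P. \<bar>c p\<bar>) \<le> 4 * L t"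
proof -
  let ?\<Omega> = "{a1<..<b1} \<times> {a2<..<b2}"
  define U where "U n = {a1 + \<epsilon> n<..<b1 - \<epsilon> n} \<times> {a2 + \<epsilon> n<..<b2 - \<epsilon> n}" for n
  define \<alpha> where "\<alpha> n i = h n * (fst q + of_int i)" for n i
  define \<beta> where "\<beta> n j = k n * (snd q + of_int j)" for n j
  define I where "I n s = \<lfloor>s / h n\<rfloor>" for n s
  define J where "J n s = \<lfloor>s / k n\<rfloor>" for n s
  define S where "S n = {p. node (h n) (k n) q p \<in> U n}" for n
  define G where "G = {x \<in> ?\<Omega>. (\<lambda>n. v (lat (h n) (k n) q x)) \<longlonglongrightarrow> v x}"
  define M where "M = \<bar>a1\<bar> + \<bar>b1\<bar> + \<bar>a2\<bar> + \<bar>b2\<bar>"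
  have pos: "0 < h n" "0 < k n" "0 < \<epsilon> n" for n using h[of n] k[of n] by auto
  have lat_eq: "lat (h n) (k n) q x = (\<alpha> n (I n (fst x)), \<beta> n (J n (snd x)))" for n x
    by (simp add: lat_def \<alpha>_def \<beta>_def I_def J_def)
  have node_eq: "node (h n) (k n) q (i, j) = (\<alpha> n i, \<beta> n j)" for n i j
    by (simp add: node_def \<alpha>_def \<beta>_def)
  have close: "\<bar>\<alpha> n (I n s) - s\<bar> \<le> \<epsilon> n" "\<bar>\<beta> n (J n s) - s\<bar> \<le> \<epsilon> n" for n s
    using lat_close[OF q pos(1,2), of n n "(s, s)"] h[of n] k[of n] by (auto simp: lat_eq)
  have squeeze: "f \<longlonglongrightarrow> s" if "\<And>n. \<bar>f n - s\<bar> \<le> \<epsilon> n" for f and s :: real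
    by (rule LIM_zero_cancel, rule tendsto_rabs_zero_cancel, rule tendsto_sandwich[OF _ _ tendsto_const \<epsilon>])
      (auto intro!: always_eventually that)
  have finite_S: "finite (S n)" for n
  proof -
    have "finite {i. a < c * (s + real_of_int i) \<and> c * (s + real_of_int i) < b}" if "0 < c" for a b c s
    proof (rule finite_subset)
      show "{i. a < c * (s + real_of_int i) \<and> c * (s + real_of_int i) < b} \<subseteq> {\<lfloor>a / c - s\<rfloor>..\<lceil>b / c - s\<rceil>}"
      proof
        fix i assume "i \<in> {i. a < c * (s + real_of_int i) \<and> c * (s + real_of_int i) < b}"
        then have "a / c - s < i" "i < b / c - s" using that by (auto simp: field_simps)
        then show "i \<in> {\<lfloor>a / c - s\<rfloor>..\<lceil>b / c - s\<rceil>}" by (simp add: floor_le_iff le_ceiling_iff)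
      qed
    qed simp
    then have "finite ({i. a1 + \<epsilon> n < \<alpha> n i \<and> \<alpha> n i < b1 - \<epsilon> n} \<times> {j. a2 + \<epsilon> n < \<beta> n j \<and> \<beta> n j < b2 - \<epsilon> n})"
      unfolding \<alpha>_def \<beta>_def using pos by (intro finite_SigmaI) auto
    then show ?thesis
      by (rule finite_subset[rotated]) (auto simp: S_def U_def node_eq)
  qed
  interpret lattice_limit v \<alpha> \<beta> I J S ?\<Omega> G M
  proof
    fix n :: nat
    show "strict_mono (\<alpha> n)" "strict_mono (\<beta> n)"
      using pos by (auto simp: strict_mono_def \<alpha>_def \<beta>_def)
    show "I n s \<le> I n s'" "J n s \<le> J n s'" if "s \<le> s'" for s s'
      unfolding I_def J_def by (intro floor_mono divide_right_mono that less_imp_le[OF pos(1)] less_imp_le[OF pos(2)])+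
    show "finite (S n)" by (rule finite_S)
    show "\<bar>\<alpha> n i\<bar> \<le> M \<and> \<bar>\<beta> n j\<bar> \<le> M" if "(i, j) \<in> S n" for i j
      using that pos(3)[of n] unfolding S_def U_def M_def by (auto simp: node_eq)
  next
    show "(\<lambda>n. \<alpha> n (I n s)) \<longlonglongrightarrow> s" "(\<lambda>n. \<beta> n (J n s)) \<longlonglongrightarrow> s" for s
      by (intro squeeze close)+
    show "G \<subseteq> ?\<Omega>" by (auto simp: G_def)
    show "(\<lambda>n. v (\<alpha> n (I n (fst x)), \<beta> n (J n (snd x)))) \<longlonglongrightarrow> v x" if "x \<in> G" for x
      using that by (simp add: G_def lat_eq)
  next
    fix a e b f assume *: "(a, e) \<in> ?\<Omega>" "(b, f) \<in> ?\<Omega>"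
    then show "{a..b} \<times> {e..f} \<subseteq> ?\<Omega>" by auto
    \<comment> \<open>Half the distance to the boundary: nodes are displaced by up to
      \<open>\<epsilon> n\<close> and must still lie in a box shrunk by
      \<open>\<epsilon> n\<close>.\<close>
    define d where "d = min (min (a - a1) (b1 - b)) (min (e - a2) (b2 - f)) / 2"
    have "0 < d" using * unfolding d_def by auto
    from order_tendstoD(2)[OF \<epsilon> this]
    show "eventually (\<lambda>n. {I n a..I n b} \<times> {J n e..J n f} \<subseteq> S n) sequentially"
    proof eventually_elim
      case (elim n)
      show ?case
      proof
        fix p assume p: "p \<in> {I n a..I n b} \<times> {J n e..J n f}"
        obtain i j where ij: "p = (i, j)" by fastforce
        have "\<alpha> n (I n a) \<le> \<alpha> n i" "\<alpha> n i \<le> \<alpha> n (I n b)" "\<beta> n (J n e) \<le> \<beta> n j" "\<beta> n j \<le> \<beta> n (J n f)"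
          using p pos unfolding ij \<alpha>_def \<beta>_def by auto
        then show "p \<in> S n"
          using close(1)[of n a] close(1)[of n b] close(2)[of n e] close(2)[of n f] elim
          unfolding S_def ij mem_Collect_eq node_eq U_def d_def by auto
      qed
    qed
  qed
  have step: "(\<Sum>\<sigma>\<in>{-1,1}. \<Sum>\<tau>\<in>{-1,1}.
       min \<bar>v (\<alpha> n (i + \<sigma>), \<beta> n j) - v (\<alpha> n i, \<beta> n j)\<bar> \<bar>v (\<alpha> n i, \<beta> n (j + \<tau>)) - v (\<alpha> n i, \<beta> n j)\<bar>) =
     step_energy v (h n) (k n) (node (h n) (k n) q (i, j))" for n i j
  proof -
    have "\<alpha> n (i + 1) = \<alpha> n i + h n" "\<alpha> n (i - 1) = \<alpha> n i - h n" "\<beta> n (j + 1) = \<beta> n j + k n" "\<beta> n (j - 1) = \<beta> n j - k n"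
      by (simp_all add: \<alpha>_def \<beta>_def algebra_simps)
    then show ?thesis by (simp add: step_energy_def node_eq)
  qed
  show thesis
  proof (rule that[of G multiplicity])
    show "G \<subseteq> ?\<Omega>" by (rule G_subset)
    show "AE x in lborel. x \<in> ?\<Omega> \<longrightarrow> x \<in> G"
      using ae by eventually_elim (simp add: G_def)
    show "multiplicity \<in> borel_measurable borel"
      unfolding multiplicity_def[abs_def] by measurable
    have "(\<integral>\<^sup>+t. multiplicity t \<partial>lborel) \<le> liminf (\<lambda>n. \<integral>\<^sup>+t. ennreal (real (card (K t n))) \<partial>lborel)"
      unfolding multiplicity_def by (rule nn_integral_liminf) measurable
    also have "\<dots> \<le> ennreal A"
    proof (rule Liminf_le)
      show "eventually (\<lambda>n. (\<integral>\<^sup>+t. ennreal (real (card (K t n))) \<partial>lborel) \<le> ennreal A) sequentially"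
      proof (rule always_eventually, rule allI)
        fix n
        have "(\<Sum>(i, j)\<in>S n. step_energy v (h n) (k n) (node (h n) (k n) q (i, j))) \<le> A"
          using sum[OF finite_S, of n n] unfolding S_def U_def by (auto simp: case_prod_beta')
        then have "ennreal (\<Sum>(i, j)\<in>S n. step_energy v (h n) (k n) (node (h n) (k n) q (i, j))) \<le> ennreal A"
          by (rule ennreal_leI)
        then show "(\<integral>\<^sup>+t. ennreal (real (card (K t n))) \<partial>lborel) \<le> ennreal A"
          using nn_integral_card_K[of n] unfolding step by (rule order_trans[rotated])
      qed
    qed simp
    finally show "(\<integral>\<^sup>+t. multiplicity t \<partial>lborel) \<le> ennreal A" .
    show "\<exists>P c F. corner_data {x\<in>G. v x \<noteq> t} (lev v t) P c F \<and> P \<subseteq> ?\<Omega> \<and> ennreal (\<Sum>p\<in>P. \<bar>c p\<bar>) \<le> 4 * multiplicity t"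
      if "multiplicity t < \<infinity>" for t
      by (rule corner_data_of_multiplicity[OF that])
  qed
qed

section \<open>The set carrying the corners\<close>

lemma AE_lborel_dense:
  assumes "AE x::real in lborel. P x" "r < s"
  shows "\<exists>x. r < x \<and> x < s \<and> P x"
proof (rule ccontr)
  assume not: "\<not> ?thesis"
  from assms(1) have "AE x in lborel. x \<notin> {r<..<s}"
    by eventually_elim (use not in auto)
  then have "emeasure lborel {x \<in> space lborel. x \<in> {r<..<s}} = 0" by (rule emeasure_eq_0_AE)
  moreover have "{x \<in> space lborel. x \<in> {r<..<s}} = {r<..<s}" by auto
  ultimately show False using assms(2) by (simp only: emeasure_lborel_Ioo less_imp_le) simp
qed

lemma countable_dense_AE:
  assumes "AE x::real in lborel. P x"
  obtains X where "countable X" "\<And>x. x \<in> X \<Longrightarrow> P x" "\<And>c d. c < d \<Longrightarrow> \<exists>x\<in>X. c < x \<and> x < d"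
proof -
  have "\<exists>x. r < s \<longrightarrow> r < x \<and> x < s \<and> P x" for r s
    using AE_lborel_dense[OF assms, of r s] by blast
  then have "\<exists>f. \<forall>p. fst p < snd p \<longrightarrow> fst p < f p \<and> f p < snd p \<and> P (f p)"
    by (intro choice allI)
  then obtain f where f: "\<forall>p. fst p < snd p \<longrightarrow> fst p < f p \<and> f p < snd p \<and> P (f p)" ..
  define X where "X = f ` {p \<in> \<rat> \<times> \<rat>. fst p < snd p}"
  have "countable ({p \<in> \<rat> \<times> \<rat>. fst p < snd p} :: (real \<times> real) set)"
    by (rule countable_subset[of _ "\<rat> \<times> \<rat>"]) (auto intro: countable_rat)
  then have "countable X" unfolding X_def by (rule countable_image)
  moreover have "P x" if "x \<in> X" for x using that f unfolding X_def by auto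
  moreover have "\<exists>x\<in>X. c < x \<and> x < d" if cd: "c < d" for c d
  proof -
    obtain s where s: "s \<in> \<rat>" "c < s" "s < d" using Rats_dense_in_real[OF cd] by blast
    obtain r where r: "r \<in> \<rat>" "c < r" "r < s" using Rats_dense_in_real[OF s(2)] by blast
    have "r < f (r, s) \<and> f (r, s) < s" using f r(3) by auto
    moreover have "f (r, s) \<in> X" unfolding X_def using r s by (intro imageI) simp
    ultimately show ?thesis using r s by (intro bexI[of _ "f (r, s)"]) auto
  qed
  ultimately show thesis by (rule that)
qed

text \<open>Fubini makes almost every vertical line good. Once countably many of them are fixed,
  almost every ordinate is good on all of them at once, so the entire product consists of good
  points.\<close>

lemma dense_grid:
  assumes ae: "AE x in lborel. x \<in> {a1<..<b1} \<times> {a2<..<b2} \<longrightarrow> x \<in> G"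
  obtains X1 X2 where "countable X1" "countable X2" "X1 \<subseteq> {a1<..<b1}" "X2 \<subseteq> {a2<..<b2::real}"
    "dense_in X1 a1 b1" "dense_in X2 a2 b2" "X1 \<times> X2 \<subseteq> (G :: pt set)"
proof -
  have "AE x1 in lborel. AE x2 in lborel. (x1, x2) \<in> {a1<..<b1} \<times> {a2<..<b2} \<longrightarrow> (x1, x2) \<in> G"
    using ae unfolding lborel_prod[symmetric] by (rule lborel_pair.AE_pair)
  from countable_dense_AE[OF this] obtain Y1 where Y1: "countable Y1"
    "\<And>x1. x1 \<in> Y1 \<Longrightarrow> AE x2 in lborel. (x1, x2) \<in> {a1<..<b1} \<times> {a2<..<b2} \<longrightarrow> (x1, x2) \<in> G"
    "\<And>c d. c < d \<Longrightarrow> \<exists>x\<in>Y1. c < x \<and> x < d" by blast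
  have "AE x2 in lborel. \<forall>x1\<in>Y1. (x1, x2) \<in> {a1<..<b1} \<times> {a2<..<b2} \<longrightarrow> (x1, x2) \<in> G"
    unfolding AE_ball_countable[OF Y1(1)] using Y1(2) by blast
  from countable_dense_AE[OF this] obtain Y2 where Y2: "countable Y2"
    "\<And>x2. x2 \<in> Y2 \<Longrightarrow> \<forall>x1\<in>Y1. (x1, x2) \<in> {a1<..<b1} \<times> {a2<..<b2} \<longrightarrow> (x1, x2) \<in> G"
    "\<And>c d. c < d \<Longrightarrow> \<exists>x\<in>Y2. c < x \<and> x < d" by blast
  have dense: "dense_in (Y \<inter> {a<..<b}) a b" if Y: "\<And>c d. c < d \<Longrightarrow> \<exists>x\<in>Y. c < x \<and> x < d" for Y a b
    unfolding dense_in_def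
  proof (intro allI impI)
    fix c d assume *: "a \<le> c" "c < d" "d \<le> b"
    obtain x where "x \<in> Y" "c < x" "x < d" using Y[OF *(2)] by blast
    then show "\<exists>x\<in>Y \<inter> {a<..<b}. c < x \<and> x < d" using * by (intro bexI[of _ x]) auto
  qed
  show thesis
    by (rule that[of "Y1 \<inter> {a1<..<b1}" "Y2 \<inter> {a2<..<b2}"])
      (use Y1(1) Y2(1,2) in \<open>auto intro: dense Y1(3) Y2(3)\<close>)
qed

text \<open>The grid is the same for all levels and only the finite set \<open>F t\<close> of
  forbidden lines varies, which keeps the nesting of levels usable. The atoms are arbitrary
  functions of \<open>t\<close>; no measurability is assumed of them.\<close>

locale corner_family =
  fixes a1 b1 a2 b2 :: real and X1 X2 :: "real set" and v :: "pt \<Rightarrow> real" and T :: "real set"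
    and P :: "real \<Rightarrow> pt set" and c :: "real \<Rightarrow> pt \<Rightarrow> real" and F :: "real \<Rightarrow> real set"
  assumes X1: "X1 \<subseteq> {a1<..<b1}" "dense_in X1 a1 b1" and X2: "X2 \<subseteq> {a2<..<b2}" "dense_in X2 a2 b2"
    and T [measurable]: "T \<in> sets borel"
    and data: "t \<in> T \<Longrightarrow> corner_data (X1 \<times> X2) (lev v t) (P t) (c t) (F t)"
    and P_subset: "t \<in> T \<Longrightarrow> P t \<subseteq> {a1<..<b1} \<times> {a2<..<b2}"
begin

lemma finite_P: "t \<in> T \<Longrightarrow> finite (P t)" and finite_F: "t \<in> T \<Longrightarrow> finite (F t)"
  and P_nz: "t \<in> T \<Longrightarrow> p \<in> P t \<Longrightarrow> c t p \<noteq> 0"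
  and P_F: "t \<in> T \<Longrightarrow> p \<in> P t \<Longrightarrow> fst p \<in> F t \<and> snd p \<in> F t"
  using data[of t] unfolding corner_data_def by auto

lemma mixed_eq:
  assumes "t \<in> T" "a \<in> X1 - F t" "b \<in> X1 - F t" "e \<in> X2 - F t" "f \<in> X2 - F t" "a < b" "e < f"
  shows "mixed (lev v t) a b e f = (\<Sum>p\<in>{p\<in>P t. a < fst p \<and> fst p < b \<and> e < snd p \<and> snd p < f}. c t p)"
  using data[OF assms(1)] assms unfolding corner_data_def by auto

definition isolated :: "real \<Rightarrow> real \<Rightarrow> real \<Rightarrow> real \<Rightarrow> pt set" where
  "isolated a b e f = {p. \<exists>t\<in>T. P t \<inter> {a<..<b} \<times> {e<..<f} = {p}}"

text \<open>Inside the box the levels concerned have one corner each, and their patterns on the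
  common grid decrease in \<open>t\<close>; this is the situation of
  \<open>chain_cover_one_corner\<close>.\<close>

lemma chain_cover_isolated:
  assumes box: "a1 \<le> a" "b \<le> b1" "a2 \<le> e" "f \<le> b2"
  shows "chain_cover (isolated a b e f)"
proof -
  let ?R = "{a<..<b} \<times> {e<..<f}"
  define T' where "T' = {t\<in>T. \<exists>p. P t \<inter> ?R = {p}}"
  define p where "p t = the_elem (P t \<inter> ?R)" for t
  have p: "P t \<inter> ?R = {p t}" "t \<in> T" if "t \<in> T'" for t
  proof -
    from that obtain x where "t \<in> T" "P t \<inter> ?R = {x}" unfolding T'_def by blast
    then show "P t \<inter> ?R = {p t}" "t \<in> T" by (simp_all add: p_def)
  qed
  have p_box: "a < fst (p t) \<and> fst (p t) < b \<and> e < snd (p t) \<and> snd (p t) < f" if "t \<in> T'" for t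
  proof -
    have "p t \<in> P t \<inter> ?R" unfolding p(1)[OF that] by simp
    then show ?thesis by (auto simp: mem_Times_iff)
  qed
  have dense: "dense_in (X \<inter> {l<..<r}) l r" if d: "dense_in X l' r'" "l' \<le> l" "r \<le> r'" for X l r l' r'
    unfolding dense_in_def
  proof (intro allI impI)
    fix s u assume *: "l \<le> s" "s < u" "u \<le> r"
    then obtain x where "x \<in> X" "s < x" "x < u" using dense_inD[OF d(1), of s u] d by auto
    then show "\<exists>x\<in>X \<inter> {l<..<r}. s < x \<and> x < u" using * by (intro bexI[of _ x]) auto
  qed
  have "chain_cover (p ` T')"
  proof (rule chain_cover_one_corner[where ?X1.0 = "X1 \<inter> {a<..<b}" and ?X2.0 = "X2 \<inter> {e<..<f}"
        and F = F and G = F and \<kappa> = "\<lambda>t x y. t < v (x, y)" and c = "\<lambda>t. c t (p t)"])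
    show "dense_in (X1 \<inter> {a<..<b}) a b" "dense_in (X2 \<inter> {e<..<f}) e f"
      by (rule dense[OF X1(2) box(1,2)], rule dense[OF X2(2) box(3,4)])
    show "finite (F t)" "finite (F t)" if "t \<in> T'" for t
      using finite_F p(2)[OF that] by auto
    show "a < fst (p t) \<and> fst (p t) < b \<and> e < snd (p t) \<and> snd (p t) < f" if "t \<in> T'" for t
      by (rule p_box[OF that])
    show "t < v (x, y)" if "t < u" "u < v (x, y)" for t u x y using that by simp
    fix t assume t: "t \<in> T'"
    have pP: "p t \<in> P t" using p(1)[OF t] by blast
    show "one_corner (X1 \<inter> {a<..<b} - F t) (X2 \<inter> {e<..<f} - F t) (\<lambda>x y. t < v (x, y)) (fst (p t)) (snd (p t)) (c t (p t))"
      unfolding one_corner_def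
    proof (intro conjI ballI impI)
      show "c t (p t) \<noteq> 0" using P_nz p(2)[OF t] pP by blast
      show "fst (p t) \<notin> X1 \<inter> {a<..<b} - F t" "snd (p t) \<notin> X2 \<inter> {e<..<f} - F t"
        using P_F[OF p(2)[OF t] pP] by auto
      fix x x' y y' assume *: "x \<in> X1 \<inter> {a<..<b} - F t" "x' \<in> X1 \<inter> {a<..<b} - F t"
        "y \<in> X2 \<inter> {e<..<f} - F t" "y' \<in> X2 \<inter> {e<..<f} - F t" "x < x'" "y < y'"
      let ?in = "\<lambda>p. x < fst p \<and> fst p < x' \<and> y < snd p \<and> snd p < y'"
      have single: "{z \<in> {w}. Q z} = (if Q w then {w} else {})" for w :: pt and Q by auto
      have "{z \<in> P t. ?in z} = (if ?in (p t) then {p t} else {})"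
      proof -
        have "{z \<in> P t. ?in z} = {z \<in> P t \<inter> ?R. ?in z}" using * by (auto simp: mem_Times_iff)
        also have "\<dots> = {z \<in> {p t}. ?in z}" unfolding p(1)[OF t] ..
        also have "\<dots> = (if ?in (p t) then {p t} else {})" by (rule single)
        finally show ?thesis .
      qed
      moreover have "mixed (lev v t) x x' y y' = (\<Sum>z\<in>{z \<in> P t. ?in z}. c t z)"
        by (rule mixed_eq[OF p(2)[OF t]]) (use * in blast)+
      ultimately have "mixed (lev v t) x x' y y' = (if ?in (p t) then c t (p t) else 0)"
        by simp
      then show "of_bool (t < v (x', y')) - of_bool (t < v (x, y')) - of_bool (t < v (x', y)) + of_bool (t < v (x, y)) =
          (if x < fst (p t) \<and> fst (p t) < x' \<and> y < snd (p t) \<and> snd (p t) < y' then c t (p t) else 0)"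
        by (simp add: mixed_def lev_def)
    qed
  qed
  moreover have "isolated a b e f \<subseteq> p ` T'"
    unfolding isolated_def T'_def p_def by (auto intro!: image_eqI)
  ultimately show ?thesis by (rule chain_cover_mono)
qed

text \<open>The finitely many corners of a level keep some distance \<open>d\<close> from
  \<open>p\<close>, so a rational box reaching less than \<open>d / 2\<close> in each coordinate
  contains no other corner.\<close>

lemma P_isolated:
  assumes "t \<in> T" "p \<in> P t"
  obtains a b e f where "a \<in> \<rat>" "b \<in> \<rat>" "e \<in> \<rat>" "f \<in> \<rat>" "a1 \<le> a" "b \<le> b1" "a2 \<le> e" "f \<le> b2"
    "p \<in> isolated a b e f"
proof -
  have p: "a1 < fst p" "fst p < b1" "a2 < snd p" "snd p < b2"
    using P_subset[OF assms(1)] assms(2) by auto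
  obtain d where d: "0 < d" "\<And>p'. p' \<in> P t \<Longrightarrow> p' \<noteq> p \<Longrightarrow> d \<le> dist p' p"
    using finite_set_avoid[OF finite_P[OF assms(1)], of p] by (metis dist_commute)
  obtain a where a: "a \<in> \<rat>" "max a1 (fst p - d / 2) < a" "a < fst p"
    using Rats_dense_in_real[of "max a1 (fst p - d / 2)" "fst p"] p d by auto
  obtain b where b: "b \<in> \<rat>" "fst p < b" "b < min b1 (fst p + d / 2)"
    using Rats_dense_in_real[of "fst p" "min b1 (fst p + d / 2)"] p d by auto
  obtain e where e: "e \<in> \<rat>" "max a2 (snd p - d / 2) < e" "e < snd p"
    using Rats_dense_in_real[of "max a2 (snd p - d / 2)" "snd p"] p d by auto
  obtain f where f: "f \<in> \<rat>" "snd p < f" "f < min b2 (snd p + d / 2)"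
    using Rats_dense_in_real[of "snd p" "min b2 (snd p + d / 2)"] p d by auto
  have "P t \<inter> {a<..<b} \<times> {e<..<f} = {p}"
  proof (intro equalityI subsetI)
    fix p' assume p': "p' \<in> P t \<inter> {a<..<b} \<times> {e<..<f}"
    then have "a < fst p'" "fst p' < b" "e < snd p'" "snd p' < f" by (auto simp: mem_Times_iff)
    then have "\<bar>fst p' - fst p\<bar> < d / 2" "\<bar>snd p' - snd p\<bar> < d / 2"
      using a b e f unfolding abs_less_iff by auto
    then have "dist p' p < d" using dist_le_sum_abs[of p' p] by linarith
    then show "p' \<in> {p}" using d(2)[of p'] p' by force
  next
    fix p' assume "p' \<in> {p}"
    then show "p' \<in> P t \<inter> {a<..<b} \<times> {e<..<f}"
      using assms(2) a b e f by (auto simp: mem_Times_iff)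
  qed
  then have "p \<in> isolated a b e f" using assms(1) unfolding isolated_def by blast
  then show thesis using a b e f by (intro that[of a b e f]) auto
qed

text \<open>Closures of chains are chains and are Borel; intersecting with the bounded set
  \<open>S\<close> beforehand keeps their length finite.\<close>

lemma chain_cover_closed:
  assumes "chain_cover S" "bounded S"
  obtains \<D> where "finite \<D>" "S \<subseteq> \<Union>\<D>" "\<And>D. D \<in> \<D> \<Longrightarrow> closed D \<and> hausdorff1 D < \<infinity>"
proof -
  obtain \<C> where C: "finite \<C>" "S \<subseteq> \<Union>\<C>" "\<forall>C\<in>\<C>. chain 1 C \<or> chain (-1) C"
    using assms(1) unfolding chain_cover_def by blast
  have "closed (closure (C \<inter> S)) \<and> hausdorff1 (closure (C \<inter> S)) < \<infinity>" if C_in: "C \<in> \<C>" for C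
  proof -
    obtain s where s: "chain s C" "s = 1 \<or> s = -1" using bspec[OF C(3) C_in] by metis
    then have "chain s (C \<inter> S)" unfolding chain_def by blast
    then have "chain s (closure (C \<inter> S))" by (rule chain_closure)
    moreover have "bounded (closure (C \<inter> S))" by (intro bounded_closure bounded_subset[OF assms(2)]) auto
    ultimately have "hausdorff1 (closure (C \<inter> S)) < \<infinity>" using s(2) by (intro hausdorff1_chain_finite)
    then show ?thesis by simp
  qed
  then have closed: "closed D \<and> hausdorff1 D < \<infinity>" if "D \<in> (\<lambda>C. closure (C \<inter> S)) ` \<C>" for D
    using that by (elim imageE) simp
  have cover: "S \<subseteq> \<Union>((\<lambda>C. closure (C \<inter> S)) ` \<C>)"
  proof
    fix x assume x: "x \<in> S"
    then obtain C where "C \<in> \<C>" "x \<in> C" using C(2) by blast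
    moreover from this x have "x \<in> closure (C \<inter> S)" using closure_subset[of "C \<inter> S"] by blast
    ultimately show "x \<in> \<Union>((\<lambda>C. closure (C \<inter> S)) ` \<C>)" by blast
  qed
  have "finite ((\<lambda>C. closure (C \<inter> S)) ` \<C>)" using C(1) by simp
  then show thesis using cover closed by (rule that)
qed

lemma sigma_finite_carrier:
  "\<exists>A. A \<in> sets borel \<and> A \<subseteq> {a1<..<b1} \<times> {a2<..<b2} \<and> hausdorff1_sigma_finite_on A \<and> (\<forall>t\<in>T. P t \<subseteq> A)"
proof -
  let ?\<Omega> = "{a1<..<b1} \<times> {a2<..<b2}"
  define R where "R = {(a, b, e, f). a \<in> \<rat> \<and> b \<in> \<rat> \<and> e \<in> \<rat> \<and> f \<in> \<rat> \<and> a1 \<le> a \<and> b \<le> b1 \<and> a2 \<le> e \<and> f \<le> b2}"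
  have "countable (\<rat> \<times> \<rat> \<times> \<rat> \<times> \<rat> :: (real \<times> real \<times> real \<times> real) set)"
    by (intro countable_SIGMA countable_rat)
  then have R: "countable R" by (rule countable_subset[rotated]) (auto simp: R_def)
  have "\<exists>\<D>. finite \<D> \<and> (case r of (a, b, e, f) \<Rightarrow> isolated a b e f) \<subseteq> \<Union>\<D> \<and>
      (\<forall>D\<in>\<D>. closed D \<and> hausdorff1 D < \<infinity>)" if "r \<in> R" for r
  proof -
    obtain a b e f where r: "r = (a, b, e, f)" by (cases r)
    have "chain_cover (isolated a b e f)"
      by (rule chain_cover_isolated) (use that in \<open>auto simp: r R_def\<close>)
    moreover have "bounded (isolated a b e f)"
      by (rule bounded_subset[of "{a<..<b} \<times> {e<..<f}"]) (auto simp: isolated_def intro: bounded_Times)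
    ultimately obtain \<D> where "finite \<D>" "isolated a b e f \<subseteq> \<Union>\<D>" "\<And>D. D \<in> \<D> \<Longrightarrow> closed D \<and> hausdorff1 D < \<infinity>"
      by (rule chain_cover_closed) blast
    then show ?thesis unfolding r by (intro exI[of _ \<D>]) simp
  qed
  then have "\<exists>\<D>. \<forall>r\<in>R. finite (\<D> r) \<and> (case r of (a, b, e, f) \<Rightarrow> isolated a b e f) \<subseteq> \<Union>(\<D> r) \<and>
      (\<forall>D\<in>\<D> r. closed D \<and> hausdorff1 D < \<infinity>)" by (intro bchoice ballI)
  then obtain \<D> where \<D>: "\<forall>r\<in>R. finite (\<D> r) \<and> (case r of (a, b, e, f) \<Rightarrow> isolated a b e f) \<subseteq> \<Union>(\<D> r) \<and>
      (\<forall>D\<in>\<D> r. closed D \<and> hausdorff1 D < \<infinity>)" ..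
  \<comment> \<open>The empty set makes the family nonempty, as its enumeration by
    \<open>from_nat_into\<close> requires.\<close>
  define \<E> where "\<E> = insert {} (\<Union>r\<in>R. \<D> r)"
  have count: "countable \<E>" unfolding \<E>_def using R \<D> by (intro countable_insert countable_UN R) (auto intro: countable_finite)
  have "hausdorff1 {} < \<infinity>"
    by (rule hausdorff1_chain_finite[of 1]) (auto simp: chain_def)
  then have E: "closed D" "hausdorff1 D < \<infinity>" if "D \<in> \<E>" for D
    using that \<D> unfolding \<E>_def by auto
  define A where "A = \<Union>\<E> \<inter> ?\<Omega>"
  have "A \<in> sets borel"
    unfolding A_def using E(1) count by (intro sets.Int sets.countable_Union) (auto simp: open_Times)
  moreover have "hausdorff1_sigma_finite_on A"
    unfolding hausdorff1_sigma_finite_on_def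
  proof (intro exI[of _ "from_nat_into \<E>"] conjI allI)
    have "range (from_nat_into \<E>) = \<E>"
      by (rule range_from_nat_into[OF _ count]) (auto simp: \<E>_def)
    then show "A \<subseteq> (\<Union>k. from_nat_into \<E> k)" "hausdorff1 (from_nat_into \<E> k) < \<infinity>" for k
      unfolding A_def using E(2) by auto
  qed
  moreover have "P t \<subseteq> A" if t: "t \<in> T" for t
  proof
    fix p assume p: "p \<in> P t"
    obtain a b e f where r: "(a, b, e, f) \<in> R" "p \<in> isolated a b e f"
      by (rule P_isolated[OF t p]) (auto simp: R_def)
    then have "p \<in> \<Union>\<E>" using \<D> unfolding \<E>_def by fastforce
    then show "p \<in> A" using P_subset[OF t] p unfolding A_def by blast
  qed
  ultimately show ?thesis by (intro exI[of _ A]) (auto simp: A_def)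
qed

end

section \<open>The measure generated by the corners\<close>

lemma left_sequence:
  assumes "dense_in X l r" "l < a" "a \<le> r"
  obtains \<xi> :: "nat \<Rightarrow> real" where "\<And>n. \<xi> n \<in> X" "\<And>n. \<xi> n < a" "\<xi> \<longlonglongrightarrow> a"
proof -
  have "\<exists>x\<in>X. max l (a - 1 / real (Suc n)) < x \<and> x < a" for n
    using assms by (intro dense_inD) auto
  then obtain \<xi> where \<xi>: "\<And>n. \<xi> n \<in> X" "\<And>n. max l (a - 1 / real (Suc n)) < \<xi> n" "\<And>n. \<xi> n < a"
    by metis
  have "\<xi> \<longlonglongrightarrow> a"
  proof (rule tendsto_sandwich)
    show "eventually (\<lambda>n. a - 1 / real (Suc n) \<le> \<xi> n) sequentially" "eventually (\<lambda>n. \<xi> n \<le> a) sequentially"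
      using \<xi>(2,3) by (auto intro!: always_eventually less_imp_le)
    show "(\<lambda>n. a - 1 / real (Suc n)) \<longlonglongrightarrow> a"
      using tendsto_diff[OF tendsto_const[of a] lim_1_over_n[THEN LIMSEQ_Suc]] by simp
  qed auto
  with \<xi>(1,3) show thesis by (rule that)
qed

text \<open>When \<open>a\<close> is approached from the left, the point \<open>y = a\<close> ends
  up on the right. Rectangles with such vertices therefore capture half-open cells exactly, and
  forbidden lines are eventually avoided.\<close>

lemma left_sequence_eventually:
  fixes \<xi> :: "nat \<Rightarrow> real"
  assumes "\<And>n. \<xi> n < a" "\<xi> \<longlonglongrightarrow> a"
  shows "eventually (\<lambda>n. (\<xi> n < y \<longleftrightarrow> a \<le> y) \<and> (y < \<xi> n \<longleftrightarrow> y < a) \<and> \<xi> n \<noteq> y) sequentially"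
proof (cases "a \<le> y")
  case True
  then have "\<xi> n < y" for n using assms(1)[of n] by linarith
  then show ?thesis using True by (auto intro!: always_eventually simp: less_imp_neq not_less less_imp_le)
next
  case False
  then show ?thesis using order_tendstoD(1)[OF assms(2), of y]
    by (auto elim!: eventually_mono)
qed

context corner_family
begin

definition pts :: "real \<Rightarrow> pt set" where "pts t = (if t \<in> T then P t else {})"

text \<open>For \<open>s = 1\<close> and \<open>s = -1\<close> this integrates against the positive
  and the negative part of the atomic measure of level \<open>t\<close>. The counting measure makes
  additivity and monotone convergence in \<open>f\<close> immediate.\<close>

definition kint :: "real \<Rightarrow> (pt \<Rightarrow> ennreal) \<Rightarrow> real \<Rightarrow> ennreal" where
  "kint s f t = (\<integral>\<^sup>+p. f p * ennreal (max 0 (s * c t p)) \<partial>count_space (pts t))"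

lemma finite_pts: "finite (pts t)"
  unfolding pts_def using finite_P by simp

lemma kint_sum: "kint s f t = (\<Sum>p\<in>pts t. f p * ennreal (max 0 (s * c t p)))"
  unfolding kint_def by (rule nn_integral_count_space_finite[OF finite_pts])

text \<open>The atoms were chosen separately for each \<open>t\<close>, but their total weight in a
  half-open cell is a limit of mixed differences of \<open>lev v t\<close> at fixed grid points, and
  these are Borel in \<open>t\<close>.\<close>

lemma measurable_cell_weight:
  assumes "a1 < a" "a < b" "b < b1" "a2 < e" "e < f" "f < b2"
  shows "(\<lambda>t. \<Sum>p\<in>{p\<in>pts t. a \<le> fst p \<and> fst p < b \<and> e \<le> snd p \<and> snd p < f}. c t p) \<in> borel_measurable borel"
proof -
  obtain \<xi>a where a: "\<And>n. \<xi>a n \<in> X1" "\<And>n. \<xi>a n < a" "\<xi>a \<longlonglongrightarrow> a"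
    by (rule left_sequence[OF X1(2), of a]) (use assms in auto)
  obtain \<xi>b where b: "\<And>n. \<xi>b n \<in> X1" "\<And>n. \<xi>b n < b" "\<xi>b \<longlonglongrightarrow> b"
    by (rule left_sequence[OF X1(2), of b]) (use assms in auto)
  obtain \<xi>e where e: "\<And>n. \<xi>e n \<in> X2" "\<And>n. \<xi>e n < e" "\<xi>e \<longlonglongrightarrow> e"
    by (rule left_sequence[OF X2(2), of e]) (use assms in auto)
  obtain \<xi>f where f: "\<And>n. \<xi>f n \<in> X2" "\<And>n. \<xi>f n < f" "\<xi>f \<longlonglongrightarrow> f"
    by (rule left_sequence[OF X2(2), of f]) (use assms in auto)
  let ?w = "\<lambda>t. \<Sum>p\<in>{p\<in>pts t. a \<le> fst p \<and> fst p < b \<and> e \<le> snd p \<and> snd p < f}. c t p"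
  show ?thesis
  proof (rule borel_measurable_LIMSEQ_real)
    fix t
    show "(\<lambda>n. indicator T t * mixed (lev v t) (\<xi>a n) (\<xi>b n) (\<xi>e n) (\<xi>f n)) \<longlonglongrightarrow> ?w t"
    proof (cases "t \<in> T")
      case False
      then show ?thesis by (simp add: pts_def)
    next
      case True
      have ev: "eventually (\<lambda>n. \<forall>y\<in>F t. (\<xi> n < y \<longleftrightarrow> z \<le> y) \<and> (y < \<xi> n \<longleftrightarrow> y < z) \<and> \<xi> n \<noteq> y) sequentially"
        if "\<And>n. \<xi> n < z" "\<xi> \<longlonglongrightarrow> z" for \<xi> z
        using finite_F[OF True] by (intro eventually_ball_finite ballI left_sequence_eventually that)
      have less: "eventually (\<lambda>n. \<xi> n < \<zeta> n) sequentially"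
        if "\<And>n. \<xi> n < x" "\<zeta> \<longlonglongrightarrow> y" "x < y" for \<xi> \<zeta> :: "nat \<Rightarrow> real" and x y
        using order_tendstoD(1)[OF that(2,3)] by eventually_elim (use that(1) less_trans in blast)
      have "eventually (\<lambda>n. indicator T t * mixed (lev v t) (\<xi>a n) (\<xi>b n) (\<xi>e n) (\<xi>f n) = ?w t) sequentially"
        using ev[of \<xi>a, OF a(2,3)] ev[of \<xi>b, OF b(2,3)] ev[of \<xi>e, OF e(2,3)] ev[of \<xi>f, OF f(2,3)]
          less[of \<xi>a, OF a(2) b(3) assms(2)] less[of \<xi>e, OF e(2) f(3) assms(5)]
      proof eventually_elim
        case (elim n)
        have "mixed (lev v t) (\<xi>a n) (\<xi>b n) (\<xi>e n) (\<xi>f n) =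
          (\<Sum>p\<in>{p\<in>P t. \<xi>a n < fst p \<and> fst p < \<xi>b n \<and> \<xi>e n < snd p \<and> snd p < \<xi>f n}. c t p)"
          by (rule mixed_eq[OF True]) (use a(1) b(1) e(1) f(1) elim in blast)+
        also have "{p\<in>P t. \<xi>a n < fst p \<and> fst p < \<xi>b n \<and> \<xi>e n < snd p \<and> snd p < \<xi>f n} =
          {p\<in>pts t. a \<le> fst p \<and> fst p < b \<and> e \<le> snd p \<and> snd p < f}"
          using elim P_F[OF True] True unfolding pts_def by auto
        finally show ?case using True by simp
      qed
      then show ?thesis by (rule tendsto_eventually)
    qed
  next
    fix n
    show "(\<lambda>t. indicator T t * mixed (lev v t) (\<xi>a n) (\<xi>b n) (\<xi>e n) (\<xi>f n)) \<in> borel_measurable borel"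
      unfolding mixed_def lev_def by measurable
  qed
qed

section \<open>Dyadic cells and measurability in the level\<close>

definition idx :: "nat \<Rightarrow> pt \<Rightarrow> int \<times> int" where
  "idx n p = (\<lfloor>2 ^ n * fst p\<rfloor>, \<lfloor>2 ^ n * snd p\<rfloor>)"

definition closed_cell :: "nat \<Rightarrow> int \<times> int \<Rightarrow> pt set" where
  "closed_cell n k = {of_int (fst k) / 2 ^ n..(of_int (fst k) + 1) / 2 ^ n} \<times> {of_int (snd k) / 2 ^ n..(of_int (snd k) + 1) / 2 ^ n}"

lemma floor_scale_iff: "\<lfloor>2 ^ n * x\<rfloor> = i \<longleftrightarrow> of_int i / 2 ^ n \<le> x \<and> x < (of_int i + 1) / 2 ^ n" for x :: real
  by (auto simp: floor_eq_iff field_simps)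

lemma idx_eq_iff: "idx n p = k \<longleftrightarrow> of_int (fst k) / 2 ^ n \<le> fst p \<and> fst p < (of_int (fst k) + 1) / 2 ^ n \<and>
    of_int (snd k) / 2 ^ n \<le> snd p \<and> snd p < (of_int (snd k) + 1) / 2 ^ n"
  unfolding idx_def by (cases k) (auto simp: floor_scale_iff)

lemma in_closed_cell_idx: "p \<in> closed_cell n (idx n p)"
  using idx_eq_iff[of n p "idx n p"] by (auto simp: closed_cell_def mem_Times_iff)

lemma eventually_small_scale: "0 < d \<Longrightarrow> eventually (\<lambda>n. 1 / 2 ^ n < (d::real)) sequentially"
proof -
  have "(\<lambda>n. (1 / 2 :: real) ^ n) \<longlonglongrightarrow> 0" by (rule LIMSEQ_realpow_zero) auto
  then show "0 < d \<Longrightarrow> ?thesis" using order_tendstoD(2) by (fastforce simp: power_one_over)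
qed

lemma closed_cell_close:
  assumes "p \<in> closed_cell n k" "p' \<in> closed_cell n k"
  shows "dist p p' \<le> 2 * (1 / 2 ^ n)"
proof -
  have "\<bar>fst p - fst p'\<bar> \<le> 1 / 2 ^ n"
    using assms unfolding closed_cell_def mem_Times_iff atLeastAtMost_iff add_divide_distrib by linarith
  moreover have "\<bar>snd p - snd p'\<bar> \<le> 1 / 2 ^ n"
    using assms unfolding closed_cell_def mem_Times_iff atLeastAtMost_iff add_divide_distrib by linarith
  ultimately show ?thesis using dist_le_sum_abs[of p p'] by linarith
qed

definition cells :: "nat \<Rightarrow> pt set \<Rightarrow> (int \<times> int) set" where
  "cells n B = {k. closed_cell n k \<subseteq> B}"

lemma finite_cells:
  assumes "bounded B"
  shows "finite (cells n B)"
proof -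
  obtain M where M: "\<And>x. x \<in> B \<Longrightarrow> norm x \<le> M" using assms by (auto simp: bounded_iff)
  have "cells n B \<subseteq> {-\<lceil>2 ^ n * M\<rceil>..\<lceil>2 ^ n * M\<rceil>} \<times> {-\<lceil>2 ^ n * M\<rceil>..\<lceil>2 ^ n * M\<rceil>}"
  proof
    fix k assume "k \<in> cells n B"
    then have sub: "closed_cell n k \<subseteq> B" unfolding cells_def by simp
    have "(of_int (fst k) / 2 ^ n, of_int (snd k) / 2 ^ n) \<in> closed_cell n k"
      unfolding closed_cell_def by (auto simp: divide_right_mono)
    then have "norm (of_int (fst k) / 2 ^ n :: real, of_int (snd k) / 2 ^ n :: real) \<le> M" using sub M by blast
    then have "\<bar>of_int (fst k) / 2 ^ n :: real\<bar> \<le> M" "\<bar>of_int (snd k) / 2 ^ n :: real\<bar> \<le> M"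
      using norm_fst_le[of "of_int (fst k) / 2 ^ n :: real" "of_int (snd k) / 2 ^ n :: real"]
        norm_snd_le[of "of_int (snd k) / 2 ^ n :: real" "of_int (fst k) / 2 ^ n :: real"]
      unfolding real_norm_def by linarith+
    then have "\<bar>real_of_int (fst k)\<bar> \<le> 2 ^ n * M" "\<bar>real_of_int (snd k)\<bar> \<le> 2 ^ n * M"
      by (auto simp: abs_if field_simps split: if_splits)
    then have "\<bar>fst k\<bar> \<le> \<lceil>2 ^ n * M\<rceil>" "\<bar>snd k\<bar> \<le> \<lceil>2 ^ n * M\<rceil>" by linarith+
    then show "k \<in> {-\<lceil>2 ^ n * M\<rceil>..\<lceil>2 ^ n * M\<rceil>} \<times> {-\<lceil>2 ^ n * M\<rceil>..\<lceil>2 ^ n * M\<rceil>}"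
      by (auto simp: mem_Times_iff)
  qed
  then show ?thesis by (rule finite_subset) simp
qed

text \<open>The positive part of a cell sum would lose weight if atoms of opposite sign shared a
  cell. As a level has finitely many atoms, at fine scales each cell holds at most one, and the
  closed cells around the atoms in an open set stay inside it.\<close>

lemma kint_open_eventually:
  assumes B: "open B" "bounded B"
  shows "eventually (\<lambda>n. (\<Sum>k\<in>cells n B. ennreal (max 0 (s * (\<Sum>p\<in>{p\<in>pts t. idx n p = k}. c t p)))) = kint s (indicator B) t) sequentially"
proof -
  have "eventually (\<lambda>n. \<forall>p\<in>pts t. \<forall>p'\<in>pts t. p \<noteq> p' \<longrightarrow> idx n p \<noteq> idx n p') sequentially"
  proof (intro eventually_ball_finite finite_pts ballI)
    fix p p' assume "p \<in> pts t" "p' \<in> pts t"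
    show "eventually (\<lambda>n. p \<noteq> p' \<longrightarrow> idx n p \<noteq> idx n p') sequentially"
    proof (cases "p = p'")
      case False
      then have "0 < dist p p' / 2" by simp
      from eventually_small_scale[OF this] show ?thesis
      proof eventually_elim
        case (elim n)
        show ?case
        proof (intro impI notI)
          assume "idx n p = idx n p'"
          then have "dist p p' \<le> 2 * (1 / 2 ^ n)"
            using in_closed_cell_idx[of p n] in_closed_cell_idx[of p' n] by (intro closed_cell_close) auto
          then show False using elim by simp
        qed
      qed
    qed simp
  qed
  moreover have "eventually (\<lambda>n. \<forall>p\<in>pts t. p \<in> B \<longrightarrow> idx n p \<in> cells n B) sequentially"
  proof (intro eventually_ball_finite finite_pts ballI)
    fix p assume "p \<in> pts t"
    show "eventually (\<lambda>n. p \<in> B \<longrightarrow> idx n p \<in> cells n B) sequentially"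
    proof (cases "p \<in> B")
      case True
      then obtain d where d: "0 < d" "ball p d \<subseteq> B" using B(1) open_contains_ball by blast
      then have "0 < d / 2" by simp
      from eventually_small_scale[OF this] show ?thesis
      proof eventually_elim
        case (elim n)
        have "closed_cell n (idx n p) \<subseteq> ball p d"
        proof
          fix x assume "x \<in> closed_cell n (idx n p)"
          from closed_cell_close[OF in_closed_cell_idx this] show "x \<in> ball p d" using elim by simp
        qed
        then show ?case using d unfolding cells_def by auto
      qed
    qed simp
  qed
  ultimately show ?thesis
  proof eventually_elim
    case (elim n)
    have inj: "inj_on (idx n) (pts t)" using elim(1) by (auto simp: inj_on_def)
    have mem: "idx n p \<in> cells n B \<longleftrightarrow> p \<in> B" if "p \<in> pts t" for p
      using elim(2) that in_closed_cell_idx[of p n] unfolding cells_def by auto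
    let ?g = "\<lambda>k. ennreal (max 0 (s * (\<Sum>p\<in>{p\<in>pts t. idx n p = k}. c t p)))"
    have "(\<Sum>k\<in>cells n B. ?g k) = (\<Sum>k\<in>idx n ` {p\<in>pts t. p \<in> B}. ?g k)"
    proof (rule sum.mono_neutral_right[OF finite_cells[OF B(2)]])
      show "idx n ` {p\<in>pts t. p \<in> B} \<subseteq> cells n B" using mem by auto
      show "\<forall>k\<in>cells n B - idx n ` {p\<in>pts t. p \<in> B}. ?g k = 0"
      proof
        fix k assume k: "k \<in> cells n B - idx n ` {p\<in>pts t. p \<in> B}"
        then have empty: "{p\<in>pts t. idx n p = k} = {}" using mem by auto
        show "?g k = 0" unfolding empty by simp
      qed
    qed
    also have "\<dots> = (\<Sum>p\<in>{p\<in>pts t. p \<in> B}. ?g (idx n p))"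
      by (rule sum.reindex[unfolded o_def]) (use inj in \<open>auto simp: inj_on_def\<close>)
    also have "\<dots> = (\<Sum>p\<in>{p\<in>pts t. p \<in> B}. ennreal (max 0 (s * c t p)))"
    proof (intro sum.cong refl)
      fix p assume p: "p \<in> {p\<in>pts t. p \<in> B}"
      have "{p' \<in> pts t. idx n p' = idx n p} = {p}" using elim(1) p by auto
      then show "?g (idx n p) = ennreal (max 0 (s * c t p))" by simp
    qed
    also have "\<dots> = kint s (indicator B) t"
      unfolding kint_sum by (rule sum.mono_neutral_cong_left) (auto simp: finite_pts)
    finally show ?case .
  qed
qed

end

context corner_family
begin

abbreviation \<Omega> :: "pt set" where "\<Omega> \<equiv> {a1<..<b1} \<times> {a2<..<b2}"

lemma pts_subset: "pts t \<subseteq> \<Omega>"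
  unfolding pts_def using P_subset by auto

text \<open>Only cells whose closure lies in \<open>B\<close> enter, so their sides are strictly
  inside the box, as \<open>measurable_cell_weight\<close> demands.\<close>

lemma measurable_kint_open:
  assumes "open B" "B \<subseteq> \<Omega>"
  shows "kint s (indicator B) \<in> borel_measurable borel"
proof -
  have B: "bounded B" by (rule bounded_subset[OF _ assms(2)]) (intro bounded_Times; simp)
  have weight: "(\<lambda>t. \<Sum>p\<in>{p\<in>pts t. idx n p = k}. c t p) \<in> borel_measurable borel" if "k \<in> cells n B" for n k
  proof -
    let ?a = "of_int (fst k) / 2 ^ n :: real" and ?b = "(of_int (fst k) + 1) / 2 ^ n :: real"
    let ?e = "of_int (snd k) / 2 ^ n :: real" and ?f = "(of_int (snd k) + 1) / 2 ^ n :: real"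
    have less: "?a < ?b" "?e < ?f" by (auto intro: divide_strict_right_mono)
    have "closed_cell n k \<subseteq> \<Omega>" using that assms(2) unfolding cells_def by auto
    moreover have "(?a, ?e) \<in> closed_cell n k" "(?b, ?f) \<in> closed_cell n k"
      using less unfolding closed_cell_def by auto
    ultimately have "(?a, ?e) \<in> \<Omega>" "(?b, ?f) \<in> \<Omega>" by blast+
    then have "(\<lambda>t. \<Sum>p\<in>{p\<in>pts t. ?a \<le> fst p \<and> fst p < ?b \<and> ?e \<le> snd p \<and> snd p < ?f}. c t p) \<in> borel_measurable borel"
      using less by (intro measurable_cell_weight) auto
    then show ?thesis unfolding idx_eq_iff .
  qed
  show ?thesis
  proof (rule borel_measurable_LIMSEQ_order)
    show "(\<lambda>t. \<Sum>k\<in>cells n B. ennreal (max 0 (s * (\<Sum>p\<in>{p\<in>pts t. idx n p = k}. c t p)))) \<in> borel_measurable borel" for n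
      by (intro borel_measurable_sum measurable_compose[OF _ measurable_ennreal] borel_measurable_max
          borel_measurable_const borel_measurable_times weight)
    show "(\<lambda>n. \<Sum>k\<in>cells n B. ennreal (max 0 (s * (\<Sum>p\<in>{p\<in>pts t. idx n p = k}. c t p)))) \<longlonglongrightarrow> kint s (indicator B) t" for t
      by (intro tendsto_eventually kint_open_eventually assms B)
  qed
qed

lemma kint_finite: "kint s (indicator B) t < top"
  unfolding kint_sum using finite_pts by (auto simp: less_top ennreal_mult_eq_top_iff indicator_def)

lemma kint_UN:
  assumes "disjoint_family A"
  shows "kint s (indicator (\<Union> (range A))) t = (\<Sum>i::nat. kint s (indicator (A i)) t)"
proof -
  have "kint s (indicator (\<Union> (range A))) t =
    (\<integral>\<^sup>+p. (\<Sum>i. indicator (A i) p * ennreal (max 0 (s * c t p))) \<partial>count_space (pts t))"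
    unfolding kint_def by (simp add: suminf_indicator[OF assms])
  also have "\<dots> = (\<Sum>i. kint s (indicator (A i)) t)"
    unfolding kint_def by (rule nn_integral_suminf) simp
  finally show ?thesis .
qed

text \<open>Open sets generate the Borel sets and are stable under intersection, so a Dynkin
  argument applies; finiteness at each level permits the subtraction needed for complements.\<close>

lemma measurable_kint_indicator:
  assumes "B \<in> sets borel"
  shows "kint s (indicator B) \<in> borel_measurable borel"
proof -
  have "Int_stable {S::pt set. open S}" by (auto simp: Int_stable_def)
  moreover have "{S::pt set. open S} \<subseteq> Pow UNIV" by simp
  moreover have "B \<in> sigma_sets UNIV {S. open S}" using assms by (simp add: borel_def)
  ultimately show ?thesis
  proof (induction B rule: sigma_sets_induct_disjoint)
    case (basic S)
    have "kint s (indicator S) = kint s (indicator (S \<inter> \<Omega>))"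
      unfolding kint_sum[abs_def] using pts_subset by (intro ext sum.cong) (auto simp: indicator_def)
    moreover have "open (S \<inter> \<Omega>)" using basic by (intro open_Int open_Times) auto
    ultimately show ?case using measurable_kint_open[of "S \<inter> \<Omega>" s] by simp
  next
    case empty
    then show ?case by (simp add: kint_def[abs_def])
  next
    case (compl A)
    have UNIV_eq: "kint s (indicator UNIV) = kint s (indicator \<Omega>)"
      unfolding kint_sum[abs_def] using pts_subset by (intro ext sum.cong) (auto simp: indicator_def)
    have "kint s (indicator (UNIV - A)) = (\<lambda>t. kint s (indicator \<Omega>) t - kint s (indicator A) t)"
    proof
      fix t
      have "kint s (indicator A) t + kint s (indicator (UNIV - A)) t = kint s (indicator UNIV) t"
        unfolding kint_sum sum.distrib[symmetric] by (intro sum.cong) (auto simp: indicator_def)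
      then have "kint s (indicator UNIV) t - kint s (indicator A) t = kint s (indicator (UNIV - A)) t"
        using kint_finite[of s A t] by (metis ennreal_add_diff_cancel_left less_top)
      then show "kint s (indicator (UNIV - A)) t = kint s (indicator \<Omega>) t - kint s (indicator A) t"
        unfolding UNIV_eq ..
    qed
    moreover have "kint s (indicator \<Omega>) \<in> borel_measurable borel"
      by (intro measurable_kint_open open_Times) auto
    ultimately show ?case using compl by simp
  next
    case (union A)
    have "kint s (indicator (\<Union> (range A))) = (\<lambda>t. \<Sum>i. kint s (indicator (A i)) t)"
      by (rule ext) (rule kint_UN[OF union(1)])
    then show ?case using union by simp
  qed
qed

text \<open>The superposition over all levels of the positive or negative parts of their atomic
  measures.\<close>

definition corner_measure :: "real \<Rightarrow> pt measure" where
  "corner_measure s = measure_of UNIV (sets borel) (\<lambda>B. \<integral>\<^sup>+t. kint s (indicator B) t \<partial>lborel)"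

lemma sets_corner_measure [simp]: "sets (corner_measure s) = sets borel"
  unfolding corner_measure_def by (simp add: sets_measure_of_conv) (metis sets.sigma_sets_eq space_borel)

lemma space_corner_measure [simp]: "space (corner_measure s) = UNIV"
  unfolding corner_measure_def by (simp add: space_measure_of_conv)

lemma emeasure_corner_measure:
  assumes "B \<in> sets borel"
  shows "emeasure (corner_measure s) B = (\<integral>\<^sup>+t. kint s (indicator B) t \<partial>lborel)"
proof (rule emeasure_measure_of[OF corner_measure_def])
  show "positive (sets (corner_measure s)) (\<lambda>B. \<integral>\<^sup>+t. kint s (indicator B) t \<partial>lborel)"
    by (simp add: positive_def kint_def)
  show "countably_additive (sets (corner_measure s)) (\<lambda>B. \<integral>\<^sup>+t. kint s (indicator B) t \<partial>lborel)"
  proof (rule countably_additiveI)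
    fix A :: "nat \<Rightarrow> pt set" assume A: "range A \<subseteq> sets (corner_measure s)" "disjoint_family A"
    have "A i \<in> sets borel" for i using A(1) by auto
    then show "(\<Sum>i. \<integral>\<^sup>+t. kint s (indicator (A i)) t \<partial>lborel) = (\<integral>\<^sup>+t. kint s (indicator (\<Union> (range A))) t \<partial>lborel)"
      unfolding kint_UN[OF A(2)]
      by (intro nn_integral_suminf[symmetric]) (simp add: measurable_kint_indicator)
  qed
qed (use assms in auto)

text \<open>Both claims go through one induction on \<open>f\<close>, because the integral formula
  at each stage relies on the measurability of the kernel.\<close>

lemma measurable_kint_and_integral:
  assumes "f \<in> borel_measurable borel"
  shows "kint s f \<in> borel_measurable borel \<and> (\<integral>\<^sup>+p. f p \<partial>corner_measure s) = (\<integral>\<^sup>+t. kint s f t \<partial>lborel)"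
  using assms
proof (induction f rule: borel_measurable_induct)
  case (cong f g)
  then have "f = g" by auto
  then show ?case using cong by simp
next
  case (set A)
  then show ?case
    using measurable_kint_indicator[of A s] emeasure_corner_measure[of A s]
    by (simp add: nn_integral_indicator sets_corner_measure)
next
  case (mult u k)
  have eq: "kint s (\<lambda>x. k * u x) = (\<lambda>t. k * kint s u t)"
    unfolding kint_def[abs_def] by (subst nn_integral_cmult[symmetric]) (auto simp: mult.assoc)
  have u: "u \<in> borel_measurable (corner_measure s)"
    using mult(2) by (simp cong: measurable_cong_sets add: sets_corner_measure)
  have [measurable]: "kint s u \<in> borel_measurable borel" using mult by simp
  have "(\<integral>\<^sup>+p. k * u p \<partial>corner_measure s) = (\<integral>\<^sup>+t. k * kint s u t \<partial>lborel)"
    using mult by (simp add: nn_integral_cmult[OF u] nn_integral_cmult)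
  then show ?case unfolding eq by simp
next
  case (add u w)
  have eq: "kint s (\<lambda>x. w x + u x) = (\<lambda>t. kint s w t + kint s u t)"
    unfolding kint_def[abs_def] by (subst nn_integral_add[symmetric]) (auto simp: distrib_right)
  have uw: "u \<in> borel_measurable (corner_measure s)" "w \<in> borel_measurable (corner_measure s)"
    using add by (simp_all cong: measurable_cong_sets)
  have [measurable]: "kint s u \<in> borel_measurable borel" "kint s w \<in> borel_measurable borel"
    using add by simp_all
  have "(\<integral>\<^sup>+p. w p + u p \<partial>corner_measure s) = (\<integral>\<^sup>+t. kint s w t + kint s u t \<partial>lborel)"
    using add by (simp add: nn_integral_add uw)
  then show ?case unfolding eq by simp
next
  case (seq U)
  have eq: "kint s (SUP i. U i) = (\<lambda>t. SUP i. kint s (U i) t)"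
  proof
    fix t
    have "kint s (SUP i. U i) t = (\<integral>\<^sup>+p. (SUP i. U i p * ennreal (max 0 (s * c t p))) \<partial>count_space (pts t))"
      unfolding kint_def by (simp add: SUP_mult_right_ennreal image_comp)
    also have "\<dots> = (SUP i. kint s (U i) t)"
      unfolding kint_def
      by (rule nn_integral_monotone_convergence_SUP)
        (use seq(3) in \<open>auto simp: incseq_def le_fun_def intro!: mult_right_mono\<close>)
    finally show "kint s (SUP i. U i) t = (SUP i. kint s (U i) t)" .
  qed
  have inc: "incseq (\<lambda>i. kint s (U i))"
    using seq(3) unfolding incseq_def le_fun_def kint_def
    by (auto intro!: nn_integral_mono mult_right_mono)
  have U: "U i \<in> borel_measurable (corner_measure s)" for i
    using seq(1) by (simp cong: measurable_cong_sets add: sets_corner_measure)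
  have "(\<integral>\<^sup>+p. (SUP i. U i) p \<partial>corner_measure s) = (SUP i. \<integral>\<^sup>+p. U i p \<partial>corner_measure s)"
    using nn_integral_monotone_convergence_SUP[OF seq(3) U] by (simp add: image_comp)
  also have "\<dots> = (SUP i. \<integral>\<^sup>+t. kint s (U i) t \<partial>lborel)"
    using seq.IH by simp
  also have "\<dots> = (\<integral>\<^sup>+t. kint s (SUP i. U i) t \<partial>lborel)"
    unfolding eq using seq.IH by (intro nn_integral_monotone_convergence_SUP[symmetric] inc) auto
  finally have "(\<integral>\<^sup>+p. (SUP i. U i) p \<partial>corner_measure s) = (\<integral>\<^sup>+t. kint s (SUP i. U i) t \<partial>lborel)" .
  moreover have "kint s (SUP i. U i) \<in> borel_measurable borel"
    unfolding eq using seq.IH by (intro borel_measurable_SUP) auto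
  ultimately show ?case by blast
qed

lemma emeasure_corner_measure_outside:
  assumes "B \<in> sets borel" "\<And>t. t \<in> T \<Longrightarrow> P t \<subseteq> B"
  shows "emeasure (corner_measure s) (UNIV - B) = 0"
proof -
  have "kint s (indicator (UNIV - B)) = (\<lambda>t. 0)"
  proof
    fix t
    have "p \<in> B" if "p \<in> pts t" for p using that assms(2)[of t] unfolding pts_def by (auto split: if_splits)
    then have "indicator (UNIV - B) p * ennreal (max 0 (s * c t p)) = 0" if "p \<in> pts t" for p
      using that by simp
    then show "kint s (indicator (UNIV - B)) t = 0" unfolding kint_sum by (intro sum.neutral) blast
  qed
  then show ?thesis using assms(1) by (simp add: emeasure_corner_measure)
qed

lemma corner_measure_finite:
  assumes s: "s = 1 \<or> s = -1" and mass: "\<And>t. t \<in> T \<Longrightarrow> ennreal (\<Sum>p\<in>P t. \<bar>c t p\<bar>) \<le> 4 * L t"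
    and L: "L \<in> borel_measurable borel" "(\<integral>\<^sup>+t. L t \<partial>lborel) \<le> ennreal A"
  shows "finite_measure (corner_measure s)"
proof (rule finite_measureI)
  have "kint s (indicator UNIV) t \<le> 4 * L t" for t
  proof (cases "t \<in> T")
    case True
    have "kint s (indicator UNIV) t \<le> (\<Sum>p\<in>P t. ennreal \<bar>c t p\<bar>)"
      unfolding kint_sum pts_def using s True by (auto intro!: sum_mono ennreal_leI)
    also have "\<dots> = ennreal (\<Sum>p\<in>P t. \<bar>c t p\<bar>)" by (rule sum_ennreal) simp
    finally show ?thesis using mass[OF True] by (rule order_trans)
  qed (simp add: kint_sum pts_def)
  then have "emeasure (corner_measure s) UNIV \<le> (\<integral>\<^sup>+t. 4 * L t \<partial>lborel)"
    by (simp add: emeasure_corner_measure nn_integral_mono)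
  also have "\<dots> = 4 * (\<integral>\<^sup>+t. L t \<partial>lborel)" using L(1) by (simp add: nn_integral_cmult)
  also have "\<dots> \<le> 4 * ennreal A" by (intro mult_left_mono L(2)) simp
  also have "\<dots> < \<infinity>" by (simp add: ennreal_mult_less_top)
  finally show "emeasure (corner_measure s) (space (corner_measure s)) \<noteq> \<infinity>" by simp
qed

lemma corner_measure_integral_nonneg:
  assumes fin: "finite_measure (corner_measure s)" and g: "g \<in> borel_measurable borel" "\<And>p. 0 \<le> g p" "\<And>p. g p \<le> M"
  shows "\<exists>x. has_bochner_integral (corner_measure s) g x \<and>
    has_bochner_integral lborel (\<lambda>t. \<Sum>p\<in>pts t. g p * max 0 (s * c t p)) x"
proof -
  interpret finite_measure "corner_measure s" by (rule fin)
  have g': "g \<in> borel_measurable (corner_measure s)" using g(1) by (simp cong: measurable_cong_sets)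
  have eg: "(\<lambda>p. ennreal (g p)) \<in> borel_measurable borel" using g(1) by simp
  have kint: "kint s (\<lambda>p. ennreal (g p)) t = ennreal (\<Sum>p\<in>pts t. g p * max 0 (s * c t p))" for t
    unfolding kint_sum using g(2) by (subst sum_ennreal[symmetric]) (auto simp: ennreal_mult)
  have "(\<lambda>t. enn2real (kint s (\<lambda>p. ennreal (g p)) t)) \<in> borel_measurable borel"
    using measurable_kint_and_integral[OF eg] by (intro borel_measurable_enn2real) simp
  then have meas: "(\<lambda>t. \<Sum>p\<in>pts t. g p * max 0 (s * c t p)) \<in> borel_measurable lborel"
    unfolding kint using g(2) by (simp add: sum_nonneg)
  have "integrable (corner_measure s) g"
    by (rule integrable_const_bound[of _ M]) (use g g' in auto)
  then have bi: "has_bochner_integral (corner_measure s) g (integral\<^sup>L (corner_measure s) g)"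
    by (rule has_bochner_integral_integrable)
  have "(\<integral>\<^sup>+t. ennreal (\<Sum>p\<in>pts t. g p * max 0 (s * c t p)) \<partial>lborel) = (\<integral>\<^sup>+t. kint s (\<lambda>p. ennreal (g p)) t \<partial>lborel)"
    by (simp only: kint)
  also have "\<dots> = (\<integral>\<^sup>+p. ennreal (g p) \<partial>corner_measure s)"
    by (rule conjunct2[OF measurable_kint_and_integral[OF eg], symmetric])
  also have "\<dots> = ennreal (integral\<^sup>L (corner_measure s) g)"
    by (rule nn_integral_eq_integral[OF \<open>integrable _ _\<close>]) (use g(2) in auto)
  finally have "has_bochner_integral lborel (\<lambda>t. \<Sum>p\<in>pts t. g p * max 0 (s * c t p)) (integral\<^sup>L (corner_measure s) g)"
    by (intro has_bochner_integral_nn_integral meas) (use g(2) in \<open>auto intro!: sum_nonneg integral_nonneg\<close>)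
  with bi show ?thesis by blast
qed

text \<open>Adding the constant \<open>M\<close> makes the integrand nonnegative; since the measure
  is finite, the integral of the constant can be subtracted again.\<close>

lemma corner_measure_integral:
  assumes fin: "finite_measure (corner_measure s)" and g: "g \<in> borel_measurable borel" "\<And>p. \<bar>g p\<bar> \<le> M"
  shows "has_bochner_integral lborel (\<lambda>t. \<Sum>p\<in>pts t. g p * max 0 (s * c t p)) (integral\<^sup>L (corner_measure s) g)"
proof -
  have "0 \<le> M" using g(2)[of undefined] by linarith
  have "\<exists>x. has_bochner_integral (corner_measure s) (\<lambda>p. g p + M) x \<and>
    has_bochner_integral lborel (\<lambda>t. \<Sum>p\<in>pts t. (g p + M) * max 0 (s * c t p)) x"
  proof (rule corner_measure_integral_nonneg[OF fin, where M = "2 * M"])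
    show "(\<lambda>p. g p + M) \<in> borel_measurable borel" using g(1) by simp
    show "0 \<le> g p + M" "g p + M \<le> 2 * M" for p using g(2)[of p] by linarith+
  qed
  then obtain x where x: "has_bochner_integral (corner_measure s) (\<lambda>p. g p + M) x"
    "has_bochner_integral lborel (\<lambda>t. \<Sum>p\<in>pts t. (g p + M) * max 0 (s * c t p)) x" by blast
  have "\<exists>y. has_bochner_integral (corner_measure s) (\<lambda>p. M) y \<and>
    has_bochner_integral lborel (\<lambda>t. \<Sum>p\<in>pts t. M * max 0 (s * c t p)) y"
    by (rule corner_measure_integral_nonneg[OF fin, where M = M]) (use \<open>0 \<le> M\<close> in auto)
  then obtain y where y: "has_bochner_integral (corner_measure s) (\<lambda>p. M) y"
    "has_bochner_integral lborel (\<lambda>t. \<Sum>p\<in>pts t. M * max 0 (s * c t p)) y" by blast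
  have "has_bochner_integral (corner_measure s) g (x - y)"
    using has_bochner_integral_diff[OF x(1) y(1)] by simp
  then have "integral\<^sup>L (corner_measure s) g = x - y" by (rule has_bochner_integral_integral_eq)
  moreover have "has_bochner_integral lborel (\<lambda>t. \<Sum>p\<in>pts t. g p * max 0 (s * c t p)) (x - y)"
    using has_bochner_integral_diff[OF x(2) y(2)] by (simp add: sum_subtractf[symmetric] algebra_simps)
  ultimately show ?thesis by simp
qed

lemma corner_measure_difference:
  assumes fin: "finite_measure (corner_measure 1)" "finite_measure (corner_measure (-1))"
    and g: "g \<in> borel_measurable borel" "\<And>p. \<bar>g p\<bar> \<le> M"
  shows "has_bochner_integral lborel (\<lambda>t. \<Sum>p\<in>pts t. c t p * g p)
    (integral\<^sup>L (corner_measure 1) g - integral\<^sup>L (corner_measure (-1)) g)"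
proof -
  have "(\<lambda>t. (\<Sum>p\<in>pts t. g p * max 0 (1 * c t p)) - (\<Sum>p\<in>pts t. g p * max 0 (-1 * c t p))) =
    (\<lambda>t. \<Sum>p\<in>pts t. c t p * g p)"
    unfolding sum_subtractf[symmetric] by (intro ext sum.cong refl) (auto simp: max_def)
  then show ?thesis
    using has_bochner_integral_diff[OF corner_measure_integral[OF fin(1) g] corner_measure_integral[OF fin(2) g]]
    by simp
qed

end

section \<open>Testing against smooth functions\<close>

text \<open>The support is enclosed in a closed rectangle so that integration by parts can be done
  one variable at a time.\<close>

locale box_test_fun =
  fixes \<phi> :: "pt \<Rightarrow> real" and \<alpha>1 \<beta>1 \<alpha>2 \<beta>2 :: real
  assumes smooth: "smooth_fun \<phi>" and order: "\<alpha>1 \<le> \<beta>1" "\<alpha>2 \<le> \<beta>2"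
    and supp: "x \<notin> {\<alpha>1..\<beta>1} \<times> {\<alpha>2..\<beta>2} \<Longrightarrow> \<phi> x = 0"
begin

definition \<psi> :: "pt \<Rightarrow> real" where "\<psi> = pd2 (pd1 \<phi>)"

lemma continuous: "continuous_on UNIV \<phi>" "continuous_on UNIV (pd1 \<phi>)" "continuous_on UNIV \<psi>"
proof -
  have *: "continuous_on UNIV (iter_pd ws \<phi>)" for ws using smooth unfolding smooth_fun_def by blast
  from *[of "[]"] *[of "[False]"] *[of "[True, False]"]
  show "continuous_on UNIV \<phi>" "continuous_on UNIV (pd1 \<phi>)" "continuous_on UNIV \<psi>"
    by (simp_all add: iter_pd_def \<psi>_def)
qed

lemma deriv1: "((\<lambda>t. \<phi> (t, y)) has_field_derivative pd1 \<phi> (x, y)) (at x)"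
proof -
  have "(\<lambda>t. iter_pd [] \<phi> (t, snd (x, y))) differentiable (at (fst (x, y)))"
    using smooth unfolding smooth_fun_def by blast
  then have "(\<lambda>t. \<phi> (t, y)) field_differentiable (at x)"
    by (simp add: iter_pd_def field_differentiable_def real_differentiable_def)
  then show ?thesis
    unfolding pd1_def by (simp add: DERIV_deriv_iff_field_differentiable)
qed

lemma deriv2: "((\<lambda>t. pd1 \<phi> (x, t)) has_field_derivative \<psi> (x, y)) (at y)"
proof -
  have "(\<lambda>t. iter_pd [False] \<phi> (fst (x, y), t)) differentiable (at (snd (x, y)))"
    using smooth unfolding smooth_fun_def by blast
  then have "(\<lambda>t. pd1 \<phi> (x, t)) field_differentiable (at y)"
    by (simp add: iter_pd_def field_differentiable_def real_differentiable_def)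
  then show ?thesis
    unfolding \<psi>_def pd2_def by (simp add: DERIV_deriv_iff_field_differentiable)
qed

lemma derivative_vanishes:
  fixes g g' :: "real \<Rightarrow> real"
  assumes "(g has_field_derivative d) (at x)" "open U" "x \<in> U" "\<And>y. y \<in> U \<Longrightarrow> g y = 0"
  shows "d = 0"
proof -
  have "(g has_field_derivative 0) (at x)"
    by (rule has_field_derivative_transform_within_open[OF DERIV_const assms(2,3)]) (simp add: assms(4))
  then show ?thesis using assms(1) by (rule DERIV_unique[rotated])
qed

text \<open>The complement of the rectangle is open along every line, so a function vanishing there
  has vanishing derivative there.\<close>

lemma supp1: "x \<notin> {\<alpha>1..\<beta>1} \<times> {\<alpha>2..\<beta>2} \<Longrightarrow> pd1 \<phi> x = 0"
proof -
  assume x: "x \<notin> {\<alpha>1..\<beta>1} \<times> {\<alpha>2..\<beta>2}"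
  obtain s t where st: "x = (s, t)" by fastforce
  define U where "U = {r. (r, t) \<notin> {\<alpha>1..\<beta>1} \<times> {\<alpha>2..\<beta>2}}"
  have "U = (if t \<in> {\<alpha>2..\<beta>2} then - {\<alpha>1..\<beta>1} else UNIV)" unfolding U_def by auto
  then have "open U" by (auto intro: open_Compl)
  then show "pd1 \<phi> x = 0"
    unfolding st using x st by (intro derivative_vanishes[OF deriv1, of U]) (auto simp: U_def intro: supp)
qed

lemma supp2: "x \<notin> {\<alpha>1..\<beta>1} \<times> {\<alpha>2..\<beta>2} \<Longrightarrow> \<psi> x = 0"
proof -
  assume x: "x \<notin> {\<alpha>1..\<beta>1} \<times> {\<alpha>2..\<beta>2}"
  obtain s t where st: "x = (s, t)" by fastforce
  define U where "U = {r. (s, r) \<notin> {\<alpha>1..\<beta>1} \<times> {\<alpha>2..\<beta>2}}"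
  have "U = (if s \<in> {\<alpha>1..\<beta>1} then - {\<alpha>2..\<beta>2} else UNIV)" unfolding U_def by auto
  then have "open U" by (auto intro: open_Compl)
  then show "\<psi> x = 0"
    unfolding st using x st by (intro derivative_vanishes[OF deriv2, of U]) (auto simp: U_def intro: supp1)
qed

lemma slice_continuous: "continuous_on S (\<lambda>t. \<psi> (x, t))" "continuous_on S (\<lambda>t. \<psi> (t, x))"
    "continuous_on S (\<lambda>t. pd1 \<phi> (t, x))"
  by (rule continuous_on_compose2[OF continuous(3)] continuous_on_compose2[OF continuous(2)],
      (intro continuous_intros)?, simp?)+

lemma integral_psi_right: "(\<integral>s. \<psi> (x, s) * of_bool (y < s) \<partial>lborel) = - pd1 \<phi> (x, y)"
proof -
  define B where "B = max y \<beta>2 + 1"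
  have B: "y \<le> B" "\<beta>2 < B" by (auto simp: B_def)
  have "(\<integral>s. \<psi> (x, s) * indicator {y..B} s \<partial>lborel) = pd1 \<phi> (x, B) - pd1 \<phi> (x, y)"
    by (rule integral_FTC_Icc_real)
      (use slice_continuous(1)[of UNIV x] deriv2 in \<open>auto simp: B_def continuous_on_eq_continuous_at\<close>)
  also have "pd1 \<phi> (x, B) = 0" by (rule supp1) (use B in simp)
  also have "(\<integral>s. \<psi> (x, s) * indicator {y..B} s \<partial>lborel) = (\<integral>s. \<psi> (x, s) * of_bool (y < s) \<partial>lborel)"
  proof (rule integral_cong_AE)
    have m: "(\<lambda>s. \<psi> (x, s)) \<in> borel_measurable borel"
      by (rule borel_measurable_continuous_onI[OF slice_continuous(1)])
    show "(\<lambda>s. \<psi> (x, s) * indicator {y..B} s) \<in> borel_measurable lborel"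
      "(\<lambda>s. \<psi> (x, s) * of_bool (y < s)) \<in> borel_measurable lborel" using m by simp_all
    show "AE s in lborel. \<psi> (x, s) * indicator {y..B} s = \<psi> (x, s) * of_bool (y < s)"
      using AE_lborel_singleton[of y]
    proof eventually_elim
      case (elim s)
      have "\<psi> (x, s) = 0" if "B < s" by (rule supp2) (use that B in auto)
      then show ?case using elim by (auto simp: indicator_def)
    qed
  qed
  finally show ?thesis by simp
qed

lemma integral_psi2: "(\<integral>s. \<psi> (x, s) \<partial>lborel) = 0"
proof -
  have "(\<integral>s. \<psi> (x, s) \<partial>lborel) = (\<integral>s. \<psi> (x, s) * of_bool (\<alpha>2 - 1 < s) \<partial>lborel)"
    by (intro Bochner_Integration.integral_cong refl) (auto intro!: supp2)
  also have "\<dots> = - pd1 \<phi> (x, \<alpha>2 - 1)" by (rule integral_psi_right)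
  also have "\<dots> = 0" by (simp add: supp1)
  finally show ?thesis .
qed

lemma integral_pd1_right: "(\<integral>s. pd1 \<phi> (s, y) * of_bool (x < s) \<partial>lborel) = - \<phi> (x, y)"
proof -
  define B where "B = max x \<beta>1 + 1"
  have B: "x \<le> B" "\<beta>1 < B" by (auto simp: B_def)
  have "(\<integral>s. pd1 \<phi> (s, y) * indicator {x..B} s \<partial>lborel) = \<phi> (B, y) - \<phi> (x, y)"
    by (rule integral_FTC_Icc_real)
      (use slice_continuous(3)[of UNIV y] deriv1 in \<open>auto simp: B_def continuous_on_eq_continuous_at\<close>)
  also have "\<phi> (B, y) = 0" by (rule supp) (use B in simp)
  also have "(\<integral>s. pd1 \<phi> (s, y) * indicator {x..B} s \<partial>lborel) = (\<integral>s. pd1 \<phi> (s, y) * of_bool (x < s) \<partial>lborel)"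
  proof (rule integral_cong_AE)
    have m: "(\<lambda>s. pd1 \<phi> (s, y)) \<in> borel_measurable borel"
      by (rule borel_measurable_continuous_onI[OF slice_continuous(3)])
    show "(\<lambda>s. pd1 \<phi> (s, y) * indicator {x..B} s) \<in> borel_measurable lborel"
      "(\<lambda>s. pd1 \<phi> (s, y) * of_bool (x < s)) \<in> borel_measurable lborel" using m by simp_all
    show "AE s in lborel. pd1 \<phi> (s, y) * indicator {x..B} s = pd1 \<phi> (s, y) * of_bool (x < s)"
      using AE_lborel_singleton[of x]
    proof eventually_elim
      case (elim s)
      have "pd1 \<phi> (s, y) = 0" if "B < s" by (rule supp1) (use that B in auto)
      then show ?case using elim by (auto simp: indicator_def)
    qed
  qed
  finally show ?thesis by simp
qed

text \<open>The function \<psi> is a derivative in the second variable, so the fundamental theorem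
  does not apply directly in the first. Instead, the integral of \<open>pd1 \<phi>\<close> over the
  first variable vanishes for every second coordinate, and differentiating under the integral avoids
  interchanging partial derivatives.\<close>

lemma integral_psi1: "(\<integral>s. \<psi> (s, y) \<partial>lborel) = 0"
proof -
  have zero: "integral (cbox \<alpha>1 \<beta>1) (\<lambda>s. pd1 \<phi> (s, t)) = 0" for t
  proof -
    \<comment> \<open>The interval is enlarged by 1 on each side so that \<phi> vanishes at both
      ends.\<close>
    have "((\<lambda>s. pd1 \<phi> (s, t)) has_integral \<phi> (\<beta>1 + 1, t) - \<phi> (\<alpha>1 - 1, t)) {\<alpha>1 - 1..\<beta>1 + 1}"
      by (rule fundamental_theorem_of_calculus)
        (use order in \<open>auto intro: has_field_derivative_at_within[OF deriv1, unfolded has_real_derivative_iff_has_vector_derivative]\<close>)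
    then have "((\<lambda>s. pd1 \<phi> (s, t)) has_integral 0) {\<alpha>1 - 1..\<beta>1 + 1}" by (simp add: supp)
    then have "((\<lambda>s. if s \<in> {\<alpha>1..\<beta>1} then pd1 \<phi> (s, t) else 0) has_integral 0) {\<alpha>1 - 1..\<beta>1 + 1}"
      by (rule has_integral_eq[rotated]) (auto intro!: supp1)
    then have "((\<lambda>s. pd1 \<phi> (s, t)) has_integral 0) {\<alpha>1..\<beta>1}"
      by (subst (asm) has_integral_restrict) auto
    then show ?thesis by (simp add: integral_unique)
  qed
  have "((\<lambda>t. integral (cbox \<alpha>1 \<beta>1) (\<lambda>s. pd1 \<phi> (s, t))) has_field_derivative
      integral (cbox \<alpha>1 \<beta>1) (\<lambda>s. \<psi> (s, y))) (at y within UNIV)"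
  proof (rule leibniz_rule_field_derivative)
    show "((\<lambda>t. pd1 \<phi> (s, t)) has_field_derivative \<psi> (s, t)) (at t within UNIV)" for s t
      using deriv2 by simp
    show "(\<lambda>s. pd1 \<phi> (s, t)) integrable_on cbox \<alpha>1 \<beta>1" for t
      by (rule integrable_continuous[OF slice_continuous(3)])
    show "continuous_on (UNIV \<times> cbox \<alpha>1 \<beta>1) (\<lambda>(t, s). \<psi> (s, t))"
      unfolding case_prod_beta' by (rule continuous_on_compose2[OF continuous(3)]) (auto intro!: continuous_intros)
  qed auto
  then have "((\<lambda>t. 0) has_field_derivative integral (cbox \<alpha>1 \<beta>1) (\<lambda>s. \<psi> (s, y))) (at y)"
    unfolding zero by simp
  then have int0: "integral (cbox \<alpha>1 \<beta>1) (\<lambda>s. \<psi> (s, y)) = 0"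
    using DERIV_const DERIV_unique by blast
  have eq: "(\<lambda>s. indicator {\<alpha>1..\<beta>1} s *\<^sub>R \<psi> (s, y)) = (\<lambda>s. \<psi> (s, y))"
  proof
    fix s
    show "indicator {\<alpha>1..\<beta>1} s *\<^sub>R \<psi> (s, y) = \<psi> (s, y)"
      using supp2[of "(s, y)"] by (cases "s \<in> {\<alpha>1..\<beta>1}") auto
  qed
  have "integrable lborel (\<lambda>s. indicator {\<alpha>1..\<beta>1} s *\<^sub>R \<psi> (s, y))"
    by (rule borel_integrable_compact) (auto intro: slice_continuous)
  then have "set_integrable lborel {\<alpha>1..\<beta>1} (\<lambda>s. \<psi> (s, y))" unfolding set_integrable_def .
  then have "(LINT s:{\<alpha>1..\<beta>1}|lborel. \<psi> (s, y)) = integral {\<alpha>1..\<beta>1} (\<lambda>s. \<psi> (s, y))"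
    by (rule set_borel_integral_eq_integral)
  then show ?thesis using int0 unfolding set_lebesgue_integral_def eq by simp
qed

lemma psi_integrable: "integrable lborel \<psi>"
proof -
  have "integrable lborel (\<lambda>x. indicator ({\<alpha>1..\<beta>1} \<times> {\<alpha>2..\<beta>2}) x *\<^sub>R \<psi> x)"
    by (intro borel_integrable_compact compact_Times compact_Icc continuous_on_subset[OF continuous(3)]) auto
  also have "(\<lambda>x. indicator ({\<alpha>1..\<beta>1} \<times> {\<alpha>2..\<beta>2}) x *\<^sub>R \<psi> x) = \<psi>"
  proof
    fix x
    show "indicator ({\<alpha>1..\<beta>1} \<times> {\<alpha>2..\<beta>2}) x *\<^sub>R \<psi> x = \<psi> x"
      using supp2[of x] by (cases "x \<in> {\<alpha>1..\<beta>1} \<times> {\<alpha>2..\<beta>2}") simp_all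
  qed
  finally show ?thesis .
qed

lemma psi_mult_integrable:
  assumes "g \<in> borel_measurable borel" "\<And>x. \<bar>g x\<bar> \<le> M"
  shows "integrable lborel (\<lambda>x. g x * \<psi> x)"
proof (rule Bochner_Integration.integrable_bound)
  show "integrable lborel (\<lambda>x. M * \<psi> x)" using psi_integrable by simp
  show "(\<lambda>x. g x * \<psi> x) \<in> borel_measurable lborel"
    using assms(1) borel_measurable_continuous_onI[OF continuous(3)] by simp
  show "AE x in lborel. norm (g x * \<psi> x) \<le> norm (M * \<psi> x)"
  proof (rule AE_I2)
    fix x
    have "\<bar>g x\<bar> \<le> \<bar>M\<bar>" using assms(2)[of x] by linarith
    then show "norm (g x * \<psi> x) \<le> norm (M * \<psi> x)" by (simp add: abs_mult mult_right_mono)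
  qed
qed

lemma bounded:
  fixes f :: "pt \<Rightarrow> real"
  assumes f: "continuous_on UNIV f" "\<And>x. x \<notin> {\<alpha>1..\<beta>1} \<times> {\<alpha>2..\<beta>2} \<Longrightarrow> f x = 0"
  obtains M where "\<And>x. \<bar>f x\<bar> \<le> M"
proof -
  have "compact (f ` ({\<alpha>1..\<beta>1} \<times> {\<alpha>2..\<beta>2}))"
    by (intro compact_continuous_image continuous_on_subset[OF f(1)] compact_Times compact_Icc) auto
  from compact_imp_bounded[OF this] obtain M where M: "\<And>x. x \<in> {\<alpha>1..\<beta>1} \<times> {\<alpha>2..\<beta>2} \<Longrightarrow> \<bar>f x\<bar> \<le> M"
    unfolding bounded_iff by auto
  have "\<bar>f x\<bar> \<le> max M 0" for x
    using M[of x] f(2)[of x] by (cases "x \<in> {\<alpha>1..\<beta>1} \<times> {\<alpha>2..\<beta>2}") (auto simp: le_max_iff_disj)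
  then show thesis by (rule that)
qed

end

lemma test_fun_box:
  assumes "test_fun ({a1<..<b1} \<times> {a2<..<b2}) \<phi>" "a1 < b1" "a2 < b2"
  obtains \<alpha>1 \<beta>1 \<alpha>2 \<beta>2 where "a1 < \<alpha>1" "\<beta>1 < b1" "a2 < \<alpha>2" "\<beta>2 < (b2::real)" "box_test_fun \<phi> \<alpha>1 \<beta>1 \<alpha>2 \<beta>2"
proof -
  \<comment> \<open>Adding the centre of the box keeps \<open>K\<close> nonempty even when \<phi> is
    zero.\<close>
  define K where "K = insert ((a1 + b1) / 2, (a2 + b2) / 2) (closure {x. \<phi> x \<noteq> 0})"
  have K: "compact K" "K \<noteq> {}" "K \<subseteq> {a1<..<b1} \<times> {a2<..<b2}"
    using assms unfolding K_def test_fun_def by (auto intro: compact_insert)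
  have ext: "\<exists>l\<in>f ` K. \<exists>r\<in>f ` K. \<forall>x\<in>K. l \<le> f x \<and> f x \<le> r" if "continuous_on K f" for f :: "pt \<Rightarrow> real"
    using compact_attains_inf[OF compact_continuous_image[OF that K(1)]] compact_attains_sup[OF compact_continuous_image[OF that K(1)]] K(2)
    by blast
  obtain l1 r1 where 1: "l1 \<in> fst ` K" "r1 \<in> fst ` K" "\<And>x. x \<in> K \<Longrightarrow> l1 \<le> fst x \<and> fst x \<le> r1"
    using ext[OF continuous_on_fst[OF continuous_on_id]] by (auto simp only:)
  obtain l2 r2 where 2: "l2 \<in> snd ` K" "r2 \<in> snd ` K" "\<And>x. x \<in> K \<Longrightarrow> l2 \<le> snd x \<and> snd x \<le> r2"
    using ext[OF continuous_on_snd[OF continuous_on_id]] by (auto simp only:)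
  show thesis
  proof (rule that)
    show "a1 < l1" "r1 < b1" "a2 < l2" "r2 < b2" using 1(1,2) 2(1,2) K(3) by auto
    show "box_test_fun \<phi> l1 r1 l2 r2"
    proof
      show "smooth_fun \<phi>" using assms(1) unfolding test_fun_def by blast
      show "l1 \<le> r1" "l2 \<le> r2" using K(2) 1(3) 2(3) by (meson ex_in_conv order_trans)+
      fix x assume x: "x \<notin> {l1..r1} \<times> {l2..r2}"
      show "\<phi> x = 0"
      proof (rule ccontr)
        assume "\<phi> x \<noteq> 0"
        then have "x \<in> K" unfolding K_def using closure_subset[of "{x. \<phi> x \<noteq> 0}"] by auto
        then show False using x 1(3)[of x] 2(3)[of x] by (auto simp: mem_Times_iff)
      qed
    qed
  qed
qed

lemma AE_lborel_coordinate:
  assumes "AE y in (lborel :: real measure). P y"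
  shows "AE x in (lborel :: pt measure). P (fst x)" "AE x in (lborel :: pt measure). P (snd x)"
proof -
  obtain N where N: "{y. \<not> P y} \<subseteq> N" "N \<in> null_sets lborel"
    using assms by (auto simp: eventually_ae_filter)
  have N': "N \<in> sets lborel" "emeasure lborel N = 0" using N(2) by auto
  have "N \<times> UNIV \<in> null_sets (lborel \<Otimes>\<^sub>M lborel)" "UNIV \<times> N \<in> null_sets (lborel \<Otimes>\<^sub>M lborel)"
    using N' by (auto intro!: null_setsI simp: lborel.emeasure_pair_measure_Times)
  then have null: "N \<times> UNIV \<in> null_sets (lborel :: pt measure)" "UNIV \<times> N \<in> null_sets (lborel :: pt measure)"
    by (simp_all add: lborel_prod)
  show "AE x in (lborel :: pt measure). P (fst x)"
    by (rule AE_I'[OF null(1)]) (use N(1) in \<open>auto simp: mem_Times_iff\<close>)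
  show "AE x in (lborel :: pt measure). P (snd x)"
    by (rule AE_I'[OF null(2)]) (use N(1) in \<open>auto simp: mem_Times_iff\<close>)
qed

lemma AE_lborel_slices:
  assumes "AE x in (lborel :: pt measure). P x"
  shows "AE s in lborel. AE t in lborel. P (s, t)" "AE t in lborel. AE s in lborel. P (s, t)"
proof -
  obtain N where N: "{x. \<not> P x} \<subseteq> N" "N \<in> null_sets (lborel :: pt measure)"
    using assms by (auto simp: eventually_ae_filter)
  have "AE x in lborel \<Otimes>\<^sub>M lborel. x \<notin> N"
    using N(2) by (intro AE_not_in) (simp add: lborel_prod)
  then have 1: "AE s in lborel. AE t in lborel. (s, t) \<notin> N" by (rule lborel_pair.AE_pair)
  have "N \<in> sets (lborel \<Otimes>\<^sub>M lborel)" unfolding lborel_prod using N(2) by auto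
  then have "{x \<in> space (lborel \<Otimes>\<^sub>M lborel). (fst x, snd x) \<notin> N} \<in> sets (lborel \<Otimes>\<^sub>M lborel)"
    using sets.compl_sets[of N "lborel \<Otimes>\<^sub>M lborel"] by (simp add: set_diff_eq)
  from lborel_pair.AE_commute[OF this] 1 have 2: "AE t in lborel. AE s in lborel. (s, t) \<notin> N" by simp
  have good: "P x" if "x \<notin> N" for x using N(1) that by blast
  show "AE s in lborel. AE t in lborel. P (s, t)"
    using 1 by eventually_elim (erule eventually_mono, rule good)
  show "AE t in lborel. AE s in lborel. P (s, t)"
    using 2 by eventually_elim (erule eventually_mono, rule good)
qed

lemma lborel_integral_iterated:
  fixes f :: "pt \<Rightarrow> real"
  assumes "integrable lborel f"
  shows "integral\<^sup>L lborel f = (\<integral>s. (\<integral>t. f (s, t) \<partial>lborel) \<partial>lborel)"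
    and "integral\<^sup>L lborel f = (\<integral>t. (\<integral>s. f (s, t) \<partial>lborel) \<partial>lborel)"
proof -
  have f: "integrable (lborel \<Otimes>\<^sub>M lborel) f" using assms by (simp add: lborel_prod)
  show "integral\<^sup>L lborel f = (\<integral>s. (\<integral>t. f (s, t) \<partial>lborel) \<partial>lborel)"
    using lborel_pair.integral_fst'[OF f] by (simp add: lborel_prod)
  have "integrable (lborel \<Otimes>\<^sub>M lborel) (case_prod (\<lambda>s t. f (s, t)))" using f by simp
  from lborel_pair.integral_snd[OF this]
  show "integral\<^sup>L lborel f = (\<integral>t. (\<integral>s. f (s, t) \<partial>lborel) \<partial>lborel)"
    by (simp add: lborel_prod)
qed

context box_test_fun
begin

text \<open>A mixed derivative annihilates functions of one variable: the integral over the other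
  variable already vanishes.\<close>

lemma integral_mult_psi_fst:
  assumes g: "g \<in> borel_measurable borel" "\<And>s. \<bar>g s\<bar> \<le> M"
  shows "integrable lborel (\<lambda>x. g (fst x) * \<psi> x)" "(\<integral>x. g (fst x) * \<psi> x \<partial>lborel) = 0"
proof -
  have "(\<lambda>x::pt. g (fst x)) \<in> borel_measurable borel"
    by (rule measurable_compose[OF _ g(1)]) (intro borel_measurable_continuous_onI continuous_intros)
  then show int: "integrable lborel (\<lambda>x. g (fst x) * \<psi> x)" by (rule psi_mult_integrable) (rule g(2))
  show "(\<integral>x. g (fst x) * \<psi> x \<partial>lborel) = 0"
    unfolding lborel_integral_iterated(1)[OF int] by (simp add: integral_psi2)
qed

lemma integral_mult_psi_snd:
  assumes g: "g \<in> borel_measurable borel" "\<And>s. \<bar>g s\<bar> \<le> M"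
  shows "integrable lborel (\<lambda>x. g (snd x) * \<psi> x)" "(\<integral>x. g (snd x) * \<psi> x \<partial>lborel) = 0"
proof -
  have "(\<lambda>x::pt. g (snd x)) \<in> borel_measurable borel"
    by (rule measurable_compose[OF _ g(1)]) (intro borel_measurable_continuous_onI continuous_intros)
  then show int: "integrable lborel (\<lambda>x. g (snd x) * \<psi> x)" by (rule psi_mult_integrable) (rule g(2))
  show "(\<integral>x. g (snd x) * \<psi> x \<partial>lborel) = 0"
    unfolding lborel_integral_iterated(2)[OF int] by (simp add: integral_psi1)
qed

text \<open>The indicator of a quadrant is the fundamental solution of the mixed derivative; the two
  signs from integrating in each variable cancel.\<close>

lemma integral_quadrant_psi:
  shows "integrable lborel (\<lambda>x. of_bool (fst p < fst x \<and> snd p < snd x) * \<psi> x)"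
    and "(\<integral>x. of_bool (fst p < fst x \<and> snd p < snd x) * \<psi> x \<partial>lborel) = \<phi> p"
proof -
  have "{x::pt. fst p < fst x \<and> snd p < snd x} \<in> sets borel"
    by (intro borel_open open_Collect_conj open_Collect_less continuous_intros)
  then have "(\<lambda>x::pt. indicator {x. fst p < fst x \<and> snd p < snd x} x :: real) \<in> borel_measurable borel"
    by (rule borel_measurable_indicator)
  then have "(\<lambda>x::pt. of_bool (fst p < fst x \<and> snd p < snd x) :: real) \<in> borel_measurable borel"
    by (simp add: indicator_def of_bool_def)
  then show int: "integrable lborel (\<lambda>x. of_bool (fst p < fst x \<and> snd p < snd x) * \<psi> x)"
    by (rule psi_mult_integrable[where M = 1]) simp
  have "(\<integral>x. of_bool (fst p < fst x \<and> snd p < snd x) * \<psi> x \<partial>lborel) =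
      (\<integral>s. (\<integral>t. of_bool (fst p < s) * (\<psi> (s, t) * of_bool (snd p < t)) \<partial>lborel) \<partial>lborel)"
    unfolding lborel_integral_iterated(1)[OF int]
    by (intro Bochner_Integration.integral_cong refl) auto
  also have "\<dots> = (\<integral>s. of_bool (fst p < s) * - pd1 \<phi> (s, snd p) \<partial>lborel)"
    by (simp only: integral_mult_right_zero integral_psi_right)
  also have "\<dots> = (\<integral>s. - (pd1 \<phi> (s, snd p) * of_bool (fst p < s)) \<partial>lborel)"
    by (intro Bochner_Integration.integral_cong refl) (simp add: mult.commute)
  also have "\<dots> = \<phi> p" by (simp add: integral_pd1_right)
  finally show "(\<integral>x. of_bool (fst p < fst x \<and> snd p < snd x) * \<psi> x \<partial>lborel) = \<phi> p" .
qed

text \<open>Rectangles anchored at a point to the left of and below the support express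
  \<open>w\<close> there as functions of one variable plus quadrant indicators with weights
  \<open>c\<close>. The former integrate to zero and the latter evaluate \<phi> at the
  corners.\<close>

lemma corner_data_integral:
  assumes cd: "corner_data Q w P c F" and w: "w \<in> borel_measurable borel" "\<And>x. \<bar>w x\<bar> \<le> 1"
    and ae: "AE x in lborel. x \<in> {a1<..<b1} \<times> {a2<..<b2} \<longrightarrow> x \<in> Q"
    and box: "a1 < \<alpha>1" "\<beta>1 < b1" "a2 < \<alpha>2" "\<beta>2 < b2"
  shows "(\<integral>x. w x * \<psi> x \<partial>lborel) = (\<Sum>p\<in>P. c p * \<phi> p)"
proof -
  let ?\<Omega> = "{a1<..<b1} \<times> {a2<..<b2}"
  have fin: "finite P" "finite F" using cd unfolding corner_data_def by auto
  have mixed: "mixed w a b e f = (\<Sum>p\<in>{p\<in>P. a < fst p \<and> fst p < b \<and> e < snd p \<and> snd p < f}. c p)"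
    if "a < b" "e < f" "{a, b, e, f} \<inter> F = {}" "{a, b} \<times> {e, f} \<subseteq> Q" for a b e f
    using cd that unfolding corner_data_def by blast
  have F: "AE s in lborel. s \<notin> F"
    using fin(2) by (intro AE_not_in finite_imp_null_set_lborel)
  note slices = AE_lborel_slices[OF ae]
  \<comment> \<open>The coordinates of the anchor must avoid \<open>F\<close>, and both lines
    through it must lie in \<open>Q\<close> almost everywhere within the box. Fubini selects the
    abscissa first and then the ordinate, which also puts the anchor itself into
    \<open>Q\<close>.\<close>
  have "AE s in lborel. s \<notin> F \<and> (AE t in lborel. (s, t) \<in> ?\<Omega> \<longrightarrow> (s, t) \<in> Q)"
    using F slices(1) by eventually_elim simp
  from AE_lborel_dense[OF this box(1)] obtain r1 where r1: "a1 < r1" "r1 < \<alpha>1" "r1 \<notin> F"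
    "AE t in lborel. (r1, t) \<in> ?\<Omega> \<longrightarrow> (r1, t) \<in> Q" by blast
  have "AE t in lborel. t \<notin> F \<and> ((r1, t) \<in> ?\<Omega> \<longrightarrow> (r1, t) \<in> Q) \<and> (AE s in lborel. (s, t) \<in> ?\<Omega> \<longrightarrow> (s, t) \<in> Q)"
    using F r1(4) slices(2) by eventually_elim simp
  from AE_lborel_dense[OF this box(3)] obtain r2 where r2: "a2 < r2" "r2 < \<alpha>2" "r2 \<notin> F"
    "(r1, r2) \<in> ?\<Omega> \<longrightarrow> (r1, r2) \<in> Q" "AE s in lborel. (s, r2) \<in> ?\<Omega> \<longrightarrow> (s, r2) \<in> Q" by blast
  define P' where "P' = {p\<in>P. r1 < fst p \<and> r2 < snd p}"
  let ?q = "\<lambda>p x. of_bool (fst p < fst x \<and> snd p < snd x) :: real"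
  define rhs where "rhs x = w (r1, snd x) * \<psi> x + w (fst x, r2) * \<psi> x - w (r1, r2) * \<psi> x + (\<Sum>p\<in>P'. c p * (?q p x * \<psi> x))" for x
  have w1: "(\<lambda>t. w (r1, t)) \<in> borel_measurable borel" "(\<lambda>s. w (s, r2)) \<in> borel_measurable borel"
    by (rule measurable_compose[OF _ w(1)], intro borel_measurable_continuous_onI continuous_intros)+
  note i1 = integral_mult_psi_snd[OF w1(1) w(2)] and i2 = integral_mult_psi_fst[OF w1(2) w(2)]
  have i3: "integrable lborel (\<lambda>x. w (r1, r2) * \<psi> x)" "(\<integral>x. w (r1, r2) * \<psi> x \<partial>lborel) = 0"
    using integral_mult_psi_fst[of "\<lambda>_. w (r1, r2)" "\<bar>w (r1, r2)\<bar>"] by auto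
  have i4: "integrable lborel (\<lambda>x. \<Sum>p\<in>P'. c p * (?q p x * \<psi> x))"
    by (intro Bochner_Integration.integrable_sum integrable_mult_right integral_quadrant_psi(1))
  have "(\<integral>x. w x * \<psi> x \<partial>lborel) = (\<integral>x. rhs x \<partial>lborel)"
  proof (rule integral_cong_AE)
    show "(\<lambda>x. w x * \<psi> x) \<in> borel_measurable lborel"
      using psi_mult_integrable[OF w] by (rule borel_measurable_integrable)
    show "rhs \<in> borel_measurable lborel"
      unfolding rhs_def[abs_def]
      by (intro borel_measurable_add borel_measurable_diff borel_measurable_integrable i1(1) i2(1) i3(1) i4)
    show "AE x in lborel. w x * \<psi> x = rhs x"
      using ae AE_lborel_coordinate(1)[OF F] AE_lborel_coordinate(2)[OF F]
        AE_lborel_coordinate(2)[OF r1(4)] AE_lborel_coordinate(1)[OF r2(5)]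
    proof eventually_elim
      case (elim x)
      show "w x * \<psi> x = rhs x"
      proof (cases "x \<in> {\<alpha>1..\<beta>1} \<times> {\<alpha>2..\<beta>2}")
        case False
        then show ?thesis unfolding rhs_def by (simp add: supp2)
      next
        case True
        then have x: "r1 < fst x" "r2 < snd x" "fst x < b1" "snd x < b2" "a1 < fst x" "a2 < snd x"
          using box r1 r2 by auto
        have "{r1, fst x} \<times> {r2, snd x} \<subseteq> Q"
          using elim x r1 r2 by (cases x) auto
        moreover have "{r1, fst x, r2, snd x} \<inter> F = {}" using elim r1 r2 by auto
        ultimately have "mixed w r1 (fst x) r2 (snd x) =
            (\<Sum>p\<in>{p\<in>P. r1 < fst p \<and> fst p < fst x \<and> r2 < snd p \<and> snd p < snd x}. c p)"
          using x by (intro mixed)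
        also have "\<dots> = (\<Sum>p\<in>P'. c p * ?q p x)"
          by (rule sum.mono_neutral_cong_left) (use fin in \<open>auto simp: P'_def\<close>)
        finally have "w x = w (r1, snd x) + w (fst x, r2) - w (r1, r2) + (\<Sum>p\<in>P'. c p * ?q p x)"
          unfolding mixed_def by simp
        moreover have "rhs x = (w (r1, snd x) + w (fst x, r2) - w (r1, r2) + (\<Sum>p\<in>P'. c p * ?q p x)) * \<psi> x"
          unfolding rhs_def by (simp add: distrib_right left_diff_distrib sum_distrib_right mult.assoc)
        ultimately show ?thesis by simp
      qed
    qed
  qed
  also have "\<dots> = 0 + 0 - 0 + (\<integral>x. (\<Sum>p\<in>P'. c p * (?q p x * \<psi> x)) \<partial>lborel)"
    unfolding rhs_def using i1 i2 i3 i4 by simp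
  also have "(\<integral>x. (\<Sum>p\<in>P'. c p * (?q p x * \<psi> x)) \<partial>lborel) = (\<Sum>p\<in>P'. \<integral>x. c p * (?q p x * \<psi> x) \<partial>lborel)"
    by (intro Bochner_Integration.integral_sum integrable_mult_right integral_quadrant_psi(1))
  also have "\<dots> = (\<Sum>p\<in>P'. c p * \<phi> p)"
    by (simp only: integral_mult_right_zero integral_quadrant_psi(2))
  \<comment> \<open>Corners not strictly to the right of and above the anchor lie outside the
    support of \<phi> and contribute nothing.\<close>
  also have "\<dots> = (\<Sum>p\<in>P. c p * \<phi> p)"
  proof (rule sum.mono_neutral_left[OF fin(1)])
    show "\<forall>p\<in>P - P'. c p * \<phi> p = 0"
    proof
      fix p assume "p \<in> P - P'"
      then have "p \<notin> {\<alpha>1..\<beta>1} \<times> {\<alpha>2..\<beta>2}" using r1 r2 unfolding P'_def by (auto simp: mem_Times_iff)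
      then show "c p * \<phi> p = 0" by (simp add: supp)
    qed
  qed (auto simp: P'_def)
  finally show ?thesis by simp
qed

end

text \<open>Subtracting the reference layer \<open>t < 0\<close> makes the decomposition of a signed
  number integrable over all levels.\<close>

lemma integral_layer:
  fixes a :: real
  shows "integrable lborel (\<lambda>t. of_bool (t < a) - of_bool (t < 0) :: real)"
    and "(\<integral>t. of_bool (t < a) - of_bool (t < 0) \<partial>lborel) = a"
    and "(\<integral>t. \<bar>of_bool (t < a) - of_bool (t < 0)\<bar> \<partial>lborel) = \<bar>a\<bar>"
proof -
  have *: "has_bochner_integral lborel (\<lambda>t. of_bool (t < a) - of_bool (t < 0) :: real) a \<and>
      has_bochner_integral lborel (\<lambda>t. \<bar>of_bool (t < a) - of_bool (t < 0)\<bar> :: real) \<bar>a\<bar>"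
  proof (cases "0 \<le> a")
    case True
    have "(\<lambda>t. of_bool (t < a) - of_bool (t < 0) :: real) = indicator {0..<a}"
      "(\<lambda>t. \<bar>of_bool (t < a) - of_bool (t < 0)\<bar> :: real) = indicator {0..<a}"
      using True by (auto simp: fun_eq_iff indicator_def)
    moreover have "has_bochner_integral lborel (indicator {0..<a} :: real \<Rightarrow> real) a"
      using has_bochner_integral_real_indicator[of "{0..<a}" lborel] True by simp
    ultimately show ?thesis using True by simp
  next
    case False
    have "(\<lambda>t. of_bool (t < a) - of_bool (t < 0) :: real) = (\<lambda>t. - indicator {a..<0} t)"
      "(\<lambda>t. \<bar>of_bool (t < a) - of_bool (t < 0)\<bar> :: real) = indicator {a..<0}"
      using False by (auto simp: fun_eq_iff indicator_def)
    moreover have "has_bochner_integral lborel (indicator {a..<0} :: real \<Rightarrow> real) (- a)"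
      using has_bochner_integral_real_indicator[of "{a..<0}" lborel] False by simp
    ultimately show ?thesis using has_bochner_integral_minus[of lborel "indicator {a..<0}" "- a"] False by simp
  qed
  then show "integrable lborel (\<lambda>t. of_bool (t < a) - of_bool (t < 0) :: real)"
    "(\<integral>t. of_bool (t < a) - of_bool (t < 0) \<partial>lborel) = a"
    "(\<integral>t. \<bar>of_bool (t < a) - of_bool (t < 0)\<bar> \<partial>lborel) = \<bar>a\<bar>"
    by (auto simp: has_bochner_integral_iff)
qed

text \<open>For each \<open>x\<close> the only bad level is \<open>v x\<close>; Fubini exchanges the
  two almost everywhere statements.\<close>

lemma AE_level_null:
  fixes v :: "pt \<Rightarrow> real"
  assumes [measurable]: "v \<in> borel_measurable borel"
  shows "AE t in lborel. AE x in lborel. v x \<noteq> t"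
proof -
  have "{x \<in> space (lborel \<Otimes>\<^sub>M lborel). v (fst x) \<noteq> snd x} \<in> sets (lborel \<Otimes>\<^sub>M lborel)"
    by measurable
  moreover have "AE x in lborel. AE t in lborel. v x \<noteq> t"
  proof (rule AE_I2)
    fix x
    show "AE t in lborel. v x \<noteq> t" using AE_lborel_singleton[of "v x"] by eventually_elim simp
  qed
  ultimately show ?thesis using lborel_pair.AE_commute[of "\<lambda>x t. v x \<noteq> t"] by simp
qed

context box_test_fun
begin

text \<open>The reference layer that makes Fubini applicable does not depend on \<open>x\<close>, so
  it disappears because \<psi> has integral zero.\<close>

lemma layer_cake:
  assumes [measurable]: "v \<in> borel_measurable borel" and int: "integrable lborel (\<lambda>x. v x * \<psi> x)"
    and "AE t in lborel. (\<integral>x. lev v t x * \<psi> x \<partial>lborel) = S t"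
    and [measurable]: "S \<in> borel_measurable borel"
  shows "(\<integral>x. v x * \<psi> x \<partial>lborel) = (\<integral>t. S t \<partial>lborel)"
proof -
  define z where "z x t = (of_bool (t < v x) - of_bool (t < 0)) * \<psi> x" for x and t :: real
  have [measurable]: "\<psi> \<in> borel_measurable borel" by (rule borel_measurable_continuous_onI[OF continuous(3)])
  have "integrable (lborel \<Otimes>\<^sub>M lborel) (case_prod z)"
  proof (rule lborel_pair.Fubini_integrable)
    show "case_prod z \<in> borel_measurable (lborel \<Otimes>\<^sub>M lborel)"
      unfolding z_def by measurable
    have "(\<integral>t. norm (case_prod z (x, t)) \<partial>lborel) = norm (v x * \<psi> x)" for x
      unfolding z_def by (simp add: abs_mult integral_layer)
    then show "integrable lborel (\<lambda>x. \<integral>t. norm (case_prod z (x, t)) \<partial>lborel)"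
      using integrable_norm[OF int] by simp
    show "AE x in lborel. integrable lborel (\<lambda>t. case_prod z (x, t))"
      by (intro AE_I2) (simp add: z_def integral_layer)
  qed
  from lborel_pair.Fubini_integral[OF this]
  have "(\<integral>t. (\<integral>x. z x t \<partial>lborel) \<partial>lborel) = (\<integral>x. (\<integral>t. z x t \<partial>lborel) \<partial>lborel)" .
  moreover have "(\<integral>t. z x t \<partial>lborel) = v x * \<psi> x" for x
    unfolding z_def by (simp add: integral_layer)
  moreover have "(\<integral>x. z x t \<partial>lborel) = (\<integral>x. lev v t x * \<psi> x \<partial>lborel)" for t
  proof -
    have "(\<lambda>x. lev v t x) \<in> borel_measurable borel" unfolding lev_def by measurable
    then have i: "integrable lborel (\<lambda>x. lev v t x * \<psi> x)"
      by (rule psi_mult_integrable[where M = 1]) (simp add: lev_def)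
    have "z x t = lev v t x * \<psi> x - of_bool (t < 0) * \<psi> x" for x
      unfolding z_def lev_def by (simp add: left_diff_distrib)
    moreover have "(\<integral>x. \<psi> x \<partial>lborel) = 0" using integral_mult_psi_fst(2)[of "\<lambda>_. 1" 1] by simp
    ultimately show ?thesis using i psi_integrable by simp
  qed
  ultimately have "(\<integral>x. v x * \<psi> x \<partial>lborel) = (\<integral>t. (\<integral>x. lev v t x * \<psi> x \<partial>lborel) \<partial>lborel)" by simp
  also have "\<dots> = (\<integral>t. S t \<partial>lborel)"
  proof (rule integral_cong_AE)
    show "(\<lambda>t. \<integral>x. lev v t x * \<psi> x \<partial>lborel) \<in> borel_measurable lborel"
      unfolding lev_def by (rule lborel.borel_measurable_lebesgue_integral) measurable
  qed (use assms in auto)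
  finally show ?thesis .
qed

end

section \<open>The structure theorem\<close>

lemma corner_data_mono:
  "corner_data Q w P c F \<Longrightarrow> Q' \<subseteq> Q \<Longrightarrow> corner_data Q' w P c F"
  unfolding corner_data_def by (meson order_trans)

text \<open>The test function lives in a compact rectangle, where \<open>u\<close> is integrable and
  agrees with \<open>v\<close> almost everywhere. The pairing on the open box thus becomes an
  integral of Borel functions over the plane.\<close>

lemma weak_mixed_derivative_eq:
  fixes u v :: "pt \<Rightarrow> real"
  assumes u: "L1_loc ({a1<..<b1} \<times> {a2<..<b2}) u"
      "(\<lambda>x. indicator ({a1<..<b1} \<times> {a2<..<b2}) x *\<^sub>R u x) \<in> borel_measurable lebesgue"
    and v: "v \<in> borel_measurable borel" "AE x in lebesgue. x \<in> {a1<..<b1} \<times> {a2<..<b2} \<longrightarrow> u x = v x"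
    and box: "a1 < \<alpha>1" "\<beta>1 < b1" "a2 < \<alpha>2" "\<beta>2 < b2" and tf: "box_test_fun \<phi> \<alpha>1 \<beta>1 \<alpha>2 \<beta>2"
  shows "integrable lborel (\<lambda>x. v x * pd2 (pd1 \<phi>) x)"
    and "(LINT x:({a1<..<b1} \<times> {a2<..<b2})|lebesgue. u x * pd2 (pd1 \<phi>) x) = (\<integral>x. v x * pd2 (pd1 \<phi>) x \<partial>lborel)"
proof -
  interpret box_test_fun \<phi> \<alpha>1 \<beta>1 \<alpha>2 \<beta>2 by (rule tf)
  let ?\<Omega> = "{a1<..<b1} \<times> {a2<..<b2}" and ?R = "{\<alpha>1..\<beta>1} \<times> {\<alpha>2..\<beta>2}"
  have R: "?R \<subseteq> ?\<Omega>" using box by auto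
  have psi_borel: "\<psi> \<in> borel_measurable borel" by (rule borel_measurable_continuous_onI[OF continuous(3)])
  then have psi_leb: "\<psi> \<in> borel_measurable lebesgue" by (intro measurable_completion) simp
  have vpsi: "(\<lambda>x. v x * \<psi> x) \<in> borel_measurable lborel" using v(1) psi_borel by simp
  have eq: "AE x in lebesgue. indicator ?R x *\<^sub>R u x * \<psi> x = v x * \<psi> x"
    using v(2)
  proof eventually_elim
    case (elim x)
    show ?case using elim R supp2[of x] by (cases "x \<in> ?R") auto
  qed
  obtain M where M: "\<And>x. \<bar>\<psi> x\<bar> \<le> M" by (rule bounded[OF continuous(3) supp2]) (assumption, rule that, assumption)
  have "compact ?R" by (intro compact_Times compact_Icc)
  then have "set_integrable lebesgue ?R u"
    using u(1) R unfolding L1_loc_def by blast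
  then have uR: "integrable lebesgue (\<lambda>x. indicator ?R x *\<^sub>R u x)" unfolding set_integrable_def .
  have "integrable lebesgue (\<lambda>x. indicator ?R x *\<^sub>R u x * \<psi> x)"
  proof (rule Bochner_Integration.integrable_bound)
    show "integrable lebesgue (\<lambda>x. M * (indicator ?R x *\<^sub>R u x))" using uR by (rule integrable_mult_right)
    show "(\<lambda>x. indicator ?R x *\<^sub>R u x * \<psi> x) \<in> borel_measurable lebesgue"
      using borel_measurable_integrable[OF uR] psi_leb by (rule borel_measurable_times)
    show "AE x in lebesgue. norm (indicator ?R x *\<^sub>R u x * \<psi> x) \<le> norm (M * (indicator ?R x *\<^sub>R u x))"
    proof (rule AE_I2)
      fix x
      have "\<bar>\<psi> x\<bar> \<le> \<bar>M\<bar>" using M[of x] by linarith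
      then have "\<bar>indicator ?R x *\<^sub>R u x\<bar> * \<bar>\<psi> x\<bar> \<le> \<bar>indicator ?R x *\<^sub>R u x\<bar> * \<bar>M\<bar>" by (intro mult_left_mono) auto
      then show "norm (indicator ?R x *\<^sub>R u x * \<psi> x) \<le> norm (M * (indicator ?R x *\<^sub>R u x))"
        by (simp only: real_norm_def abs_mult mult.commute)
    qed
  qed
  then have "integrable lebesgue (\<lambda>x. v x * \<psi> x)"
    by (rule integrable_cong_AE_imp) (use vpsi eq in \<open>auto intro: measurable_completion\<close>)
  then show "integrable lborel (\<lambda>x. v x * pd2 (pd1 \<phi>) x)"
    using integrable_completion[OF vpsi] by (simp add: \<psi>_def)
  have "(LINT x:?\<Omega>|lebesgue. u x * \<psi> x) = (\<integral>x. v x * \<psi> x \<partial>lebesgue)"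
    unfolding set_lebesgue_integral_def
  proof (rule integral_cong_AE)
    have "(\<lambda>x. indicator ?\<Omega> x *\<^sub>R (u x * \<psi> x)) = (\<lambda>x. indicator ?\<Omega> x *\<^sub>R u x * \<psi> x)"
      by (simp add: mult.assoc)
    also have "\<dots> \<in> borel_measurable lebesgue" using u(2) psi_leb by (rule borel_measurable_times)
    finally show "(\<lambda>x. indicator ?\<Omega> x *\<^sub>R (u x * \<psi> x)) \<in> borel_measurable lebesgue" .
    show "(\<lambda>x. v x * \<psi> x) \<in> borel_measurable lebesgue" using vpsi by (rule measurable_completion)
    show "AE x in lebesgue. indicator ?\<Omega> x *\<^sub>R (u x * \<psi> x) = v x * \<psi> x"
      using v(2)
    proof eventually_elim
      case (elim x)
      show ?case using elim R supp2[of x] by (cases "x \<in> ?\<Omega>") auto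
    qed
  qed
  also have "\<dots> = (\<integral>x. v x * \<psi> x \<partial>lborel)" by (rule integral_completion[OF vpsi])
  finally show "(LINT x:?\<Omega>|lebesgue. u x * pd2 (pd1 \<phi>) x) = (\<integral>x. v x * pd2 (pd1 \<phi>) x \<partial>lborel)"
    by (simp add: \<psi>_def)
qed

text \<open>The signed measure is represented as a difference of two finite measures. Both are
  carried by the same \<open>A\<close>, which is the identity of the signed measure with its
  restriction.\<close>

theorem theorem1p7:
  fixes \<theta>1 \<theta>2 :: real and \<rho> u :: "real \<times> real \<Rightarrow> real"
    and a1 b1 a2 b2 :: real
  assumes "\<theta>1 > 0" "\<theta>2 > 0" "\<theta>1 + \<theta>2 = 1"
    and "integrable lebesgue \<rho>" "\<forall>z. \<rho> z \<ge> 0"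
    and "\<forall>z w. norm z = norm w \<longrightarrow> \<rho> z = \<rho> w"
    and "\<forall>z. norm z \<ge> 1 \<longrightarrow> \<rho> z = 0"
    and "(\<integral>z. \<rho> z \<partial>lebesgue) = 1"
    and "a1 < b1" "a2 < b2"
    and "L1_loc ({a1<..<b1} \<times> {a2<..<b2}) u"
    and "energy \<theta>1 \<theta>2 \<rho> {a1<..<b1} {a2<..<b2} u < \<infinity>"
  shows "\<exists>Mp Mn :: (real \<times> real) measure.
           sets Mp = sets borel \<and> sets Mn = sets borel \<and>
           finite_measure Mp \<and> finite_measure Mn \<and>
           emeasure Mp (UNIV - {a1<..<b1} \<times> {a2<..<b2}) = 0 \<and>
           emeasure Mn (UNIV - {a1<..<b1} \<times> {a2<..<b2}) = 0 \<and>
           (\<forall>\<phi>. test_fun ({a1<..<b1} \<times> {a2<..<b2}) \<phi> \<longrightarrow>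
              (LINT x:({a1<..<b1} \<times> {a2<..<b2})|lebesgue. u x * pd2 (pd1 \<phi>) x)
                = (\<integral>x. \<phi> x \<partial>Mp) - (\<integral>x. \<phi> x \<partial>Mn)) \<and>
           (\<exists>A. A \<in> sets borel \<and> A \<subseteq> {a1<..<b1} \<times> {a2<..<b2} \<and>
              hausdorff1_sigma_finite_on A \<and>
              emeasure Mp (UNIV - A) = 0 \<and> emeasure Mn (UNIV - A) = 0)"
proof -
  let ?\<Omega> = "{a1<..<b1} \<times> {a2<..<b2}"
  obtain v where v: "v \<in> borel_measurable borel" "AE x in lebesgue. x \<in> ?\<Omega> \<longrightarrow> u x = v x"
    and u_meas: "(\<lambda>x. indicator ?\<Omega> x *\<^sub>R u x) \<in> borel_measurable lebesgue"
    by (rule L1_loc_borel_version[OF assms(11)])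
  obtain C \<epsilon> h k where C: "0 < C" and \<epsilon>: "\<epsilon> \<longlonglongrightarrow> 0" and h: "\<And>n. 0 < h n \<and> h n \<le> \<epsilon> n"
    and k: "\<And>n. 0 < k n \<and> k n \<le> \<epsilon> n"
    and steps: "\<And>n s r. s \<in> {-1,1} \<Longrightarrow> r \<in> {-1,1} \<Longrightarrow>
       (\<integral>\<^sup>+x. indicator ({a1 + \<epsilon> n<..<b1 - \<epsilon> n} \<times> {a2 + \<epsilon> n<..<b2 - \<epsilon> n}) x *
         ennreal (min \<bar>v (x + (s * h n, 0)) - v x\<bar> \<bar>v (x + (0, r * k n)) - v x\<bar>) \<partial>lborel)
       \<le> ennreal (C * h n * k n)"
    by (rule energy_steps[OF assms(1-8) v assms(12)]) (rule that, assumption+)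
  obtain K q r where q: "q \<in> unit_square" and r: "(\<lambda>n. \<epsilon> (r n)) \<longlonglongrightarrow> 0"
    and lim: "AE x in lborel. x \<in> ?\<Omega> \<longrightarrow> (\<lambda>n. v (lat (h (r n)) (k (r n)) q x)) \<longlonglongrightarrow> v x"
    and sums: "\<And>n S. finite S \<Longrightarrow>
       node (h (r n)) (k (r n)) q ` S \<subseteq> {a1 + \<epsilon> (r n)<..<b1 - \<epsilon> (r n)} \<times> {a2 + \<epsilon> (r n)<..<b2 - \<epsilon> (r n)} \<Longrightarrow>
       (\<Sum>p\<in>S. step_energy v (h (r n)) (k (r n)) (node (h (r n)) (k (r n)) q p)) \<le> K"
    by (rule lattice_selection[OF v(1) C \<epsilon> h k steps]) (assumption+, rule that, assumption+)
  obtain G L where G: "G \<subseteq> ?\<Omega>" "AE x in lborel. x \<in> ?\<Omega> \<longrightarrow> x \<in> G"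
    and L: "L \<in> borel_measurable borel" "(\<integral>\<^sup>+t. L t \<partial>lborel) \<le> ennreal K"
    and levels: "\<And>t. L t < \<infinity> \<Longrightarrow> \<exists>P c F. corner_data {x\<in>G. v x \<noteq> t} (lev v t) P c F \<and>
       P \<subseteq> ?\<Omega> \<and> ennreal (\<Sum>p\<in>P. \<bar>c p\<bar>) \<le> 4 * L t"
    by (rule level_structure[OF q r h k lim sums]) (assumption+, rule that, assumption+)
  obtain X1 X2 where X: "countable X1" "countable X2" "X1 \<subseteq> {a1<..<b1}" "X2 \<subseteq> {a2<..<b2}"
    "dense_in X1 a1 b1" "dense_in X2 a2 b2" "X1 \<times> X2 \<subseteq> G"
    by (rule dense_grid[OF G(2)])
  \<comment> \<open>Removing the countably many values of \<open>v\<close> on the grid makes every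
    grid point an admissible vertex for all remaining levels simultaneously.\<close>
  define E where "E = v ` (X1 \<times> X2)"
  have E: "countable E" unfolding E_def using X by (intro countable_image countable_SIGMA)
  define T where "T = {t. L t < \<infinity>} - E"
  have "{t \<in> space borel. L t < \<infinity>} \<in> sets borel" using L(1) by measurable
  moreover have "E \<in> sets borel" by (rule sets.countable[OF _ E]) simp
  ultimately have T: "T \<in> sets borel" unfolding T_def by auto
  have ae_T: "AE t in lborel. t \<in> T"
  proof -
    have "(\<integral>\<^sup>+t. L t \<partial>lborel) \<noteq> \<infinity>" using L(2) by (metis ennreal_less_top infinity_ennreal_def leD)
    then have "AE t in lborel. L t \<noteq> \<infinity>" using L(1) by (intro nn_integral_PInf_AE) auto
    moreover have "AE t in lborel. t \<notin> E" by (intro AE_not_in countable_imp_null_set_lborel E)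
    ultimately show ?thesis by eventually_elim (simp add: T_def less_top)
  qed
  \<comment> \<open>Corners, weights and forbidden lines are chosen as one triple, so that they
    belong together at each level.\<close>
  have "\<forall>t\<in>T. \<exists>d. corner_data {x\<in>G. v x \<noteq> t} (lev v t) (fst d) (fst (snd d)) (snd (snd d)) \<and>
       fst d \<subseteq> ?\<Omega> \<and> ennreal (\<Sum>p\<in>fst d. \<bar>fst (snd d) p\<bar>) \<le> 4 * L t"
  proof
    fix t assume "t \<in> T"
    then obtain P c F where "corner_data {x\<in>G. v x \<noteq> t} (lev v t) P c F \<and>
       P \<subseteq> ?\<Omega> \<and> ennreal (\<Sum>p\<in>P. \<bar>c p\<bar>) \<le> 4 * L t" using levels unfolding T_def by blast
    then show "\<exists>d. corner_data {x\<in>G. v x \<noteq> t} (lev v t) (fst d) (fst (snd d)) (snd (snd d)) \<and>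
       fst d \<subseteq> ?\<Omega> \<and> ennreal (\<Sum>p\<in>fst d. \<bar>fst (snd d) p\<bar>) \<le> 4 * L t"
      by (intro exI[of _ "(P, c, F)"]) simp
  qed
  from bchoice[OF this] obtain d where d: "\<And>t. t \<in> T \<Longrightarrow>
      corner_data {x\<in>G. v x \<noteq> t} (lev v t) (fst (d t)) (fst (snd (d t))) (snd (snd (d t))) \<and>
       fst (d t) \<subseteq> ?\<Omega> \<and> ennreal (\<Sum>p\<in>fst (d t). \<bar>fst (snd (d t)) p\<bar>) \<le> 4 * L t" by blast
  define P where "P t = fst (d t)" for t
  define c where "c t = fst (snd (d t))" for t
  define F where "F t = snd (snd (d t))" for t
  have level: "corner_data {x\<in>G. v x \<noteq> t} (lev v t) (P t) (c t) (F t)" "P t \<subseteq> ?\<Omega>"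
    "ennreal (\<Sum>p\<in>P t. \<bar>c t p\<bar>) \<le> 4 * L t" if "t \<in> T" for t
    using d[OF that] unfolding P_def c_def F_def by auto
  interpret corner_family a1 b1 a2 b2 X1 X2 v T P c F
  proof
    show "corner_data (X1 \<times> X2) (lev v t) (P t) (c t) (F t)" if t: "t \<in> T" for t
    proof (rule corner_data_mono[OF level(1)[OF t]])
      show "X1 \<times> X2 \<subseteq> {x\<in>G. v x \<noteq> t}" using X(7) t unfolding T_def E_def by auto
    qed
    show "P t \<subseteq> ?\<Omega>" if "t \<in> T" for t by (rule level(2)[OF that])
  qed (use X T in auto)
  have fin: "finite_measure (corner_measure s)" if "s = 1 \<or> s = -1" for s
    by (rule corner_measure_finite[OF that level(3) L])
  have rep: "(LINT x:?\<Omega>|lebesgue. u x * pd2 (pd1 \<phi>) x) =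
      (\<integral>x. \<phi> x \<partial>corner_measure 1) - (\<integral>x. \<phi> x \<partial>corner_measure (-1))" if tf: "test_fun ?\<Omega> \<phi>" for \<phi>
  proof -
    obtain \<alpha>1 \<beta>1 \<alpha>2 \<beta>2 where box: "a1 < \<alpha>1" "\<beta>1 < b1" "a2 < \<alpha>2" "\<beta>2 < b2" and "box_test_fun \<phi> \<alpha>1 \<beta>1 \<alpha>2 \<beta>2"
      by (rule test_fun_box[OF tf assms(9,10)])
    then interpret box_test_fun \<phi> \<alpha>1 \<beta>1 \<alpha>2 \<beta>2 by simp
    note weak = weak_mixed_derivative_eq[OF assms(11) u_meas v box box_test_fun_axioms]
    obtain M where M: "\<And>x. \<bar>\<phi> x\<bar> \<le> M" by (rule bounded[OF continuous(1) supp]) (assumption, rule that, assumption)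
    have bi: "has_bochner_integral lborel (\<lambda>t. \<Sum>p\<in>pts t. c t p * \<phi> p)
       (integral\<^sup>L (corner_measure 1) \<phi> - integral\<^sup>L (corner_measure (-1)) \<phi>)"
      by (rule corner_measure_difference[OF fin fin _ M]) (auto intro: borel_measurable_continuous_onI continuous(1))
    have "(\<integral>x. v x * \<psi> x \<partial>lborel) = (\<integral>t. (\<Sum>p\<in>pts t. c t p * \<phi> p) \<partial>lborel)"
    proof (rule layer_cake[OF v(1)])
      show "integrable lborel (\<lambda>x. v x * \<psi> x)" using weak(1) by (simp add: \<psi>_def)
      show "(\<lambda>t. \<Sum>p\<in>pts t. c t p * \<phi> p) \<in> borel_measurable borel"
        using bi by (auto simp: has_bochner_integral_iff dest: borel_measurable_integrable)
      show "AE t in lborel. (\<integral>x. lev v t x * \<psi> x \<partial>lborel) = (\<Sum>p\<in>pts t. c t p * \<phi> p)"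
        \<comment> \<open>For almost every level the points with \<open>v x = t\<close> form a null
          set, so almost every point of the box is an admissible vertex.\<close>
        using ae_T AE_level_null[OF v(1)]
      proof eventually_elim
        case (elim t)
        have "(\<integral>x. lev v t x * \<psi> x \<partial>lborel) = (\<Sum>p\<in>P t. c t p * \<phi> p)"
        proof (rule corner_data_integral[OF level(1)[OF elim(1)] _ _ _ box])
          show "lev v t \<in> borel_measurable borel" unfolding lev_def[abs_def] using v(1) by measurable
          show "\<bar>lev v t x\<bar> \<le> 1" for x by (simp add: lev_def)
          show "AE x in lborel. x \<in> ?\<Omega> \<longrightarrow> x \<in> {x\<in>G. v x \<noteq> t}"
            using G(2) elim(2) by eventually_elim simp
        qed
        then show ?case using elim(1) by (simp add: pts_def)
      qed
    qed
    then show ?thesis using weak(2) has_bochner_integral_integral_eq[OF bi] by (simp add: \<psi>_def)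
  qed
  obtain A where A: "A \<in> sets borel" "A \<subseteq> ?\<Omega>" "hausdorff1_sigma_finite_on A" "\<forall>t\<in>T. P t \<subseteq> A"
    using sigma_finite_carrier by blast
  have "?\<Omega> \<in> sets borel" by (simp add: open_Times)
  then have outside: "emeasure (corner_measure s) (UNIV - ?\<Omega>) = 0" for s
    by (rule emeasure_corner_measure_outside) (rule P_subset)
  have outside_A: "emeasure (corner_measure s) (UNIV - A) = 0" for s
    by (rule emeasure_corner_measure_outside[OF A(1)]) (use A(4) in blast)
  show ?thesis
    by (rule exI[of _ "corner_measure 1"], rule exI[of _ "corner_measure (-1)"])
      (intro conjI allI impI exI[of _ A] sets_corner_measure fin outside outside_A rep A(1-3); simp)
qed

end
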